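(* Let $W$ be a finite set of equivalence classes of words in $\{L,R\}^*$ not containing $[L^n]$ for any $n$. Then the restricted random variables $\left(Z_{N,[w]}\right)\vert_{g=\frac{N+1}{2}}$, $[w]\in W$, satisfy $$\left(Z_{N,[w]}\right)\vert_{g=\frac{N+1}{2}}\longrightarrow Z_{[w]}\quad\text{in distribution (jointly for all }[w]\in W)\text{ as } N\to\infty,\ N\text{ odd},$$ where the $Z_{[w]}$, $[w]\in W$, are independent $\mathbb{N}$-valued Poisson distributed random variables, $Z_{[w]}$ having mean $\lambda_{[w]}=\frac{|[w]|}{2|w|}$.
   Context: Random surfaces: for $N\ge 1$ let $\Omega_N$ be the set of partitions of $\{1,\ldots,6N\}$ into pairs, with the uniform probability measure $\mathbb{P}_N$. Given $\omega\in\Omega_N$, take $2N$ oriented triangles, the $j$-th having its sides labelled $3j-2,3j-1,3j$ in the cyclic order given by the orientation, and glue the sides in pairs as prescribed by $\omega$ so that the result is an oriented closed surface $S(\omega)$ with orientation compatible with those of the triangles. $\Gamma(\omega)$ is the cubic graph dual to the triangulation (one vertex per triangle, one edge per pair in $\omega$; loops and multiple edges allowed). The cyclic order of the half-edges at each vertex gives a notion of turning left or right when a path traverses a vertex: going from half-edge $i$ to its successor in the cyclic order $3j-2\to 3j-1\to 3j\to 3j-2$ is a left turn. $LHT(\omega)$ is the number of left hand turn cycles of $\Gamma(\omega)$ (closed paths turning left at every vertex), i.e. the number of vertices of the triangulation. Equivalently, with $\sigma=(1\,2\,3)\cdots(6N-2\;6N-1\;6N)$ and $\tau$ the fixed-point-free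 involution given by $\omega$, it is the number of cycles of $\sigma\tau$. The genus is $g(\omega)=1+\frac N2-\frac{LHT(\omega)}2$; thus $g(\omega)=\frac{N+1}2$ means $LHT(\omega)=1$ (in which case $S(\omega)$ is connected). Words: $\{L,R\}^*$ is the set of (nonempty) words in two letters $L,R$; $|w|$ is the length of $w$. Two words $w,w'$ are equivalent if $w'$ is a cyclic permutation of $w$ or of $w^*$, where $w^*$ is obtained by reading $w$ backwards and exchanging $L$ and $R$. $[w]$ is the set of words equivalent to $w$ and $|[w]|$ its cardinality. A circuit on a graph is a closed path meeting each of its vertices and edges at most once (counted without base point or direction). It carries $w$ if the sequence of left ($L$) and right ($R$) turns along it, read from some starting vertex in some direction, is a word in $[w]$. $Z_{N,[w]}(\omega)$ is the number of circuits on $\Gamma(\omega)$ that carry $w$. $\left(Z_{N,[w]}\right)\vert_{g=\frac{N+1}{2}}$ is the restriction of $Z_{N,[w]}$ to $\{\omega\in\Omega_N: g(\omega)=\frac{N+1}{2}\}$ with the uniform (conditional) probability measure. *)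

theory Defs
  imports "HOL-Probability.Probability" "HOL-Combinatorics.Combinatorics"
begin

section \<open>Convergence in distribution\<close>

definition conv_in_distribution ::
  "('i \<Rightarrow> 'a measure) \<Rightarrow> ('i \<Rightarrow> 'a \<Rightarrow> 'c::topological_space) \<Rightarrow> 'b measure \<Rightarrow> ('b \<Rightarrow> 'c) \<Rightarrow> 'i filter \<Rightarrow> bool"
  where
  "conv_in_distribution Ms Xs M X F \<longleftrightarrow>
     (\<forall>f :: 'c \<Rightarrow> real. continuous_on UNIV f \<and> bounded (range f) \<longrightarrow>
        ((\<lambda>n. \<integral>\<omega>. f (Xs n \<omega>) \<partial>Ms n) \<longlongrightarrow> (\<integral>\<omega>. f (X \<omega>) \<partial>M)) F)"


section \<open>Words in two letters\<close>

datatype letter = L | R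

fun swap_letter :: "letter \<Rightarrow> letter" where
  "swap_letter L = R"
| "swap_letter R = L"

definition word_star :: "letter list \<Rightarrow> letter list" where
  "word_star w = rev (map swap_letter w)"

definition word_class :: "letter list \<Rightarrow> letter list set" where
  "word_class w = {w'. \<exists>k. w' = rotate k w \<or> w' = rotate k (word_star w)}"

definition word_classes :: "letter list set set" where
  "word_classes = word_class ` {w. w \<noteq> []}"

text \<open>All words in a class have the same length, so \<open>length ` A\<close> is a singleton.\<close>

definition class_mean :: "letter list set \<Rightarrow> real" where
  "class_mean A = real (card A) / (2 * real (the_elem (length ` A)))"


section \<open>Random gluings of triangles\<close>

text \<open>
  The side \<open>i\<close> of a triangle, with \<open>1 \<le> i \<le> 6 N\<close>, is identified with the half-edge of the dual
  graph that crosses it. The edges of the dual graph are thus the elements of \<open>\<omega>\<close>, and its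
  vertices are the triangles \<open>1, \<dots>, 2 N\<close>.
\<close>

definition gluings :: "nat \<Rightarrow> nat set set set" where
  "gluings N = {\<omega>. partition_on {1..6 * N} \<omega> \<and> (\<forall>e\<in>\<omega>. card e = 2)}"

definition triangle_of :: "nat \<Rightarrow> nat" where
  "triangle_of i = (i + 2) div 3"

text \<open>The permutation \<open>3j-2 \<mapsto> 3j-1 \<mapsto> 3j \<mapsto> 3j-2\<close>.\<close>

definition next_side :: "nat \<Rightarrow> nat" where
  "next_side i = (if 3 dvd i then i - 2 else i + 1)"

definition partner :: "nat set set \<Rightarrow> nat \<Rightarrow> nat" where
  "partner \<omega> i = (THE j. j \<noteq> i \<and> {i, j} \<in> \<omega>)"

text \<open>
  Crossing the edge at the half-edge \<open>i\<close> and then turning left leads to the half-edge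
  \<open>next_side (partner \<omega> i)\<close>; fixed points of this permutation are cycles of length one.
\<close>

definition LHT :: "nat \<Rightarrow> nat set set \<Rightarrow> nat" where
  "LHT N \<omega> = card (orbit (next_side \<circ> partner \<omega>) ` {1..6 * N})"

definition genus :: "nat \<Rightarrow> nat set set \<Rightarrow> real" where
  "genus N \<omega> = 1 + real N / 2 - real (LHT N \<omega>) / 2"

definition max_genus_gluings :: "nat \<Rightarrow> nat set set set" where
  "max_genus_gluings N = {\<omega> \<in> gluings N. genus N \<omega> = (real N + 1) / 2}"


section \<open>Circuits and the words they carry\<close>

text \<open>
  A closed path with a base point and a direction is given by the list of its passages through
  vertices: \<open>(i, j)\<close> stands for entering a vertex through the half-edge \<open>i\<close> and leaving it
  through \<open>j\<close>. Loops (lists of length one) and pairs of parallel edges (length two) are included.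
\<close>

definition path_edges :: "(nat \<times> nat) list \<Rightarrow> nat set list" where
  "path_edges p = map (\<lambda>k. {snd (p ! k), fst (p ! (Suc k mod length p))}) [0..<length p]"

definition circuit_path :: "nat set set \<Rightarrow> (nat \<times> nat) list \<Rightarrow> bool" where
  "circuit_path \<omega> p \<longleftrightarrow> p \<noteq> [] \<and>
     (\<forall>(i, j)\<in>set p. i \<noteq> j \<and> triangle_of i = triangle_of j) \<and>
     set (path_edges p) \<subseteq> \<omega> \<and>
     distinct (map (\<lambda>(i, j). triangle_of i) p) \<and>
     distinct (path_edges p)"

definition reverse_path :: "(nat \<times> nat) list \<Rightarrow> (nat \<times> nat) list" where
  "reverse_path p = rev (map prod.swap p)"

text \<open>Forgetting the base point and the direction.\<close>

definition circuit_of :: "(nat \<times> nat) list \<Rightarrow> (nat \<times> nat) list set" where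
  "circuit_of p = {q. \<exists>k. q = rotate k p \<or> q = rotate k (reverse_path p)}"

definition circuits :: "nat set set \<Rightarrow> (nat \<times> nat) list set set" where
  "circuits \<omega> = circuit_of ` {p. circuit_path \<omega> p}"

fun turn :: "nat \<times> nat \<Rightarrow> letter" where
  "turn (i, j) = (if j = next_side i then L else R)"

definition carries :: "(nat \<times> nat) list set \<Rightarrow> letter list set \<Rightarrow> bool" where
  "carries C A \<longleftrightarrow> (\<exists>p\<in>C. map turn p \<in> A)"

definition Z :: "letter list set \<Rightarrow> nat set set \<Rightarrow> nat" where
  "Z A \<omega> = card {C \<in> circuits \<omega>. carries C A}"

end

(*
  For a permutation p of n points, the sum of (-1)^|U| sgn(p|U) (n - |U|) over the p-invariant sets U
  is n if p is an n-cycle and 0 otherwise. With p = s o t this is averaged over all fixed-point-free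
  involutions t. Conjugating t by a transposition of two points that s maps out of U flips the sign, so
  only those U survive that are left by at most one point, i.e. unions of cycles of s, possibly together
  with an arc of one further cycle. The result is
    n #{t. s o t is an n-cycle} = Lam ((1 + y) prod_c (1 - y^|c|) / (1 - y)),
  where c runs over the cycles of s and Lam (y^k) = (-1)^(k/2) m(k) m(n - k) for even k, m(k) being the
  number of perfect matchings of k points. If all cycles of s but a bounded number of points are
  3-cycles, only the terms k = 0 and k = n matter, so a fraction of about 2/n of the matchings gives an
  n-cycle, provided that the parity is right.

  Prescribing the pairs of a partial matching amounts to removing their points from s one at a time,
  which leaves the other 3-cycles alone. Hence the conditional probability that a one-vertex gluing
  contains e given pairs is asymptotic to (6N)^(-e), or it is 0 if these pairs already close a face.
  Disjoint circuits that contain both turns never close a face, and intersecting circuits have more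
  edges than vertices, so they do not contribute to the limit. The joint factorial moments therefore
  converge to those of independent Poisson variables, and Bonferroni's inequalities conclude.
*)

theory Submission
  imports Defs "HOL-Real_Asymp.Real_Asymp"
begin

section \<open>Cycles of permutations\<close>

text \<open>The plain signed sum over the invariant sets of p is E(1), where E is the product of 1 -
  y^|c| over the cycles c of p, and this vanishes for every p on a nonempty set. The factor n - |U|
  replaces it by n E(1) - E'(1), and E has a simple zero at 1 exactly when p is an n-cycle. The same
  factor makes the arcs tractable: n - |U| times m(n - |U| - 1) is m(n - |U| + 1), so a set
  containing an arc contributes a value of Lam at exponent |U| - 1. The contributions of arcs and of
  invariant sets then live on the same scale, and what separates their total from the stated formula
  is killed by one linear relation that Lam satisfies. Conditioning on a single vertex destroys the
  explicit probabilities of a uniform matching. Moreover the number of candidate circuit tuples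
  grows like a power of N, so every estimate for a prescribed partial matching has to be uniform in
  that partial matching. This is why the counts come with explicit error bounds that depend only on
  the number of prescribed pairs.\<close>

definition single_cycle :: "'a set \<Rightarrow> ('a \<Rightarrow> 'a) \<Rightarrow> bool" where
  "single_cycle S p \<longleftrightarrow> (\<forall>X\<subseteq>S. p ` X = X \<longrightarrow> X = {} \<or> X = S)"

lemma single_cycleD: "single_cycle S p \<Longrightarrow> X \<subseteq> S \<Longrightarrow> p ` X = X \<Longrightarrow> X = {} \<or> X = S"
  by (auto simp: single_cycle_def)

lemma image_eq_of_subset:
  assumes "finite X" "inj p" "\<And>x. x \<in> X \<Longrightarrow> p x \<in> X"
  shows "p ` X = X"
  using assms by (intro endo_inj_surj) (auto intro: inj_on_subset)

lemma single_cycle_cong: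
  assumes "\<And>x. x \<in> S \<Longrightarrow> p x = q x"
  shows "single_cycle S p \<longleftrightarrow> single_cycle S q"
proof -
  have "p ` X = q ` X" if "X \<subseteq> S" for X using assms that by (intro image_cong) auto
  then show ?thesis by (auto simp: single_cycle_def)
qed

text \<open>The predecessor of x is redirected to \<open>p x\<close>, and x becomes a fixed point.
  The transposition stands on the left, so that for every t fixing x, removal from
  \<open>p \<circ> t\<close> gives \<open>remove_point x p \<circ> t\<close>.\<close>

definition remove_point :: "'a \<Rightarrow> ('a \<Rightarrow> 'a) \<Rightarrow> 'a \<Rightarrow> 'a" where
  "remove_point x p = Transposition.transpose x (p x) \<circ> p"

lemma remove_point_apply:
  assumes "inj p" "y \<noteq> x"
  shows "remove_point x p y = (if p y = x then p x else p y)"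
  using assms by (auto simp: remove_point_def Transposition.transpose_def dest: injD)

lemma remove_point_permutes:
  assumes "p permutes S" "x \<in> S"
  shows "remove_point x p permutes (S - {x})"
proof -
  have "remove_point x p permutes S"
    unfolding remove_point_def using assms
    by (intro permutes_compose permutes_swap_id) (auto simp: permutes_in_image)
  then show ?thesis by (rule permutes_superset) (use assms in \<open>auto simp: remove_point_def\<close>)
qed

lemma sign_remove_point:
  assumes "p permutes S" "finite S" "p x \<noteq> x"
  shows "sign (remove_point x p) = - sign p"
  unfolding remove_point_def using assms
  by (subst sign_compose) (auto simp: sign_swap_id permutation_swap_id intro: permutes_imp_permutation)

text \<open>If \<open>p x\<close> lies in X, then only the predecessor of x can leave X, and adding
  x repairs this. If not, no point of X is mapped to x, because splicing would send it to
  \<open>p x\<close>, outside X.\<close>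

lemma invariant_remove_point:
  assumes p: "p permutes S" and fin: "finite S" and X: "X \<subseteq> S - {x}" and inv: "remove_point x p ` X = X"
  shows "p ` X = X \<or> p ` insert x X = insert x X"
proof -
  note inj = permutes_inj[OF p]
  have fX: "finite X" using X fin finite_subset by blast
  have rx: "remove_point x p y = (if p y = x then p x else p y)" if "y \<in> X" for y
    by (rule remove_point_apply[OF inj]) (use that X in auto)
  have inX: "remove_point x p y \<in> X" if "y \<in> X" for y using inv that by blast
  show ?thesis
  proof (cases "p x \<in> X")
    case True
    have "p y \<in> insert x X" if "y \<in> insert x X" for y
      using that True rx[of y] inX[of y] by (cases "y = x"; cases "p y = x") auto
    then have "p ` insert x X = insert x X" using fX by (intro image_eq_of_subset inj) auto
    then show ?thesis ..
  next
    case False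
    have "p y \<in> X" if "y \<in> X" for y
      using that False rx[of y] inX[of y] by (cases "p y = x") auto
    then have "p ` X = X" using fX by (intro image_eq_of_subset inj) auto
    then show ?thesis ..
  qed
qed

text \<open>Adding or deleting x matches the invariant sets of the two permutations;
  \<open>p x \<noteq> x\<close> keeps x from being a cycle of its own.\<close>

lemma single_cycle_remove_point:
  assumes p: "p permutes S" and fin: "finite S" and x: "x \<in> S" and px: "p x \<noteq> x"
  shows "single_cycle (S - {x}) (remove_point x p) \<longleftrightarrow> single_cycle S p"
proof
  assume sc: "single_cycle S p"
  show "single_cycle (S - {x}) (remove_point x p)"
    unfolding single_cycle_def
  proof (intro allI impI)
    fix X assume X: "X \<subseteq> S - {x}" "remove_point x p ` X = X"
    from invariant_remove_point[OF p fin X]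
    show "X = {} \<or> X = S - {x}"
    proof
      assume "p ` X = X"
      then show ?thesis using single_cycleD[OF sc, of X] X x by auto
    next
      assume "p ` insert x X = insert x X"
      then show ?thesis using single_cycleD[OF sc, of "insert x X"] X x by auto
    qed
  qed
next
  assume sc: "single_cycle (S - {x}) (remove_point x p)"
  note inj = permutes_inj[OF p]
  have injr: "inj (remove_point x p)" using remove_point_permutes[OF p x] permutes_inj by blast
  show "single_cycle S p"
    unfolding single_cycle_def
  proof (intro allI impI)
    fix X assume X: "X \<subseteq> S" "p ` X = X"
    have fX: "finite X" using X fin finite_subset by blast
    have pX: "p y \<in> X \<longleftrightarrow> y \<in> X" for y using X(2) inj by (metis image_iff injD)
    have "remove_point x p ` (X - {x}) = X - {x}"
    proof (rule image_eq_of_subset)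
      fix y assume y: "y \<in> X - {x}"
      then have "remove_point x p y = (if p y = x then p x else p y)" using remove_point_apply[OF inj] by auto
      then show "remove_point x p y \<in> X - {x}" using y pX px by (auto split: if_splits)
    qed (use fX injr in auto)
    then have "X - {x} = {} \<or> X - {x} = S - {x}" using single_cycleD[OF sc, of "X - {x}"] X by auto
    then show "X = {} \<or> X = S"
    proof
      assume "X - {x} = {}"
      then show ?thesis using pX[of x] px by (cases "x \<in> X") auto
    next
      assume *: "X - {x} = S - {x}"
      have "p x \<in> S" using p x by (simp add: permutes_in_image)
      then have "p x \<in> X" using * px by blast
      then have "x \<in> X" using pX by simp
      then show ?thesis using * x by blast
    qed
  qed
qed

text \<open>Points are spliced out one at a time, each flipping the sign, until a single fixed point
  is left.\<close>

lemma sign_single_cycle: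
  assumes "finite S" "p permutes S" "single_cycle S p" "S \<noteq> {}"
  shows "sign p = - ((-1) ^ card S)"
  using assms
proof (induction "card S" arbitrary: S p rule: less_induct)
  case less
  obtain x where x: "x \<in> S" using less.prems by blast
  show ?case
  proof (cases "p x = x")
    case True
    then have S: "S = {x}" using single_cycleD[OF less.prems(3), of "{x}"] x by auto
    then have "p = id" using less.prems(2) by (simp add: permutes_sing)
    then show ?thesis using S by simp
  next
    case False
    note p = less.prems(2)
    have px: "p x \<in> S" using p x by (simp add: permutes_in_image)
    have c: "card S = Suc (card (S - {x}))" using x less.prems(1) by (metis card.remove)
    have "sign (remove_point x p) = - ((-1) ^ card (S - {x}))"
    proof (rule less.hyps)
      show "single_cycle (S - {x}) (remove_point x p)"
        using single_cycle_remove_point[OF p less.prems(1) x False] less.prems(3) by blast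
      show "S - {x} \<noteq> {}" using px False by auto
    qed (use c less.prems remove_point_permutes[OF p x] in auto)
    then show ?thesis using sign_remove_point[OF p less.prems(1) False] c by simp
  qed
qed

section \<open>Invariant sets and their generating polynomial\<close>

definition inv_sets :: "'a set \<Rightarrow> ('a \<Rightarrow> 'a) \<Rightarrow> 'a set set" where
  "inv_sets S p = {U. U \<subseteq> S \<and> p ` U = U}"

text \<open>The empty set satisfies \<open>single_cycle\<close>, so it has to be excluded; a fixed
  point counts as a cycle of length one.\<close>

definition cycles :: "'a set \<Rightarrow> ('a \<Rightarrow> 'a) \<Rightarrow> 'a set set" where
  "cycles S p = {U \<in> inv_sets S p. U \<noteq> {} \<and> single_cycle U p}"

text \<open>A k-cycle has sign (-1)^(k-1), so for an invariant U this is (-1) to the number of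
  cycles of p in U. Written with a sign, it visibly changes when p is multiplied by a transposition
  inside U.\<close>

definition wt :: "('a \<Rightarrow> 'a) \<Rightarrow> 'a set \<Rightarrow> real" where
  "wt p U = (-1) ^ card U * of_int (sign (perm_restrict p U))"

lemma finite_inv_sets [simp]: "finite S \<Longrightarrow> finite (inv_sets S p)"
  unfolding inv_sets_def by simp

lemma finite_cycles [simp]: "finite S \<Longrightarrow> finite (cycles S p)"
  unfolding cycles_def by simp

lemma inv_sets_mem_iff: "inj p \<Longrightarrow> U \<in> inv_sets S p \<Longrightarrow> p x \<in> U \<longleftrightarrow> x \<in> U"
  unfolding inv_sets_def by (auto dest: injD)

lemma perm_restrict_permutes:
  assumes "inj p" "p ` U = U"
  shows "perm_restrict p U permutes U"
proof -
  have "bij_betw p U U" using assms by (auto simp: bij_betw_def intro: inj_on_subset)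
  then have "bij_betw (perm_restrict p U) U U" by (subst bij_betw_cong[of _ _ p]) (auto simp: perm_restrict_def)
  then show ?thesis by (auto simp: permutes_altdef perm_restrict_def)
qed

lemma wt_cong: "(\<And>x. x \<in> U \<Longrightarrow> p x = q x) \<Longrightarrow> wt p U = wt q U"
  unfolding wt_def perm_restrict_def by (metis (mono_tags, lifting))

lemma wt_empty [simp]: "wt p {} = 1"
  by (simp add: wt_def perm_restrict_def [abs_def])

lemma wt_Un:
  assumes "inj p" "p ` U = U" "p ` V = V" "U \<inter> V = {}" "finite U" "finite V"
  shows "wt p (U \<union> V) = wt p U * wt p V"
proof -
  have perm: "permutation (perm_restrict p X)" if "p ` X = X" "finite X" for X
    using permutes_imp_permutation[OF that(2) perm_restrict_permutes[OF assms(1) that(1)]] .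
  have pV: "p x \<in> V" if "x \<in> V" for x using assms(3) that by blast
  have "perm_restrict p (U \<union> V) x = (perm_restrict p U \<circ> perm_restrict p V) x" for x
    using pV[of x] assms(4) by (cases "x \<in> V") (auto simp: perm_restrict_def)
  then have "perm_restrict p (U \<union> V) = perm_restrict p U \<circ> perm_restrict p V" ..
  then have "sign (perm_restrict p (U \<union> V)) = sign (perm_restrict p U) * sign (perm_restrict p V)"
    by (simp only: sign_compose[OF perm[OF assms(2,5)] perm[OF assms(3,6)]])
  then show ?thesis
    using assms(4-6) by (simp add: wt_def card_Un_disjoint power_add)
qed

lemma wt_single_cycle:
  assumes "inj p" "p ` U = U" "single_cycle U p" "U \<noteq> {}" "finite U"
  shows "wt p U = -1"
proof -
  have "single_cycle U (perm_restrict p U)"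
    using single_cycle_cong[of U p "perm_restrict p U"] assms by (auto simp: perm_restrict_def)
  then have "sign (perm_restrict p U) = - ((-1) ^ card U)"
    using sign_single_cycle[OF assms(5) perm_restrict_permutes] assms by blast
  then show ?thesis by (simp add: wt_def flip: power_mult_distrib)
qed

text \<open>Descending to ever smaller nonempty invariant subsets of U ends at a cycle.\<close>

lemma ex_cycle:
  assumes "finite S" "U \<in> inv_sets S p" "U \<noteq> {}"
  shows "\<exists>C\<in>cycles S p. C \<subseteq> U"
  using assms(2,3)
proof (induction "card U" arbitrary: U rule: less_induct)
  case less
  have fU: "finite U" using less.prems assms(1) by (auto simp: inv_sets_def intro: finite_subset)
  show ?case
  proof (cases "single_cycle U p")
    case True then show ?thesis using less.prems by (auto simp: cycles_def)
  next
    case False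
    then obtain X where X: "X \<subseteq> U" "p ` X = X" "X \<noteq> {}" "X \<noteq> U" by (auto simp: single_cycle_def)
    then have "card X < card U" using fU by (simp add: psubset_card_mono psubsetI)
    moreover have "X \<in> inv_sets S p" using X less.prems by (auto simp: inv_sets_def)
    ultimately obtain C where "C \<in> cycles S p" "C \<subseteq> X" using less.hyps[of X] X by blast
    then show ?thesis using X by blast
  qed
qed

lemma cycles_subset: "U \<subseteq> S \<Longrightarrow> cycles U p = {C \<in> cycles S p. C \<subseteq> U}"
  by (auto simp: cycles_def inv_sets_def)

lemma cycles_disjoint:
  assumes "inj p" "C \<in> cycles S p" "D \<in> cycles S p" "C \<noteq> D"
  shows "C \<inter> D = {}"
proof -
  have "p ` (C \<inter> D) = C \<inter> D" using assms by (auto simp: image_Int cycles_def inv_sets_def)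
  then show ?thesis using assms single_cycleD[of C p "C \<inter> D"] single_cycleD[of D p "C \<inter> D"]
    by (auto simp: cycles_def)
qed

lemma Union_cycles:
  assumes "finite S" "inj p" "p ` S = S"
  shows "\<Union>(cycles S p) = S"
proof (rule ccontr)
  assume ne: "\<not> ?thesis"
  have sub: "\<Union>(cycles S p) \<subseteq> S" by (auto simp: cycles_def inv_sets_def)
  have "p ` \<Union>(cycles S p) = \<Union>(cycles S p)" by (auto simp: cycles_def inv_sets_def)
  then have "p ` (S - \<Union>(cycles S p)) = S - \<Union>(cycles S p)"
    using assms by (simp add: image_set_diff)
  then have "S - \<Union>(cycles S p) \<in> inv_sets S p" by (auto simp: inv_sets_def)
  moreover have "S - \<Union>(cycles S p) \<noteq> {}" using ne sub by blast
  ultimately obtain C where "C \<in> cycles S p" "C \<subseteq> S - \<Union>(cycles S p)" using ex_cycle[OF assms(1)] by blast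
  then have "C = {}" by blast
  then show False using \<open>C \<in> cycles S p\<close> by (auto simp: cycles_def)
qed

text \<open>Cycles are nonempty and disjoint, so a family of them is recovered from its union;
  conversely an invariant set is covered by its own cycles.\<close>

lemma bij_betw_Union_cycles:
  assumes "finite S" "inj p"
  shows "bij_betw Union (Pow (cycles S p)) (inv_sets S p)"
  unfolding bij_betw_def
proof (intro conjI)
  show "inj_on Union (Pow (cycles S p))"
  proof (rule inj_onI)
    fix A B assume A: "A \<in> Pow (cycles S p)" and B: "B \<in> Pow (cycles S p)" and eq: "\<Union>A = \<Union>B"
    have *: "A' \<subseteq> B'" if "A' \<subseteq> cycles S p" "B' \<subseteq> cycles S p" "\<Union>A' = \<Union>B'" for A' B'
    proof
      fix C assume C: "C \<in> A'"
      then have "C \<noteq> {}" using that by (auto simp: cycles_def)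
      then obtain x where x: "x \<in> C" by blast
      then have "x \<in> \<Union>B'" using C that(3) by blast
      then obtain D where D: "D \<in> B'" "x \<in> D" by blast
      then have "C = D" using cycles_disjoint[OF assms(2), of C S D] that C x by blast
      then show "C \<in> B'" using D by simp
    qed
    show "A = B" using *[of A B] *[of B A] A B eq by blast
  qed
next
  show "Union ` Pow (cycles S p) = inv_sets S p"
  proof (intro set_eqI iffI)
    fix U assume "U \<in> Union ` Pow (cycles S p)"
    then show "U \<in> inv_sets S p" by (fastforce simp: inv_sets_def cycles_def)
  next
    fix U assume U: "U \<in> inv_sets S p"
    then have "\<Union>(cycles U p) = U" using assms by (intro Union_cycles) (auto simp: inv_sets_def intro: finite_subset)
    moreover have "cycles U p \<subseteq> cycles S p" using U by (auto simp: cycles_def inv_sets_def)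
    ultimately show "U \<in> Union ` Pow (cycles S p)" by (metis PowI imageI)
  qed
qed

lemma wt_Union_cycles:
  assumes fin: "finite S" and inj: "inj p" and "A \<subseteq> cycles S p"
  shows "wt p (\<Union>A) = (-1) ^ card A" "card (\<Union>A) = sum card A"
proof -
  have "finite A" using assms finite_cycles finite_subset by metis
  then have "wt p (\<Union>A) = (-1) ^ card A \<and> card (\<Union>A) = sum card A" using assms(3)
  proof (induction rule: finite_induct)
    case (insert C A)
    have C: "C \<in> cycles S p" and A: "A \<subseteq> cycles S p" using insert by auto
    have dis: "C \<inter> \<Union>A = {}" using cycles_disjoint[OF inj C] A insert.hyps by blast
    have "C \<subseteq> S" "\<Union>A \<subseteq> S" using C A by (auto simp: cycles_def inv_sets_def)
    then have fc: "finite C" "finite (\<Union>A)" using finite_subset[OF _ fin] by auto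
    have "p ` \<Union>A = \<Union>A" using A by (fastforce simp: cycles_def inv_sets_def)
    then have "wt p (C \<union> \<Union>A) = wt p C * wt p (\<Union>A)"
      using C dis fc by (intro wt_Un inj) (auto simp: cycles_def inv_sets_def)
    moreover have "wt p C = -1" using C fc by (intro wt_single_cycle inj) (auto simp: cycles_def inv_sets_def)
    ultimately show ?case using insert dis fc by (auto simp: card_Un_disjoint)
  qed simp
  then show "wt p (\<Union>A) = (-1) ^ card A" "card (\<Union>A) = sum card A" by auto
qed

text \<open>For p permuting S this is det(1 - y P) with P the permutation matrix of p on S. Here it
  serves as the generating polynomial of the invariant sets weighted by \<open>wt\<close>.\<close>

definition cycle_poly :: "'a set \<Rightarrow> ('a \<Rightarrow> 'a) \<Rightarrow> real poly" where
  "cycle_poly S p = (\<Prod>C\<in>cycles S p. 1 - monom 1 (card C))"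

lemma prod_neg_monom: "finite A \<Longrightarrow> (\<Prod>C\<in>A. - monom (1::real) (f C)) = monom ((-1) ^ card A) (sum f A)"
  by (induction A rule: finite_induct) (auto simp: mult_monom simp flip: minus_monom)

text \<open>Expanding the product selects a set of cycles; its sign is (-1) to their number, which
  is the weight of their union.\<close>

lemma cycle_poly_eq_sum:
  assumes "finite S" "inj p"
  shows "cycle_poly S p = (\<Sum>U\<in>inv_sets S p. monom (wt p U) (card U))"
proof -
  have "cycle_poly S p = (\<Prod>C\<in>cycles S p. - monom 1 (card C) + 1)"
    by (simp add: cycle_poly_def)
  also have "\<dots> = (\<Sum>A\<in>Pow (cycles S p). (\<Prod>C\<in>A. - monom 1 (card C)) * (\<Prod>C\<in>cycles S p - A. 1))"
    using assms by (subst prod_add) auto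
  also have "\<dots> = (\<Sum>A\<in>Pow (cycles S p). monom (wt p (\<Union>A)) (card (\<Union>A)))"
  proof (rule sum.cong)
    fix A assume "A \<in> Pow (cycles S p)"
    moreover from this have "finite A" using assms finite_subset finite_cycles by (metis PowD)
    ultimately show "(\<Prod>C\<in>A. - monom 1 (card C)) * (\<Prod>C\<in>cycles S p - A. 1) = monom (wt p (\<Union>A)) (card (\<Union>A))"
      using wt_Union_cycles[OF assms, of A] by (simp add: prod_neg_monom)
  qed simp
  also have "\<dots> = (\<Sum>U\<in>inv_sets S p. monom (wt p U) (card U))"
    using sum.reindex_bij_betw[OF bij_betw_Union_cycles[OF assms], of "\<lambda>U. monom (wt p U) (card U)"] by simp
  finally show ?thesis .
qed

lemma single_cycle_iff_cycles:
  assumes "finite S" "inj p" "p ` S = S" "S \<noteq> {}"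
  shows "single_cycle S p \<longleftrightarrow> cycles S p = {S}"
proof
  assume "single_cycle S p"
  then show "cycles S p = {S}" using assms by (auto simp: cycles_def inv_sets_def dest: single_cycleD)
qed (auto simp: cycles_def)

lemma pderiv_sum: "pderiv (\<Sum>x\<in>A. f x) = (\<Sum>x\<in>A. pderiv (f x))"
  by (induction A rule: infinite_finite_induct) (auto simp: pderiv_add)

text \<open>For nonempty S the left side is n E(1) - E'(1) with E = \<open>cycle_poly S p\<close>.
  Every cycle contributes a simple zero at 1, so E'(1) is nonzero only if there is just one cycle,
  and then it equals -n.\<close>

lemma sum_wt_inv_sets:
  assumes "finite S" "p permutes S"
  shows "(\<Sum>U\<in>inv_sets S p. wt p U * (real (card S) - real (card U))) = (if single_cycle S p then real (card S) else 0)"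
proof (cases "S = {}")
  case True then show ?thesis by (simp add: inv_sets_def)
next
  case False
  note inj = permutes_inj[OF assms(2)] and img = permutes_image[OF assms(2)]
  have "(\<Sum>U\<in>inv_sets S p. wt p U * (real (card S) - real (card U)))
      = real (card S) * poly (cycle_poly S p) 1 - poly (pderiv (cycle_poly S p)) 1"
    by (simp add: cycle_poly_eq_sum[OF assms(1) inj] poly_sum poly_monom pderiv_sum pderiv_monom
        sum_distrib_left flip: sum_subtractf) (simp add: algebra_simps)
  also have ne: "cycles S p \<noteq> {}" using Union_cycles[OF assms(1) inj img] False by auto
  then have "poly (cycle_poly S p) 1 = 0"
    using assms by (auto simp: cycle_poly_def poly_prod poly_monom)
  \<comment> \<open>All factors vanish at 1, so with c cycles the factors left after differentiating
    one of them multiply to 0^(c-1), which is 1 only for c = 1.\<close>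
  also have "poly (pderiv (cycle_poly S p)) 1 = - (\<Sum>C\<in>cycles S p. 0 ^ (card (cycles S p) - 1) * real (card C))"
    using assms by (auto simp: cycle_poly_def pderiv_prod poly_sum poly_prod poly_monom pderiv_diff pderiv_monom sum_negf
       intro!: sum.cong)
  also have "(\<Sum>C\<in>cycles S p. 0 ^ (card (cycles S p) - 1) * real (card C)) = (if single_cycle S p then real (card S) else 0)"
  proof (cases "single_cycle S p")
    case True
    then have "cycles S p = {S}" using single_cycle_iff_cycles[OF assms(1) inj img False] by blast
    then show ?thesis using True by simp
  next
    case nsc: False
    have "card (cycles S p) \<noteq> 1"
    proof
      assume "card (cycles S p) = 1"
      then obtain C where "cycles S p = {C}" by (auto simp: card_1_singleton_iff)
      then show False using nsc Union_cycles[OF assms(1) inj img] single_cycle_iff_cycles[OF assms(1) inj img False] by auto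
    qed
    moreover have "card (cycles S p) \<noteq> 0" using ne assms by simp
    ultimately have "card (cycles S p) - 1 \<noteq> 0" by simp
    then show ?thesis using nsc by (simp add: power_0_left)
  qed
  finally show ?thesis by simp
qed

section \<open>Random matchings\<close>

definition fpf_invol :: "'a set \<Rightarrow> ('a \<Rightarrow> 'a) set" where
  "fpf_invol S = {t. t permutes S \<and> (\<forall>x\<in>S. t x \<noteq> x \<and> t (t x) = x)}"

text \<open>The double factorial (n - 1)!! for even n. The value 0 for odd n makes the odd exponents
  drop out of the later sums.\<close>

definition matching_number :: "nat \<Rightarrow> real" where
  "matching_number n = (if even n then fact n / (2 ^ (n div 2) * fact (n div 2)) else 0)"

lemma matching_number_0 [simp]: "matching_number 0 = 1"
  and matching_number_1 [simp]: "matching_number (Suc 0) = 0"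
  by (auto simp: matching_number_def)

lemma matching_number_Suc_Suc: "matching_number (Suc (Suc n)) = (real n + 1) * matching_number n"
proof (cases "even n")
  case True
  then obtain m where n: "n = 2 * m" by (auto elim: evenE)
  show ?thesis by (simp add: matching_number_def n divide_simps)
qed (simp add: matching_number_def)

lemma fpf_involD:
  assumes "t \<in> fpf_invol S"
  shows "t permutes S" "inj t" "t (t x) = x" "x \<in> S \<Longrightarrow> t x \<noteq> x" "t x \<in> S \<longleftrightarrow> x \<in> S" "x \<notin> S \<Longrightarrow> t x = x"
proof -
  show p: "t permutes S" using assms by (simp add: fpf_invol_def)
  show "inj t" "t x \<in> S \<longleftrightarrow> x \<in> S" using p by (auto simp: permutes_inj permutes_in_image)
  show "x \<in> S \<Longrightarrow> t x \<noteq> x" using assms by (simp add: fpf_invol_def)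
  show "x \<notin> S \<Longrightarrow> t x = x" using p by (simp add: permutes_not_in)
  then show "t (t x) = x" using assms by (cases "x \<in> S") (auto simp: fpf_invol_def)
qed

lemma finite_fpf_invol [simp]: "finite S \<Longrightarrow> finite (fpf_invol S)"
  by (rule finite_subset[OF _ finite_permutations[of S]]) (auto simp: fpf_invol_def)

lemma fpf_involI:
  assumes "\<And>x. t (t x) = x" "\<And>x. x \<in> S \<Longrightarrow> t x \<noteq> x" "\<And>x. x \<notin> S \<Longrightarrow> t x = x"
  shows "t \<in> fpf_invol S"
proof -
  have "t permutes S" unfolding permutes_def using assms(1,3) by metis
  then show ?thesis using assms by (auto simp: fpf_invol_def)
qed

lemma perm_restrict_fpf_invol:
  assumes "t \<in> fpf_invol S" "K \<subseteq> S" "t ` K = K"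
  shows "perm_restrict t K \<in> fpf_invol K"
proof -
  have "t x \<in> K" if "x \<in> K" for x using assms(3) that by blast
  then show ?thesis using assms fpf_involD[OF assms(1)]
    by (intro fpf_involI) (auto simp: perm_restrict_def)
qed

lemma comp_fpf_invol:
  assumes g: "g \<in> fpf_invol K" and t: "t \<in> fpf_invol (S - K)" and "K \<subseteq> S"
  shows "g \<circ> t \<in> fpf_invol S" "x \<in> K \<Longrightarrow> (g \<circ> t) x = g x" "x \<notin> K \<Longrightarrow> (g \<circ> t) x = t x"
proof -
  show a: "x \<in> K \<Longrightarrow> (g \<circ> t) x = g x" for x using fpf_involD(6)[OF t] by simp
  show b: "x \<notin> K \<Longrightarrow> (g \<circ> t) x = t x" for x
    using fpf_involD(5,6)[OF t, of x] fpf_involD(6)[OF g, of "t x"] by (cases "x \<in> S") auto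
  have c: "t x \<notin> K" if "x \<notin> K" for x
    using fpf_involD(5,6)[OF t, of x] that by (cases "x \<in> S") auto
  show "g \<circ> t \<in> fpf_invol S"
  proof (rule fpf_involI)
    fix x
    show "(g \<circ> t) ((g \<circ> t) x) = x"
      using a[of x] b[of x] a[of "g x"] b[of "t x"] c[of x] fpf_involD(3,5)[OF g, of x] fpf_involD(3)[OF t, of x]
      by (cases "x \<in> K") auto
    show "x \<in> S \<Longrightarrow> (g \<circ> t) x \<noteq> x"
      using a[of x] b[of x] fpf_involD(4)[OF g, of x] fpf_involD(4)[OF t, of x] by (cases "x \<in> K") auto
    show "x \<notin> S \<Longrightarrow> (g \<circ> t) x = x"
      using b[of x] fpf_involD(6)[OF t, of x] assms(3) by auto
  qed
qed

text \<open>The supports of g and t are disjoint, so composing with g both adds and removes the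
  prescribed pairs: the same formula gives the inverse.\<close>

lemma bij_betw_fpf_invol_extend:
  assumes g: "g \<in> fpf_invol K" and "K \<subseteq> S"
  shows "bij_betw (\<lambda>t. g \<circ> t) (fpf_invol (S - K)) {t \<in> fpf_invol S. \<forall>x\<in>K. t x = g x}"
proof (rule bij_betwI[where g = "\<lambda>t. g \<circ> t"])
  show "(\<lambda>t. g \<circ> t) \<in> fpf_invol (S - K) \<rightarrow> {t \<in> fpf_invol S. \<forall>x\<in>K. t x = g x}"
    using comp_fpf_invol[OF g _ assms(2)] by auto
  show "g \<circ> (g \<circ> t) = t" for t :: "'a \<Rightarrow> 'a" using fpf_involD(3)[OF g] by auto
  then show "g \<circ> (g \<circ> t) = t" for t :: "'a \<Rightarrow> 'a" .
  show "(\<lambda>t. g \<circ> t) \<in> {t \<in> fpf_invol S. \<forall>x\<in>K. t x = g x} \<rightarrow> fpf_invol (S - K)"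
  proof
    fix t assume "t \<in> {t \<in> fpf_invol S. \<forall>x\<in>K. t x = g x}"
    then have t: "t \<in> fpf_invol S" and tg: "\<And>x. x \<in> K \<Longrightarrow> t x = g x" by auto
    have K: "t x \<notin> K" if "x \<notin> K" for x
      using that tg[of "t x"] fpf_involD(3)[OF t, of x] fpf_involD(5)[OF g, of "t x"] by auto
    show "g \<circ> t \<in> fpf_invol (S - K)"
    proof (rule fpf_involI)
      fix x
      show "(g \<circ> t) ((g \<circ> t) x) = x"
        using tg[of x] K[of x] fpf_involD(3)[OF g, of x] fpf_involD(3)[OF t, of x] fpf_involD(6)[OF g, of "t x"]
          fpf_involD(6)[OF g, of "x"]
        by (cases "x \<in> K") auto
      show "x \<in> S - K \<Longrightarrow> (g \<circ> t) x \<noteq> x"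
        using K[of x] fpf_involD(6)[OF g, of "t x"] fpf_involD(4)[OF t, of x] by auto
      show "x \<notin> S - K \<Longrightarrow> (g \<circ> t) x = x"
        using tg[of x] K[of x] fpf_involD(3)[OF g, of x] fpf_involD(6)[OF t, of x] fpf_involD(6)[OF g, of x]
        by (cases "x \<in> K") auto
    qed
  qed
qed

lemma bij_betw_fpf_invol_split:
  assumes "K \<subseteq> S"
  shows "bij_betw (\<lambda>(g, t). g \<circ> t) (fpf_invol K \<times> fpf_invol (S - K)) {t \<in> fpf_invol S. t ` K = K}"
proof (rule bij_betwI[where g = "\<lambda>t. (perm_restrict t K, perm_restrict t (S - K))"])
  show "(\<lambda>(g, t). g \<circ> t) \<in> fpf_invol K \<times> fpf_invol (S - K) \<rightarrow> {t \<in> fpf_invol S. t ` K = K}"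
  proof clarify
    fix g t assume g: "g \<in> fpf_invol K" and t: "t \<in> fpf_invol (S - K)"
    have "(g \<circ> t) ` K = g ` K" using comp_fpf_invol(2)[OF g t assms] by (intro image_cong) auto
    also have "\<dots> = K" using permutes_image[OF fpf_involD(1)[OF g]] .
    finally show "g \<circ> t \<in> fpf_invol S \<and> (g \<circ> t) ` K = K" using comp_fpf_invol(1)[OF g t assms] by blast
  qed
  show "(\<lambda>t. (perm_restrict t K, perm_restrict t (S - K))) \<in> {t \<in> fpf_invol S. t ` K = K} \<rightarrow> fpf_invol K \<times> fpf_invol (S - K)"
  proof clarify
    fix t assume t: "t \<in> fpf_invol S" "t ` K = K"
    have "t ` (S - K) = S - K"
      using t permutes_image[OF fpf_involD(1)[OF t(1)]] image_set_diff[OF fpf_involD(2)[OF t(1)], of S K] by simp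
    then show "perm_restrict t K \<in> fpf_invol K \<and> perm_restrict t (S - K) \<in> fpf_invol (S - K)"
      using perm_restrict_fpf_invol[OF t(1)] t(2) assms by auto
  qed
next
  fix x assume "x \<in> fpf_invol K \<times> fpf_invol (S - K)"
  then obtain g t where x: "x = (g, t)" and g: "g \<in> fpf_invol K" and t: "t \<in> fpf_invol (S - K)" by auto
  have "perm_restrict (g \<circ> t) K = g" "perm_restrict (g \<circ> t) (S - K) = t"
    using comp_fpf_invol(2,3)[OF g t assms] fpf_involD(6)[OF g] fpf_involD(6)[OF t]
    by (auto simp: perm_restrict_def fun_eq_iff)
  then show "(\<lambda>t. (perm_restrict t K, perm_restrict t (S - K))) (case x of (g, t) \<Rightarrow> g \<circ> t) = x" by (simp add: x)
next
  fix t assume "t \<in> {t \<in> fpf_invol S. t ` K = K}"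
  then have t: "t \<in> fpf_invol S" and K: "t ` K = K" by auto
  have inK: "t x \<in> K \<longleftrightarrow> x \<in> K" for x using K fpf_involD(2)[OF t] by (metis image_iff injD)
  have "(perm_restrict t K \<circ> perm_restrict t (S - K)) x = t x" for x
    using inK[of x] fpf_involD(6)[OF t, of x] by (auto simp: perm_restrict_def)
  then show "(case (perm_restrict t K, perm_restrict t (S - K)) of (g, t) \<Rightarrow> g \<circ> t) = t" by auto
qed

lemma fpf_invol_doubleton:
  assumes "x \<noteq> y"
  shows "Transposition.transpose x y \<in> fpf_invol {x, y}"
  using assms by (intro fpf_involI) (auto simp: Transposition.transpose_def)

lemma fpf_invol_with_pair:
  assumes "x \<in> S" "y \<in> S" "x \<noteq> y"
  shows "bij_betw (\<lambda>t. Transposition.transpose x y \<circ> t) (fpf_invol (S - {x, y})) {t \<in> fpf_invol S. t x = y}"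
proof -
  have "{t \<in> fpf_invol S. \<forall>z\<in>{x, y}. t z = Transposition.transpose x y z} = {t \<in> fpf_invol S. t x = y}"
    using fpf_involD(3) by (fastforce simp: Transposition.transpose_def)
  then show ?thesis
    using bij_betw_fpf_invol_extend[OF fpf_invol_doubleton[OF assms(3)], of S] assms by auto
qed

text \<open>A chosen x has |S| - 1 possible partners, and each leaves a matching of the other |S| -
  2 points.\<close>

lemma card_fpf_invol:
  assumes "finite S"
  shows "real (card (fpf_invol S)) = matching_number (card S)"
  using assms
proof (induction "card S" arbitrary: S rule: less_induct)
  case less
  show ?case
  proof (cases "S = {}")
    case True
    have "fpf_invol ({} :: 'a set) = {id}" by (auto simp: fpf_invol_def)
    then show ?thesis using True by simp
  next
    case False
    then obtain x where x: "x \<in> S" by blast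
    have fin: "finite (S - {x})" using less.prems by simp
    have "fpf_invol S = (\<Union>y\<in>S - {x}. {t \<in> fpf_invol S. t x = y})"
      using x fpf_involD(4,5) by fastforce
    then have "card (fpf_invol S) = (\<Sum>y\<in>S - {x}. card {t \<in> fpf_invol S. t x = y})"
      using less.prems by (subst card_UN_disjoint[symmetric]) auto
    also have "real \<dots> = (\<Sum>y\<in>S - {x}. matching_number (card S - 2))"
      unfolding of_nat_sum
    proof (rule sum.cong[OF refl])
      fix y assume y: "y \<in> S - {x}"
      have "real (card {t \<in> fpf_invol S. t x = y}) = real (card (fpf_invol (S - {x, y})))"
        using bij_betw_same_card[OF fpf_invol_with_pair[of x S y]] x y by auto
      also have "card (S - {x, y}) = card S - 2" using x y less.prems by (subst card_Diff_subset) auto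
      then have "real (card (fpf_invol (S - {x, y}))) = matching_number (card S - 2)"
        using x y less.prems less.hyps[of "S - {x, y}"] by (metis psubset_card_mono Diff_subset DiffE finite_Diff insertI1 psubsetI)
      finally show "real (card {t \<in> fpf_invol S. t x = y}) = matching_number (card S - 2)" .
    qed
    also have "\<dots> = real (card S - 1) * matching_number (card S - 2)" using x less.prems by simp
    also have "\<dots> = matching_number (card S)"
    proof -
      have "card S \<noteq> 0" using False less.prems by simp
      then consider "card S = 1" | m where "card S = Suc (Suc m)" by (metis One_nat_def not0_implies_Suc)
      then show ?thesis by cases (auto simp: matching_number_Suc_Suc)
    qed
    finally show ?thesis .
  qed
qed

lemma card_fpf_invol_split:
  assumes "finite S" "K \<subseteq> S"
  shows "real (card {t \<in> fpf_invol S. t ` K = K}) = matching_number (card K) * matching_number (card S - card K)"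
proof -
  have "finite K" using assms finite_subset by blast
  moreover have "real (card {t \<in> fpf_invol S. t ` K = K}) = real (card (fpf_invol K)) * real (card (fpf_invol (S - K)))"
    by (simp add: card_cartesian_product flip: bij_betw_same_card[OF bij_betw_fpf_invol_split[OF assms(2)]])
  ultimately show ?thesis
    using assms by (simp add: card_fpf_invol card_Diff_subset)
qed

text \<open>The involution is a product of |S|/2 transpositions, which are split off one by
  one.\<close>

lemma sign_fpf_invol:
  assumes "finite S" "t \<in> fpf_invol S"
  shows "sign t = (-1) ^ (card S div 2)" "even (card S)"
proof -
  have "sign t = (-1) ^ (card S div 2) \<and> even (card S)" using assms
  proof (induction "card S" arbitrary: S t rule: less_induct)
    case less
    show ?case
    proof (cases "S = {}")
      case True
      then show ?thesis using less.prems by (simp add: fpf_invol_def)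
    next
      case False
      then obtain x where x: "x \<in> S" by blast
      note t = fpf_involD[OF less.prems(2)]
      define y where "y = t x"
      have y: "y \<in> S" "x \<noteq> y" using t(5)[of x] t(4)[OF x] x by (auto simp: y_def)
      obtain t' where t': "t' \<in> fpf_invol (S - {x, y})" and tt: "t = Transposition.transpose x y \<circ> t'"
        using bij_betw_imp_surj_on[OF fpf_invol_with_pair[OF x y]] less.prems(2) y_def by fast
      have c: "card S = Suc (Suc (card (S - {x, y})))"
      proof -
        have "card {x, y} \<le> card S" using x y less.prems by (intro card_mono) auto
        then show ?thesis using x y less.prems by (subst card_Diff_subset) auto
      qed
      have "sign t' = (-1) ^ (card (S - {x, y}) div 2) \<and> even (card (S - {x, y}))"
        using less.hyps[OF _ _ t'] c less.prems by auto
      moreover have "permutation t'" using fpf_involD(1)[OF t'] less.prems permutes_imp_permutation by blast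
      then have "sign t = - sign t'" unfolding tt using y
        by (subst sign_compose) (auto simp: sign_swap_id permutation_swap_id)
      ultimately show ?thesis using c by simp
    qed
  qed
  then show "sign t = (-1) ^ (card S div 2)" "even (card S)" by auto
qed

text \<open>Conjugating by a transposition of two points that leave \<open>U\<close> under \<open>s\<close> flips the sign.\<close>

lemma sum_wt_fpf_invol_eq_0:
  fixes s :: "'a \<Rightarrow> 'a"
  assumes fin: "finite S" and s: "s permutes S" and U: "U \<subseteq> S" and xy: "x \<in> U" "y \<in> U" "s x \<notin> U" "s y \<notin> U" "x \<noteq> y"
  shows "(\<Sum>t\<in>{t \<in> fpf_invol S. s ` t ` U = U}. wt (s \<circ> t) U) = 0"
proof -
  define r where "r = Transposition.transpose x y"
  define T where "T = {t \<in> fpf_invol S. s ` t ` U = U}"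
  have rr: "r (r z) = z" for z by (simp add: r_def)
  have rU: "r z \<in> U \<longleftrightarrow> z \<in> U" for z using xy by (auto simp: r_def Transposition.transpose_def)
  have finU: "finite U" using U fin finite_subset by blast
  have rUimg: "r ` U = U" using rU by (intro image_eq_of_subset[OF finU]) (auto simp: r_def)
  have key: "r \<circ> t \<circ> r \<in> T \<and> wt (s \<circ> (r \<circ> t \<circ> r)) U = - wt (s \<circ> t) U" if t: "t \<in> T" for t
  proof -
    have t1: "t \<in> fpf_invol S" and t2: "s ` t ` U = U" using t by (auto simp: T_def)
    have stU: "s (t z) \<in> U" if "z \<in> U" for z using t2 that by blast
    \<comment> \<open>Since \<open>s (t z)\<close> lies in U while \<open>s x\<close> and
      \<open>s y\<close> do not, \<open>t z\<close> is neither x nor y. Hence conjugation by r keeps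
      the image of U under t, and on U it acts as precomposition with r, which costs one
      sign.\<close>
    have rfix: "r (t z) = t z" if "z \<in> U" for z
      using stU[OF that] xy by (auto simp: r_def Transposition.transpose_def)
    have "(r \<circ> t \<circ> r) ` U = t ` U"
    proof -
      have "(r \<circ> t \<circ> r) ` U = (r \<circ> t) ` U" using rUimg by (metis image_comp)
      also have "\<dots> = t ` U" using rfix by (intro image_cong) auto
      finally show ?thesis .
    qed
    moreover have "r \<circ> t \<circ> r \<in> fpf_invol S"
    proof (rule fpf_involI)
      fix z
      have rS: "r z \<in> S \<longleftrightarrow> z \<in> S" using xy U by (auto simp: r_def Transposition.transpose_def)
      show "(r \<circ> t \<circ> r) ((r \<circ> t \<circ> r) z) = z" using rr fpf_involD(3)[OF t1] by simp
      show "z \<in> S \<Longrightarrow> (r \<circ> t \<circ> r) z \<noteq> z" using rr fpf_involD(4)[OF t1, of "r z"] rS by (metis comp_apply)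
      show "z \<notin> S \<Longrightarrow> (r \<circ> t \<circ> r) z = z" using rr fpf_involD(6)[OF t1, of "r z"] rS by (metis comp_apply)
    qed
    ultimately have "r \<circ> t \<circ> r \<in> T" using t2 by (simp add: T_def)
    moreover have "wt (s \<circ> (r \<circ> t \<circ> r)) U = - wt (s \<circ> t) U"
    proof -
      have "perm_restrict (s \<circ> (r \<circ> t \<circ> r)) U z = (perm_restrict (s \<circ> t) U \<circ> r) z" for z
        using rU[of z] rfix[of "r z"] xy
        by (cases "z \<in> U") (auto simp: perm_restrict_def r_def Transposition.transpose_def)
      then have eq: "perm_restrict (s \<circ> (r \<circ> t \<circ> r)) U = perm_restrict (s \<circ> t) U \<circ> r" ..
      have "inj (s \<circ> t)" using permutes_inj[OF s] fpf_involD(2)[OF t1] by (rule inj_compose)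
      then have "perm_restrict (s \<circ> t) U permutes U" using t2 by (intro perm_restrict_permutes) (auto simp: image_comp)
      then have "permutation (perm_restrict (s \<circ> t) U)" using finU permutes_imp_permutation by blast
      then have "sign (perm_restrict (s \<circ> t) U \<circ> r) = - sign (perm_restrict (s \<circ> t) U)"
        unfolding r_def using xy by (subst sign_compose) (auto simp: sign_swap_id permutation_swap_id)
      then show ?thesis unfolding wt_def eq by simp
    qed
    ultimately show ?thesis ..
  qed
  have rtr: "r \<circ> (r \<circ> t \<circ> r) \<circ> r = t" for t :: "'a \<Rightarrow> 'a" using rr by (auto simp: fun_eq_iff)
  have "bij_betw (\<lambda>t. r \<circ> t \<circ> r) T T"
    by (rule bij_betwI[where g = "\<lambda>t. r \<circ> t \<circ> r"]) (use key rtr in auto)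
  then have "(\<Sum>t\<in>T. wt (s \<circ> t) U) = (\<Sum>t\<in>T. wt (s \<circ> (r \<circ> t \<circ> r)) U)"
    by (rule sum.reindex_bij_betw[symmetric])
  also have "\<dots> = - (\<Sum>t\<in>T. wt (s \<circ> t) U)" using key by (simp add: sum_negf)
  finally show ?thesis by (simp add: T_def)
qed

text \<open>As s is injective and preserves U, the condition says that t preserves U. Then s and t
  restrict to U separately, and t contributes the sign of |U|/2 transpositions.\<close>

lemma sum_wt_fpf_invol_invariant:
  assumes fin: "finite S" and s: "s permutes S" and U: "U \<subseteq> S" and sU: "s ` U = U"
  shows "(\<Sum>t\<in>{t \<in> fpf_invol S. s ` t ` U = U}. wt (s \<circ> t) U)
    = wt s U * ((-1) ^ (card U div 2) * matching_number (card U) * matching_number (card S - card U))"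
proof -
  note inj = permutes_inj[OF s]
  have finU: "finite U" using U fin finite_subset by blast
  have T: "{t \<in> fpf_invol S. s ` t ` U = U} = {t \<in> fpf_invol S. t ` U = U}"
    using inj_image_eq_iff[OF inj] sU by metis
  have "wt (s \<circ> t) U = wt s U * (-1) ^ (card U div 2)" if t: "t \<in> fpf_invol S" "t ` U = U" for t
  proof -
    have "perm_restrict (s \<circ> t) U x = (perm_restrict s U \<circ> perm_restrict t U) x" for x
      using t by (auto simp: perm_restrict_def)
    then have eq: "perm_restrict (s \<circ> t) U = perm_restrict s U \<circ> perm_restrict t U" ..
    have "perm_restrict t U \<in> fpf_invol U" using perm_restrict_fpf_invol[OF t(1) U t(2)] .
    note f = this sign_fpf_invol[OF finU this]
    have "sign (perm_restrict (s \<circ> t) U) = sign (perm_restrict s U) * (-1) ^ (card U div 2)"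
      unfolding eq using perm_restrict_permutes[OF inj sU] fpf_involD(1)[OF f(1)] f(2) finU
      by (subst sign_compose) (auto intro: permutes_imp_permutation)
    then show ?thesis by (simp add: wt_def)
  qed
  then have "(\<Sum>t\<in>{t \<in> fpf_invol S. t ` U = U}. wt (s \<circ> t) U) = (\<Sum>t\<in>{t \<in> fpf_invol S. t ` U = U}. wt s U * (-1) ^ (card U div 2))"
    by (intro sum.cong) auto
  then show ?thesis unfolding T using card_fpf_invol_split[OF fin U] by simp
qed

text \<open>The preimage of U under s is U with u replaced by v, and t has to map U onto it. An
  involution can do this only by pairing u with v and preserving the rest of U. The weight then
  splits into that of s after the exchange of u and v, which no longer depends on t, and the sign of
  t on the rest.\<close>

lemma sum_wt_fpf_invol_boundary:
  assumes fin: "finite S" and s: "s permutes S" and U: "U \<subseteq> S"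
    and u: "{x \<in> U. s x \<notin> U} = {u}" and v: "{x \<in> S - U. s x \<in> U} = {v}"
  shows "(\<Sum>t\<in>{t \<in> fpf_invol S. s ` t ` U = U}. wt (s \<circ> t) U)
    = wt (s \<circ> Transposition.transpose u v) U *
      ((-1) ^ ((card U - 1) div 2) * matching_number (card U - 1) * matching_number (card S - card U - 1))"
proof -
  define K where "K = U - {u}"
  define f where "f = s \<circ> Transposition.transpose u v"
  note inj = permutes_inj[OF s]
  have finU: "finite U" using U fin finite_subset by blast
  have uU: "u \<in> U" "s u \<notin> U" "v \<in> S" "v \<notin> U" "s v \<in> U" using u v by blast+
  have uv: "u \<noteq> v" using uU by blast
  have sK: "s x \<in> U" if "x \<in> K" for x using that u by (auto simp: K_def)
  have pre: "x = v \<or> x \<in> K" if "s x \<in> U" "x \<in> S" for x using that u v by (auto simp: K_def)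
  have KU: "K \<subseteq> U" "u \<notin> K" "v \<notin> K" "U = insert u K" using uU by (auto simp: K_def)
  have f: "f ` U = U"
  proof (rule image_eq_of_subset)
    show "inj f" unfolding f_def by (intro inj_compose inj) simp
    fix x assume "x \<in> U"
    then show "f x \<in> U" using KU sK[of x] uU by (auto simp: f_def Transposition.transpose_def)
  qed (rule finU)
  have T: "{t \<in> fpf_invol S. s ` t ` U = U} = {t \<in> fpf_invol S. t u = v \<and> t ` K = K}"
  proof (intro Collect_cong conj_cong refl iffI)
    fix t assume t: "t \<in> fpf_invol S" and stU: "s ` t ` U = U"
    have *: "t x = v \<or> t x \<in> K" if "x \<in> U" for x
      using pre[of "t x"] that stU fpf_involD(5)[OF t, of x] U by blast
    \<comment> \<open>If \<open>t u\<close> were in K, applying t once more would make u an element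
      of K or equal to v.\<close>
    have tu: "t u = v"
    proof (rule ccontr)
      assume "t u \<noteq> v"
      then have "t u \<in> K" using *[OF uU(1)] by blast
      then have "t (t u) = v \<or> t (t u) \<in> K" using * KU by blast
      then show False using fpf_involD(3)[OF t] uv KU by auto
    qed
    have "t x \<in> K" if "x \<in> K" for x
    proof -
      have "t x \<noteq> v" using tu that KU fpf_involD(2)[OF t] by (metis injD)
      then show ?thesis using *[of x] that KU by blast
    qed
    then have "t ` K = K" using finU KU fpf_involD(2)[OF t] by (intro image_eq_of_subset) (auto intro: finite_subset)
    then show "t u = v \<and> t ` K = K" using tu by blast
  next
    fix t assume t: "t \<in> fpf_invol S" and "t u = v \<and> t ` K = K"
    then have "s ` t ` U = s ` insert v K" using KU by auto
    also have "\<dots> = s ` Transposition.transpose u v ` U"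
    proof -
      have "Transposition.transpose u v ` U = insert v K"
        using KU uv by (force simp: Transposition.transpose_def image_iff)
      then show ?thesis by simp
    qed
    also have "\<dots> = U" using f by (simp add: f_def image_comp)
    finally show "s ` t ` U = U" .
  qed
  have "wt (s \<circ> t) U = wt f U * (-1) ^ (card K div 2)" if t: "t \<in> fpf_invol S" "t u = v" "t ` K = K" for t
  proof -
    have tK: "t x \<in> K" if "x \<in> K" for x using t(3) that by blast
    have "perm_restrict (s \<circ> t) U x = (perm_restrict f U \<circ> perm_restrict t K) x" for x
    proof -
      consider "x \<in> K" | "x = u" | "x \<notin> U" using KU by blast
      then show ?thesis
      proof cases
        case 1
        then have "x \<noteq> u" "t x \<noteq> u" "t x \<noteq> v" "x \<in> U" "t x \<in> U" using tK[of x] KU by auto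
        then show ?thesis using 1 by (simp add: perm_restrict_def f_def)
      next
        case 2
        then show ?thesis using t(2) KU(2) uU(1) by (simp add: perm_restrict_def f_def)
      next
        case 3
        then have "x \<notin> K" using KU by auto
        then show ?thesis using 3 by (simp add: perm_restrict_def)
      qed
    qed
    then have eq: "perm_restrict (s \<circ> t) U = perm_restrict f U \<circ> perm_restrict t K" ..
    have KS: "K \<subseteq> S" and finK: "finite K" using KU U finU finite_subset by auto
    have "perm_restrict t K \<in> fpf_invol K" using perm_restrict_fpf_invol[OF t(1) KS t(3)] .
    note g = this sign_fpf_invol[OF finK this]
    have "inj f" unfolding f_def by (intro inj_compose inj) simp
    then have "sign (perm_restrict (s \<circ> t) U) = sign (perm_restrict f U) * (-1) ^ (card K div 2)"
      unfolding eq using perm_restrict_permutes[OF _ f] fpf_involD(1)[OF g(1)] g(2) finU finK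
      by (subst sign_compose) (auto intro: permutes_imp_permutation)
    then show ?thesis by (simp add: wt_def)
  qed
  then have s1: "(\<Sum>t\<in>{t \<in> fpf_invol S. t u = v \<and> t ` K = K}. wt (s \<circ> t) U)
      = (\<Sum>t\<in>{t \<in> fpf_invol S. t u = v \<and> t ` K = K}. wt f U * (-1) ^ (card K div 2))"
    by (intro sum.cong) auto
  have s2: "real (card {t \<in> fpf_invol S. t u = v \<and> t ` K = K}) = matching_number (card K) * matching_number (card S - card U - 1)"
  proof -
    have uS: "u \<in> S" using uU U by blast
    define r where "r = Transposition.transpose u v"
    have rK: "r z = z" if "z \<in> K" for z using that KU by (auto simp: r_def Transposition.transpose_def)
    have bij: "bij_betw (\<lambda>t. r \<circ> t) {t \<in> fpf_invol (S - {u, v}). t ` K = K} {t \<in> fpf_invol S. t u = v \<and> t ` K = K}"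
    proof (rule bij_betw_subset[OF fpf_invol_with_pair[OF uS uU(3) uv, folded r_def]])
      have rt: "(r \<circ> t) ` K = K \<longleftrightarrow> t ` K = K" for t
      proof -
        have "r ` K = K" using rK by (force simp: image_iff)
        then have "(r \<circ> t) ` K = K \<longleftrightarrow> r ` (t ` K) = r ` K" by (simp add: image_comp)
        also have "\<dots> \<longleftrightarrow> t ` K = K" by (rule inj_image_eq_iff) (simp add: r_def)
        finally show ?thesis .
      qed
      have "{t \<in> fpf_invol S. t u = v \<and> t ` K = K} = {t \<in> {t \<in> fpf_invol S. t u = v}. t ` K = K}" by auto
      also have "\<dots> = {t \<in> (\<lambda>t. r \<circ> t) ` fpf_invol (S - {u, v}). t ` K = K}"
        using bij_betw_imp_surj_on[OF fpf_invol_with_pair[OF uS uU(3) uv, folded r_def]] by simp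
      also have "\<dots> = (\<lambda>t. r \<circ> t) ` {t \<in> fpf_invol (S - {u, v}). t ` K = K}" using rt by blast
      finally show "(\<lambda>t. r \<circ> t) ` {t \<in> fpf_invol (S - {u, v}). t ` K = K} = {t \<in> fpf_invol S. t u = v \<and> t ` K = K}" ..
    qed auto
    have "card (S - {u, v}) = card S - 2" using uS uU uv fin by (subst card_Diff_subset) auto
    moreover have "card U = Suc (card K)" by (metis KU(2,4) card_insert_disjoint finU finite_insert)
    moreover have "K \<subseteq> S - {u, v}" using KU U by auto
    ultimately have "real (card {t \<in> fpf_invol (S - {u, v}). t ` K = K}) = matching_number (card K) * matching_number (card S - card U - 1)"
      using card_fpf_invol_split[of "S - {u, v}" K] fin by simp
    then show ?thesis by (simp only: bij_betw_same_card[OF bij])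
  qed
  have s3: "card K = card U - 1" using uU(1) finU by (simp add: K_def)
  show ?thesis unfolding T s1 sum_constant s2 unfolding s3 f_def by (simp only: mult_ac)
qed

section \<open>Counting matchings with a one-cycle product\<close>

definition pre_iter :: "('a \<Rightarrow> 'a) \<Rightarrow> 'a \<Rightarrow> nat \<Rightarrow> 'a" where
  "pre_iter s u i = (inv s ^^ i) u"

text \<open>The points are listed against the direction of s, starting from the one at which s
  leaves the arc. For m below the cycle length, the point from which s enters the arc is then
  \<open>pre_iter s u m\<close>.\<close>

definition arc :: "('a \<Rightarrow> 'a) \<Rightarrow> 'a \<Rightarrow> nat \<Rightarrow> 'a set" where
  "arc s u m = pre_iter s u ` {..<m}"

text \<open>Everything is read off the orbit of u under the inverse of s, which is enumerated
  injectively by powers up to the first return to u.\<close>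

lemma cycle_enum:
  fixes s :: "'a \<Rightarrow> 'a"
  assumes fin: "finite S" and s: "s permutes S" and Q: "Q \<in> cycles S s" and u: "u \<in> Q"
  defines "e \<equiv> pre_iter s u"
  shows "e 0 = u" "s (e (Suc i)) = e i" "s u = e (card Q - 1)" "inj_on e {..<card Q}" "e ` {..<card Q} = Q"
proof -
  have perm: "permutation s" using permutes_imp_permutation[OF fin s] .
  have QS: "Q \<subseteq> S" and sQ: "s ` Q = Q" and scQ: "single_cycle Q s" using Q by (auto simp: cycles_def inv_sets_def)
  have finQ: "finite Q" using QS fin finite_subset by blast
  note inj = permutes_inj[OF s]
  show "e 0 = u" by (simp add: e_def pre_iter_def)
  show step: "s (e (Suc i)) = e i" for i using permutes_inverses(1)[OF s] by (simp add: e_def pre_iter_def)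
  have sub: "orbit s u \<subseteq> Q"
  proof
    fix x assume "x \<in> orbit s u"
    then show "x \<in> Q"
    proof induction
      case base then show ?case using u sQ by blast
    next
      case (step y) then show ?case using sQ by blast
    qed
  qed
  have "s ` orbit s u = orbit s u"
    using finite_subset[OF sub finQ] by (intro image_eq_of_subset inj) (auto intro: orbit.step)
  then have "orbit s u = Q" using single_cycleD[OF scQ sub] orbit_nonempty[of s u] by auto
  then have orb: "orbit (inv s) u = Q" using orbit_inv_eq[OF perm] by metis
  have uo: "u \<in> orbit (inv s) u" using orb u by simp
  define l where "l = funpow_dist1 (inv s) u u"
  have injl: "inj_on e {0..<l}" using inj_on_funpow_dist1[OF uo] by (simp add: e_def l_def pre_iter_def [abs_def])
  have iml: "e ` {0..<l} = Q" using orbit_conv_funpow_dist1[OF uo] orb by (simp add: e_def l_def pre_iter_def [abs_def])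
  have l: "l = card Q" using card_image[OF injl] iml by simp
  show "inj_on e {..<card Q}" "e ` {..<card Q} = Q" using injl iml l by (auto simp: lessThan_atLeast0)
  have "e l = u" using funpow_dist1_prop[OF uo] by (simp add: e_def l_def pre_iter_def)
  moreover have "l = Suc (card Q - 1)" using l by (simp add: l_def)
  ultimately show "s u = e (card Q - 1)" using step[of "card Q - 1"] by simp
qed

text \<open>Exchanging u and v before applying s closes the arc into a cycle of its own: u goes to
  the far end, and from there the arc runs back to u. This accounts for the factor -1 in the
  weight.\<close>

lemma arc_boundary:
  assumes fin: "finite S" and s: "s permutes S" and Q: "Q \<in> cycles S s" and u: "u \<in> Q"
    and m: "1 \<le> m" "m < card Q" and C: "C \<in> inv_sets (S - Q) s"
  defines "U \<equiv> C \<union> arc s u m" and "v \<equiv> pre_iter s u m"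
  shows "U \<subseteq> S" "{x \<in> U. s x \<notin> U} = {u}" "{x \<in> S - U. s x \<in> U} = {v}"
    "card U = card C + m" "U \<inter> Q = arc s u m" "U - Q = C"
    "wt (s \<circ> Transposition.transpose u v) U = - wt s C"
    "card (arc s u m) = m"
proof -
  define e where "e = pre_iter s u"
  note ce = cycle_enum[OF fin s Q u, folded e_def]
  note inj = permutes_inj[OF s]
  have QS: "Q \<subseteq> S" using Q by (auto simp: cycles_def inv_sets_def)
  have CS: "C \<subseteq> S - Q" and sC: "s ` C = C" using C by (auto simp: inv_sets_def)
  have finC: "finite C" using CS fin finite_subset by blast
  have A: "arc s u m = e ` {..<m}" by (simp add: arc_def e_def)
  have AQ: "arc s u m \<subseteq> Q" using ce(5) m by (auto simp: A)
  have injm: "inj_on e {..<m}" using m by (intro inj_on_subset[OF ce(4)]) auto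
  have eq_iff: "e i = e j \<longleftrightarrow> i = j" if "i < card Q" "j < card Q" for i j
    using ce(4) that by (auto dest: inj_onD)
  have emA: "e i \<in> arc s u m \<longleftrightarrow> i < m" if "i < card Q" for i
    using eq_iff that m by (auto simp: A)
  have eQ: "e i \<in> Q" if "i < card Q" for i using ce(5) that by blast
  have sCiff: "s x \<in> C \<longleftrightarrow> x \<in> C" for x using inv_sets_mem_iff[OF inj C] .
  have vdef: "v = e m" by (simp add: v_def e_def)
  have finA: "finite (arc s u m)" by (simp add: A)
  show "card (arc s u m) = m" using card_image[OF injm] by (simp add: A)
  have dis: "C \<inter> arc s u m = {}" using CS AQ by blast
  show "U \<subseteq> S" "U \<inter> Q = arc s u m" "U - Q = C" using CS AQ QS by (auto simp: U_def)
  show "card U = card C + m" unfolding U_def using dis finC finA \<open>card (arc s u m) = m\<close> by (simp add: card_Un_disjoint)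
  have su: "s u = e (card Q - 1)" by (rule ce(3))
  have uA: "u \<in> arc s u m" using emA[of 0] ce(1) m by simp
  have suU: "s u \<notin> U" using emA[of "card Q - 1"] eQ[of "card Q - 1"] m CS by (auto simp: U_def su)
  have sA: "s x \<in> arc s u m" if "x \<in> arc s u m" "x \<noteq> u" for x
  proof -
    obtain i where i: "i < m" "x = e i" using \<open>x \<in> arc s u m\<close> by (auto simp: A)
    then have "i \<noteq> 0" using \<open>x \<noteq> u\<close> ce(1) by (intro notI) simp
    then obtain j where "i = Suc j" using not0_implies_Suc by blast
    then show ?thesis using ce(2)[of j] i by (auto simp: A)
  qed
  show "{x \<in> U. s x \<notin> U} = {u}"
    using sA suU uA sCiff by (auto simp: U_def)
  have svA: "s v = e (m - 1)" using ce(2)[of "m - 1"] m by (simp add: vdef)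
  have vS: "v \<in> S - U" using eQ[of m] emA[of m] m QS CS by (auto simp: vdef U_def)
  show vv: "{x \<in> S - U. s x \<in> U} = {v}"
  proof (intro set_eqI iffI)
    fix x assume x: "x \<in> {x \<in> S - U. s x \<in> U}"
    then have "x \<notin> C" by (auto simp: U_def)
    then have "s x \<in> arc s u m" using x sCiff by (auto simp: U_def)
    then obtain i where i: "i < m" "s x = e i" by (auto simp: A)
    then have "s x = s (e (Suc i))" using ce(2) by simp
    then have xe: "x = e (Suc i)" using inj by (auto dest: injD)
    moreover have "x \<notin> arc s u m" using x by (auto simp: U_def)
    ultimately have "\<not> Suc i < m" by (auto simp: A)
    then show "x \<in> {v}" using i xe vdef by (metis Suc_lessI singletonI)
  next
    fix x assume "x \<in> {v}"
    then show "x \<in> {x \<in> S - U. s x \<in> U}" using vS svA m by (auto simp: U_def A)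
  qed
  define f where "f = s \<circ> Transposition.transpose u v"
  have injf: "inj f" unfolding f_def by (intro inj_compose inj) simp
  have uC: "u \<notin> C" "v \<notin> C" using CS u eQ[of m] m by (auto simp: vdef)
  have fC: "f x = s x" if "x \<in> C" for x using that uC by (auto simp: f_def Transposition.transpose_def)
  have fu: "f u = e (m - 1)" by (simp add: f_def svA)
  have vA: "v \<notin> arc s u m" using vS by (auto simp: U_def)
  have fA: "f x = s x" if "x \<in> arc s u m" "x \<noteq> u" for x using that vA by (auto simp: f_def Transposition.transpose_def)
  have fAA: "f ` arc s u m = arc s u m"
  proof (rule image_eq_of_subset[OF finA injf])
    fix x assume "x \<in> arc s u m"
    then show "f x \<in> arc s u m" using fu fA sA emA[of "m - 1"] m by (cases "x = u") auto
  qed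
  have fCC: "f ` C = C" using sC fC by (simp cong: image_cong)
  have "single_cycle (arc s u m) f"
    unfolding single_cycle_def
  proof (intro allI impI)
    fix X assume X: "X \<subseteq> arc s u m" "f ` X = X"
    \<comment> \<open>Under f the index decreases until u is reached, and u is sent to index m - 1.
      So a nonempty invariant X contains u, and then the whole arc.\<close>
    have down: "e i \<in> X \<Longrightarrow> i < m \<Longrightarrow> u \<in> X" for i
    proof (induction i)
      case 0 then show ?case using ce(1) by simp
    next
      case (Suc i)
      have "e (Suc i) \<noteq> u" using eq_iff[of "Suc i" 0] ce(1) Suc.prems m by auto
      then have "f (e (Suc i)) = e i" using fA[of "e (Suc i)"] ce(2)[of i] Suc.prems X by auto
      then show ?case using Suc X by (metis Suc_lessD imageI)
    qed
    have up: "u \<in> X \<Longrightarrow> i < m \<Longrightarrow> e (m - 1 - i) \<in> X" for i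
    proof (induction i)
      case 0 then show ?case using fu X(2) by (metis diff_zero imageI)
    next
      case (Suc i)
      define j where "j = m - 1 - Suc i"
      have j: "m - 1 - i = Suc j" using Suc.prems by (simp add: j_def)
      then have "e (Suc j) \<noteq> u" using eq_iff[of "Suc j" 0] ce(1) m by auto
      then have "f (e (Suc j)) = e j" using fA[of "e (Suc j)"] ce(2)[of j] Suc j X by auto
      then show ?case using Suc X j by (metis Suc_lessD imageI j_def)
    qed
    show "X = {} \<or> X = arc s u m"
    proof (cases "X = {}")
      case False
      then obtain x where "x \<in> X" by blast
      moreover from this have "x \<in> e ` {..<m}" using X A by blast
      ultimately obtain i where "i < m" "e i \<in> X" by blast
      then have uX: "u \<in> X" using down by blast
      have "e i \<in> X" if "i < m" for i using up[OF uX, of "m - 1 - i"] that by simp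
      then show ?thesis using X A by auto
    qed simp
  qed
  then have "wt f (arc s u m) = -1" using uA by (intro wt_single_cycle[OF injf fAA _ _ finA]) auto
  moreover have "wt f (C \<union> arc s u m) = wt f C * wt f (arc s u m)"
    using injf fCC fAA dis finC finA by (rule wt_Un)
  moreover have "wt f C = wt s C" using fC by (rule wt_cong)
  ultimately show "wt (s \<circ> Transposition.transpose u v) U = - wt s C" by (simp add: U_def f_def)
qed

definition one_exit :: "'a set \<Rightarrow> ('a \<Rightarrow> 'a) \<Rightarrow> 'a set set" where
  "one_exit S s = {U. U \<subseteq> S \<and> card {x \<in> U. s x \<notin> U} = 1}"

text \<open>In (Q, u, m, C), Q is the cycle that is cut, u the exit point, m the length of the arc
  and C a union of cycles other than Q.\<close>

definition arc_index :: "'a set \<Rightarrow> ('a \<Rightarrow> 'a) \<Rightarrow> ('a set \<times> 'a \<times> nat \<times> 'a set) set" where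
  "arc_index S s = (SIGMA Q:cycles S s. Q \<times> {1..<card Q} \<times> inv_sets (S - Q) s)"

text \<open>The exit point determines the cycle Q on which it lies; C is then the part of U outside
  Q, and m the size of the part inside. For surjectivity, Q is followed backwards from the exit
  point until U is left for the first time.\<close>

lemma bij_betw_one_exit:
  assumes fin: "finite S" and s: "s permutes S"
  shows "bij_betw (\<lambda>(Q, u, m, C). C \<union> arc s u m) (arc_index S s) (one_exit S s)"
  unfolding bij_betw_def
proof (intro conjI)
  note inj = permutes_inj[OF s]
  have bd: "U \<in> one_exit S s \<and> {x \<in> U. s x \<notin> U} = {u} \<and> u \<in> Q \<and> Q \<in> cycles S s \<and> U - Q = C \<and> card (U \<inter> Q) = m"
    if "(Q, u, m, C) \<in> arc_index S s" "U = C \<union> arc s u m" for Q u m C U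
  proof -
    have h: "Q \<in> cycles S s" "u \<in> Q" "1 \<le> m" "m < card Q" "C \<in> inv_sets (S - Q) s"
      using that by (auto simp: arc_index_def)
    show ?thesis using arc_boundary[OF fin s h, folded that(2)] h by (auto simp: one_exit_def)
  qed
  show "inj_on (\<lambda>(Q, u, m, C). C \<union> arc s u m) (arc_index S s)"
  proof (rule inj_onI)
    fix a b assume ab: "a \<in> arc_index S s" "b \<in> arc_index S s"
      "(case a of (Q, u, m, C) \<Rightarrow> C \<union> arc s u m) = (case b of (Q, u, m, C) \<Rightarrow> C \<union> arc s u m)"
    obtain Q u m C Q' u' m' C' where a: "a = (Q, u, m, C)" and b: "b = (Q', u', m', C')" by (cases a, cases b) auto
    define U where "U = C \<union> arc s u m"
    have 1: "{x \<in> U. s x \<notin> U} = {u}" "u \<in> Q" "Q \<in> cycles S s" "U - Q = C" "card (U \<inter> Q) = m"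
      using bd[OF _ U_def, of Q] ab(1) unfolding a by blast+
    have U': "U = C' \<union> arc s u' m'" using ab a b U_def by simp
    have 2: "{x \<in> U. s x \<notin> U} = {u'}" "u' \<in> Q'" "Q' \<in> cycles S s" "U - Q' = C'" "card (U \<inter> Q') = m'"
      using bd[OF _ U', of Q'] ab(2) unfolding b by blast+
    have "u = u'" using 1(1) 2(1) by simp
    moreover from this have "Q = Q'" using cycles_disjoint[OF inj 1(3) 2(3)] 1(2) 2(2) by blast
    ultimately show "a = b" using a b 1 2 by simp
  qed
  show "(\<lambda>(Q, u, m, C). C \<union> arc s u m) ` arc_index S s = one_exit S s"
  proof (intro set_eqI iffI)
    fix U assume "U \<in> (\<lambda>(Q, u, m, C). C \<union> arc s u m) ` arc_index S s"
    then show "U \<in> one_exit S s" using bd by (auto simp del: Un_iff)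
  next
    fix U assume U: "U \<in> one_exit S s"
    then obtain u where u: "{x \<in> U. s x \<notin> U} = {u}" and US: "U \<subseteq> S" by (auto simp: one_exit_def card_1_singleton_iff)
    then have uU: "u \<in> U" "s u \<notin> U" by auto
    have only: "x = u" if "x \<in> U" "s x \<notin> U" for x using u that by blast
    obtain Q where Q: "Q \<in> cycles S s" "u \<in> Q"
      using Union_cycles[OF fin inj permutes_image[OF s]] uU US by blast
    have sQ: "s x \<in> Q \<longleftrightarrow> x \<in> Q" for x using Q inv_sets_mem_iff[OF inj, of Q S] by (auto simp: cycles_def)
    have QS: "Q \<subseteq> S" and finQ: "finite Q" using Q fin finite_subset by (auto simp: cycles_def inv_sets_def)
    define e where "e = pre_iter s u"
    note ce = cycle_enum[OF fin s Q, folded e_def]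
    have eq_iff: "e i = e j \<longleftrightarrow> i = j" if "i < card Q" "j < card Q" for i j
      using ce(4) that by (auto dest: inj_onD)
    have cQ: "0 < card Q" using Q finQ by (auto simp: card_gt_0_iff)
    have last: "e (card Q - 1) \<notin> U" using uU ce(3) by simp
    define m where "m = (LEAST i. e i \<notin> U)"
    have emU: "e m \<notin> U" unfolding m_def using last by (rule LeastI)
    have lt: "e i \<in> U" if "i < m" for i using not_less_Least that unfolding m_def by blast
    have mle: "m \<le> card Q - 1" unfolding m_def using last by (rule Least_le)
    have m1: "1 \<le> m" using emU ce(1) uU by (cases m) auto
    \<comment> \<open>Walking backwards, a return into U would produce a second point at which s
      leaves U.\<close>
    have ge: "e (m + i) \<notin> U" if "m + i < card Q" for i using that
    proof (induction i)
      case 0 then show ?case using emU by simp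
    next
      case (Suc i)
      show ?case
      proof
        assume a: "e (m + Suc i) \<in> U"
        have "s (e (m + Suc i)) \<notin> U" using ce(2)[of "m + i"] Suc by simp
        then have "e (m + Suc i) = e 0" using only a ce(1) by simp
        then show False using eq_iff[of "m + Suc i" 0] Suc.prems cQ by simp
      qed
    qed
    have UQ: "U \<inter> Q = arc s u m"
    proof
      show "arc s u m \<subseteq> U \<inter> Q"
      proof
        fix x assume "x \<in> arc s u m"
        then obtain i where "i < m" "x = e i" by (auto simp: arc_def e_def)
        moreover from this have "e i \<in> e ` {..<card Q}" using mle by auto
        ultimately show "x \<in> U \<inter> Q" using lt ce(5) by auto
      qed
      show "U \<inter> Q \<subseteq> arc s u m"
      proof
        fix x assume x: "x \<in> U \<inter> Q"
        then obtain i where i: "i < card Q" "x = e i" using ce(5) by (metis IntD2 imageE lessThan_iff)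
        then have "i < m" using ge[of "i - m"] x by (cases "i < m") auto
        then show "x \<in> arc s u m" using i by (auto simp: arc_def e_def)
      qed
    qed
    have "s x \<in> U - Q" if "x \<in> U - Q" for x
      using that only[of x] Q(2) sQ[of x] by auto
    moreover have "finite (U - Q)" using US fin finite_subset by blast
    ultimately have "s ` (U - Q) = U - Q" using inj by (intro image_eq_of_subset) auto
    then have "U - Q \<in> inv_sets (S - Q) s" using US by (auto simp: inv_sets_def)
    then have "(Q, u, m, U - Q) \<in> arc_index S s" using Q m1 mle cQ by (auto simp: arc_index_def)
    moreover have "U = (U - Q) \<union> arc s u m" using UQ by blast
    ultimately show "U \<in> (\<lambda>(Q, u, m, C). C \<union> arc s u m) ` arc_index S s"
      by (intro image_eqI[where x = "(Q, u, m, U - Q)"]) auto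
  qed
qed

text \<open>The number m(k) is the k-th moment of a standard Gaussian. So this is the mean of (iX)^k
  Y^(n-k) for independent standard Gaussians X and Y.\<close>

definition kernel :: "nat \<Rightarrow> nat \<Rightarrow> real" where
  "kernel n k = (-1) ^ (k div 2) * matching_number k * matching_number (n - k)"

definition Lam :: "nat \<Rightarrow> real poly \<Rightarrow> real" where
  "Lam n p = (\<Sum>k\<le>n. coeff p k * kernel n k)"

lemma Lam_add: "Lam n (p + q) = Lam n p + Lam n q"
  and Lam_diff: "Lam n (p - q) = Lam n p - Lam n q"
  and Lam_smult: "Lam n (smult a p) = a * Lam n p"
  by (simp_all add: Lam_def algebra_simps sum.distrib sum_subtractf sum_distrib_left)

lemma Lam_sum: "Lam n (\<Sum>x\<in>A. f x) = (\<Sum>x\<in>A. Lam n (f x))"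
  by (induction A rule: infinite_finite_induct) (auto simp: Lam_add, auto simp: Lam_def)

lemma Lam_monom: "k \<le> n \<Longrightarrow> Lam n (monom a k) = a * kernel n k"
  by (simp add: Lam_def if_distrib[of "\<lambda>x. x * _"] cong: if_cong)

text \<open>The sums over t and U are exchanged. With E = \<open>cycle_poly S s\<close>, the
  invariant U give n E - y E'. The sets with one exit give the sum over Q, in which |Q| counts the
  exit points and the geometric sum the arc lengths.\<close>

lemma sum_over_fpf_invol:
  assumes fin: "finite S" and s: "s permutes S"
  defines "n \<equiv> card S"
  shows "real n * real (card {t \<in> fpf_invol S. single_cycle S (s \<circ> t)})
    = Lam n (smult (real n) (cycle_poly S s) - monom 1 1 * pderiv (cycle_poly S s)
       - (\<Sum>Q\<in>cycles S s. smult (real (card Q)) ((\<Sum>i<card Q - 1. monom 1 i) * cycle_poly (S - Q) s)))"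
proof -
  note inj = permutes_inj[OF s]
  define F where "F U = (real n - real (card U)) * (\<Sum>t\<in>{t \<in> fpf_invol S. s ` t ` U = U}. wt (s \<circ> t) U)" for U
  have "real n * real (card {t \<in> fpf_invol S. single_cycle S (s \<circ> t)})
      = (\<Sum>t\<in>fpf_invol S. if single_cycle S (s \<circ> t) then real n else 0)"
    using fin by (simp flip: sum.inter_filter)
  also have "\<dots> = (\<Sum>t\<in>fpf_invol S. \<Sum>U\<in>inv_sets S (s \<circ> t). wt (s \<circ> t) U * (real n - real (card U)))"
    unfolding n_def using s fpf_involD(1) by (intro sum.cong refl sum_wt_inv_sets[symmetric] fin permutes_compose)
  also have "\<dots> = (\<Sum>t\<in>fpf_invol S. \<Sum>U\<in>Pow S. if s ` t ` U = U then wt (s \<circ> t) U * (real n - real (card U)) else 0)"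
  proof (rule sum.cong[OF refl])
    fix t
    have "inv_sets S (s \<circ> t) = {U \<in> Pow S. s ` t ` U = U}" by (simp add: inv_sets_def image_comp)
    then show "(\<Sum>U\<in>inv_sets S (s \<circ> t). wt (s \<circ> t) U * (real n - real (card U))) =
        (\<Sum>U\<in>Pow S. if s ` t ` U = U then wt (s \<circ> t) U * (real n - real (card U)) else 0)"
      using fin by (simp only: sum.inter_filter finite_Pow_iff)
  qed
  also have "\<dots> = (\<Sum>U\<in>Pow S. F U)"
    unfolding F_def sum_distrib_left using fin
    by (subst sum.swap) (auto intro!: sum.cong simp: mult.commute simp flip: sum.inter_filter)
  also have "\<dots> = (\<Sum>U\<in>inv_sets S s \<union> one_exit S s. F U)"
  proof (rule sum.mono_neutral_right)
    show "\<forall>U\<in>Pow S - (inv_sets S s \<union> one_exit S s). F U = 0"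
    proof
      fix U assume U: "U \<in> Pow S - (inv_sets S s \<union> one_exit S s)"
      then have finU: "finite U" using fin finite_subset by blast
      define B where "B = {x \<in> U. s x \<notin> U}"
      have "finite B" using finU by (simp add: B_def)
      have "B \<noteq> {}"
      proof
        assume "B = {}"
        then have "s ` U = U" using finU inj by (intro image_eq_of_subset) (auto simp: B_def)
        then show False using U by (auto simp: inv_sets_def)
      qed
      moreover have "card B \<noteq> 1" using U by (auto simp: one_exit_def B_def)
      moreover have "card B \<noteq> 0" using \<open>finite B\<close> \<open>B \<noteq> {}\<close> by simp
      ultimately have "\<not> card B \<le> 1" by linarith
      then obtain x y where "x \<in> B" "y \<in> B" "x \<noteq> y" using card_le_Suc0_iff_eq[OF \<open>finite B\<close>] by auto
      then show "F U = 0"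
        unfolding F_def using sum_wt_fpf_invol_eq_0[OF fin s, of U x y] U by (auto simp: B_def)
    qed
  qed (use fin in \<open>auto simp: inv_sets_def one_exit_def\<close>)
  also have "\<dots> = (\<Sum>U\<in>inv_sets S s. F U) + (\<Sum>U\<in>one_exit S s. F U)"
  proof (rule sum.union_disjoint)
    show "inv_sets S s \<inter> one_exit S s = {}"
      using inv_sets_mem_iff[OF inj, of _ S] by (auto simp: one_exit_def card_1_singleton_iff)
  qed (use fin in \<open>auto simp: one_exit_def\<close>)
  also have "(\<Sum>U\<in>inv_sets S s. F U) = Lam n (smult (real n) (cycle_poly S s) - monom 1 1 * pderiv (cycle_poly S s))"
  proof -
    have le: "card U \<le> n" if "U \<in> inv_sets S s" for U using that fin by (auto simp: inv_sets_def n_def intro: card_mono)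
    have "(\<Sum>U\<in>inv_sets S s. F U) = (\<Sum>U\<in>inv_sets S s. (real n - real (card U)) * wt s U * kernel n (card U))"
      using sum_wt_fpf_invol_invariant[OF fin s] unfolding F_def
      by (intro sum.cong refl) (auto simp: kernel_def inv_sets_def n_def)
    also have "\<dots> = (\<Sum>U\<in>inv_sets S s. Lam n (smult (real n) (monom (wt s U) (card U)) - monom 1 1 * pderiv (monom (wt s U) (card U))))"
    proof (intro sum.cong refl)
      fix U assume U: "U \<in> inv_sets S s"
      have "monom 1 1 * pderiv (monom (wt s U) (card U)) = monom (real (card U) * wt s U) (card U)"
        by (cases "card U") (auto simp: pderiv_monom mult_monom)
      then show "(real n - real (card U)) * wt s U * kernel n (card U) = Lam n (smult (real n) (monom (wt s U) (card U)) - monom 1 1 * pderiv (monom (wt s U) (card U)))"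
        using le[OF U] by (simp add: Lam_diff Lam_smult Lam_monom algebra_simps)
    qed
    finally show ?thesis
      by (simp only: cycle_poly_eq_sum[OF fin inj] pderiv_sum Lam_diff Lam_smult Lam_sum sum_distrib_left sum_subtractf)
  qed
  also have "(\<Sum>U\<in>one_exit S s. F U) = - Lam n (\<Sum>Q\<in>cycles S s. smult (real (card Q)) ((\<Sum>i<card Q - 1. monom 1 i) * cycle_poly (S - Q) s))"
  proof -
    have "(\<Sum>U\<in>one_exit S s. F U) = (\<Sum>(Q, u, m, C)\<in>arc_index S s. F (C \<union> arc s u m))"
      using sum.reindex_bij_betw[OF bij_betw_one_exit[OF fin s], of F] by (simp add: case_prod_unfold)
    also have "\<dots> = (\<Sum>(Q, u, m, C)\<in>arc_index S s. - wt s C * kernel n (card C + m - 1))"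
    proof (rule sum.cong[OF refl], clarify)
      fix Q u m C assume i: "(Q, u, m, C) \<in> arc_index S s"
      define U where "U = C \<union> arc s u m"
      have h: "Q \<in> cycles S s" "u \<in> Q" "1 \<le> m" "m < card Q" "C \<in> inv_sets (S - Q) s"
        using i by (auto simp: arc_index_def)
      note ab = arc_boundary[OF fin s h, folded U_def]
      have psub: "U \<subset> S" using ab(1,3) by blast
      have cU: "card U < n" unfolding n_def using psubset_card_mono[OF fin psub] .
      \<comment> \<open>The factor n - |U| is absorbed by the recursion of matching numbers, which
        leaves a kernel value at |U| - 1, that is, at |C| + m - 1.\<close>
      have "n - (card U - 1) = Suc (Suc (n - card U - 1))" using cU ab(4) h(3) by linarith
      then have "matching_number (n - (card U - 1)) = (real n - real (card U)) * matching_number (n - card U - 1)"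
        using cU by (simp add: matching_number_Suc_Suc of_nat_diff)
      then show "F (C \<union> arc s u m) = - wt s C * kernel n (card C + m - 1)"
        unfolding F_def U_def[symmetric] sum_wt_fpf_invol_boundary[OF fin s ab(1-3)] ab(7)
        using ab(4) by (simp add: kernel_def n_def)
    qed
    also have "\<dots> = (\<Sum>Q\<in>cycles S s. \<Sum>u\<in>Q. \<Sum>m\<in>{1..<card Q}. \<Sum>C\<in>inv_sets (S - Q) s. - wt s C * kernel n (card C + m - 1))"
    proof -
      have "finite Q" if "Q \<in> cycles S s" for Q using that fin finite_subset by (auto simp: cycles_def inv_sets_def)
      then have "(\<Sum>(Q, u, m, C)\<in>arc_index S s. - wt s C * kernel n (card C + m - 1))
          = (\<Sum>Q\<in>cycles S s. \<Sum>(u, m, C)\<in>Q \<times> {1..<card Q} \<times> inv_sets (S - Q) s. - wt s C * kernel n (card C + m - 1))"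
        unfolding arc_index_def using fin by (intro sum.Sigma[symmetric]) auto
      then show ?thesis by (simp only: sum.cartesian_product)
    qed
    also have "\<dots> = (\<Sum>Q\<in>cycles S s. - Lam n (smult (real (card Q)) ((\<Sum>i<card Q - 1. monom 1 i) * cycle_poly (S - Q) s)))"
    proof (rule sum.cong[OF refl])
      fix Q assume Q: "Q \<in> cycles S s"
      have QS: "Q \<subseteq> S" using Q by (auto simp: cycles_def inv_sets_def)
      have le: "card C + card Q \<le> n" if "C \<in> inv_sets (S - Q) s" for C
      proof -
        have "card (C \<union> Q) = card C + card Q"
          using that QS fin by (intro card_Un_disjoint) (auto simp: inv_sets_def intro: finite_subset)
        moreover have "card (C \<union> Q) \<le> n" unfolding n_def using that QS fin by (intro card_mono) (auto simp: inv_sets_def)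
        ultimately show ?thesis by simp
      qed
      have "(\<Sum>m\<in>{1..<card Q}. \<Sum>C\<in>inv_sets (S - Q) s. - wt s C * kernel n (card C + m - 1))
          = (\<Sum>i<card Q - 1. \<Sum>C\<in>inv_sets (S - Q) s. - wt s C * kernel n (card C + i))"
        by (rule sum.reindex_bij_witness[of _ Suc "\<lambda>m. m - 1"]) auto
      also have "\<dots> = (\<Sum>i<card Q - 1. \<Sum>C\<in>inv_sets (S - Q) s. - Lam n (monom 1 i * monom (wt s C) (card C)))"
      proof (intro sum.cong refl)
        fix i C assume "i \<in> {..<card Q - 1}" "C \<in> inv_sets (S - Q) s"
        then show "- wt s C * kernel n (card C + i) = - Lam n (monom 1 i * monom (wt s C) (card C))"
          using le[of C] by (simp add: mult_monom Lam_monom add.commute)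
      qed
      finally show "(\<Sum>u\<in>Q. \<Sum>m\<in>{1..<card Q}. \<Sum>C\<in>inv_sets (S - Q) s. - wt s C * kernel n (card C + m - 1))
          = - Lam n (smult (real (card Q)) ((\<Sum>i<card Q - 1. monom 1 i) * cycle_poly (S - Q) s))"
        using fin by (simp add: Lam_smult cycle_poly_eq_sum[OF _ inj] sum_product Lam_sum sum_negf)
    qed
    finally show ?thesis by (simp only: Lam_sum sum_negf)
  qed
  finally show ?thesis by (simp only: Lam_diff add_uminus_conv_diff)
qed

lemma smult_sum_right: "smult a (\<Sum>x\<in>A. f x) = (\<Sum>x\<in>A. smult a (f x))"
  by (induction A rule: infinite_finite_induct) (auto simp: smult_add_right)

text \<open>For odd j the recursion of matching numbers makes the two terms opposite; for even j all
  values are zero. In the Gaussian reading it is rotation invariance: the generator of rotations of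
  (X, Y), applied to (iX)^j Y^(n-j), has mean zero.\<close>

lemma kernel_relation:
  assumes "j < n"
  shows "(real n - real j) * kernel n (Suc j) + real j * kernel n (j - 1) = 0"
proof (cases "even j")
  case True
  then show ?thesis by (cases "j = 0") (auto simp: kernel_def matching_number_def)
next
  case False
  then obtain i where j: "j = Suc (2 * i)" by (auto elim: oddE)
  have "n - 2 * i = Suc (Suc (n - Suc (Suc (2 * i))))" using assms j by linarith
  then have "matching_number (n - 2 * i) = (real n - real j) * matching_number (n - Suc (Suc (2 * i)))"
    using assms j by (simp add: matching_number_Suc_Suc of_nat_diff)
  then have "kernel n (j - 1) = (-1) ^ i * matching_number (2 * i) * ((real n - real j) * matching_number (n - Suc (Suc (2 * i))))"
    using j by (simp add: kernel_def)
  moreover have "kernel n (Suc j) = - ((-1) ^ i * (real j * matching_number (2 * i)) * matching_number (n - Suc (Suc (2 * i))))"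
    using j by (simp add: kernel_def matching_number_Suc_Suc)
  ultimately show ?thesis by simp
qed

text \<open>For h = y^j the polynomial is (n - j) y^(j+1) + j y^(j-1), to which the kernel relation
  applies; the degree bound keeps all exponents within n.\<close>

lemma Lam_relation:
  assumes "degree h < n"
  shows "Lam n (smult (real n) (monom 1 1 * h) + (1 - monom 1 2) * pderiv h) = 0"
proof -
  have *: "Lam n (smult (real n) (monom 1 1 * monom a j) + (1 - monom 1 2) * pderiv (monom a j)) = 0"
    if "j < n" for a j
  proof -
    have "smult (real n) (monom 1 1 * monom a j) + (1 - monom 1 2) * pderiv (monom a j)
       = monom ((real n - real j) * a) (Suc j) + monom (real j * a) (j - 1)"
      by (cases j) (auto simp: pderiv_monom mult_monom smult_monom algebra_simps add_monom simp flip: diff_monom)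
    then have "Lam n (smult (real n) (monom 1 1 * monom a j) + (1 - monom 1 2) * pderiv (monom a j))
       = a * ((real n - real j) * kernel n (Suc j) + real j * kernel n (j - 1))"
      using that by (simp add: Lam_add Lam_monom algebra_simps)
    then show ?thesis using kernel_relation[OF that] by simp
  qed
  have h: "h = (\<Sum>j\<le>degree h. monom (coeff h j) j)" by (rule poly_as_sum_of_monoms[symmetric])
  have "Lam n (smult (real n) (monom 1 1 * h) + (1 - monom 1 2) * pderiv h)
     = (\<Sum>j\<le>degree h. Lam n (smult (real n) (monom 1 1 * monom (coeff h j) j) + (1 - monom 1 2) * pderiv (monom (coeff h j) j)))"
    by (subst h, subst (2) h) (simp only: pderiv_sum sum_distrib_left smult_sum_right Lam_add Lam_sum sum.distrib)
  also have "\<dots> = 0" using assms by (intro sum.neutral ballI *) auto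
  finally show ?thesis .
qed

lemma geometric_monom: "(1 - monom 1 1) * (\<Sum>i<k. monom 1 i) = (1 - monom 1 k :: real poly)"
proof (induction k)
  case (Suc k)
  then show ?case
    by (simp only: sum.lessThan_Suc distrib_left) (simp add: left_diff_distrib mult_monom)
qed simp

text \<open>H is E / (1 - y). Multiplying the arc sum B by 1 - y telescopes its geometric sums and
  yields B = n H + E', after which only H is left as an unknown polynomial.\<close>

theorem card_single_cycle_matchings:
  fixes H :: "real poly"
  assumes fin: "finite S" and s: "s permutes S" and ne: "S \<noteq> {}"
    and H: "(1 - monom 1 1) * H = cycle_poly S s"
  shows "real (card S) * real (card {t \<in> fpf_invol S. single_cycle S (s \<circ> t)}) = Lam (card S) ((1 + monom 1 1) * H)"
proof -
  define n where "n = card S"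
  define E where "E = cycle_poly S s"
  define X where "X = (monom 1 1 :: real poly)"
  define B where "B = (\<Sum>Q\<in>cycles S s. smult (real (card Q)) ((\<Sum>i<card Q - 1. monom 1 i) * cycle_poly (S - Q) s))"
  note inj = permutes_inj[OF s]
  have cy: "cycles (S - Q) s = cycles S s - {Q}" if "Q \<in> cycles S s" for Q
  proof -
    have "C \<subseteq> S - Q \<longleftrightarrow> C \<noteq> Q" if "C \<in> cycles S s" for C
    proof -
      have "C \<subseteq> S" "C \<noteq> {}" using that by (auto simp: cycles_def inv_sets_def)
      then show ?thesis using cycles_disjoint[OF inj that \<open>Q \<in> cycles S s\<close>] by blast
    qed
    then show ?thesis using cycles_subset[of "S - Q" S s] by auto
  qed
  have fQ: "finite Q" "0 < card Q" if "Q \<in> cycles S s" for Q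
    using that fin finite_subset by (auto simp: cycles_def inv_sets_def card_gt_0_iff)
  have n: "real n = (\<Sum>Q\<in>cycles S s. real (card Q))"
    using wt_Union_cycles(2)[OF fin inj, of "cycles S s"] Union_cycles[OF fin inj permutes_image[OF s]] by (simp add: n_def)
  have EQ: "E = (1 - monom 1 (card Q)) * cycle_poly (S - Q) s" if "Q \<in> cycles S s" for Q
    unfolding E_def cycle_poly_def cy[OF that] using that fin by (subst prod.remove[of _ Q]) auto
  have E': "pderiv E = (\<Sum>Q\<in>cycles S s. - smult (real (card Q)) (monom 1 (card Q - 1) * cycle_poly (S - Q) s))"
    unfolding E_def cycle_poly_def pderiv_prod
  proof (rule sum.cong[OF refl])
    fix Q assume Q: "Q \<in> cycles S s"
    have m: "monom (real (card Q)) (card Q - 1) = smult (real (card Q)) (monom 1 (card Q - 1))" by (simp add: smult_monom)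
    show "(\<Prod>C\<in>cycles S s - {Q}. 1 - monom 1 (card C)) * pderiv (1 - monom 1 (card Q)) =
        - smult (real (card Q)) (monom 1 (card Q - 1) * (\<Prod>C\<in>cycles (S - Q) s. 1 - monom 1 (card C)))"
      unfolding cy[OF Q] pderiv_diff pderiv_monom mult_1_right m by (simp add: mult.commute)
  qed
  have "(1 - X) * B = (\<Sum>Q\<in>cycles S s. smult (real (card Q)) ((1 - monom 1 (card Q - 1)) * cycle_poly (S - Q) s))"
    unfolding B_def sum_distrib_left X_def
    by (intro sum.cong refl) (simp only: geometric_monom mult_smult_right flip: mult.assoc)
  \<comment> \<open>With q = |Q|, the identity 1 - y^(q-1) = (1 - y^q) - (1 - y) y^(q-1) splits each
    summand. The first parts add up to n E, and the second parts reassemble the derivative of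
    E.\<close>
  also have "\<dots> = (\<Sum>Q\<in>cycles S s. smult (real (card Q)) E - (1 - X) * smult (real (card Q)) (monom 1 (card Q - 1) * cycle_poly (S - Q) s))"
  proof (intro sum.cong refl)
    fix Q assume Q: "Q \<in> cycles S s"
    have "X * monom 1 (card Q - 1) = monom 1 (card Q)" using fQ[OF Q] by (simp add: X_def mult_monom)
    then have "(1 - monom 1 (card Q - 1)) = (1 - monom 1 (card Q)) - (1 - X) * monom 1 (card Q - 1)"
      by (simp add: algebra_simps)
    then have "(1 - monom 1 (card Q - 1)) * cycle_poly (S - Q) s = E - (1 - X) * (monom 1 (card Q - 1) * cycle_poly (S - Q) s)"
      using EQ[OF Q] by (simp add: algebra_simps)
    then show "smult (real (card Q)) ((1 - monom 1 (card Q - 1)) * cycle_poly (S - Q) s)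
        = smult (real (card Q)) E - (1 - X) * smult (real (card Q)) (monom 1 (card Q - 1) * cycle_poly (S - Q) s)"
      by (simp only: smult_diff_right mult_smult_right)
  qed
  also have "\<dots> = (\<Sum>Q\<in>cycles S s. smult (real (card Q)) E)
      - (1 - X) * (\<Sum>Q\<in>cycles S s. smult (real (card Q)) (monom 1 (card Q - 1) * cycle_poly (S - Q) s))"
    by (simp only: sum_subtractf sum_distrib_left)
  also have "(\<Sum>Q\<in>cycles S s. smult (real (card Q)) (monom 1 (card Q - 1) * cycle_poly (S - Q) s)) = - pderiv E"
    by (simp add: E' sum_negf)
  also have "(\<Sum>Q\<in>cycles S s. smult (real (card Q)) E) = smult (real n) E"
    by (simp only: n smult_sum)
  also have "smult (real n) E - (1 - X) * (- pderiv E) = smult (real n) E + (1 - X) * pderiv E" by simp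
  also have "\<dots> = (1 - X) * (smult (real n) H + pderiv E)"
    using H by (simp add: E_def X_def distrib_left mult_smult_right)
  finally have B: "B = smult (real n) H + pderiv E"
    by (metis X_def mult_cancel_left diff_eq_diff_eq diff_self one_poly_eq_simps degree_monom_eq degree_1 zero_neq_one eq_iff_diff_eq_0)
  have pE: "pderiv E = (1 - X) * pderiv H - H"
    unfolding E_def H[symmetric] by (simp add: pderiv_mult pderiv_diff pderiv_monom X_def algebra_simps)
  \<comment> \<open>Substituting E = (1 - y) H leaves (1 + y) H minus exactly the combination that
    \<open>Lam_relation\<close> annihilates.\<close>
  have eq: "smult (real n) E - X * pderiv E - B = (1 + X) * H - (smult (real n) (X * H) + (1 - X * X) * pderiv H)"
    unfolding B pE unfolding E_def H[symmetric] X_def[symmetric] by (simp add: algebra_simps smult_diff_right smult_add_right)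
  have XX: "X * X = monom 1 2" by (simp add: X_def mult_monom numeral_2_eq_2)
  have "1 - monom 1 k \<noteq> (0 :: real poly)" if "0 < k" for k
    using that by (auto simp: poly_eq_iff intro!: exI[of _ 0])
  then have "E \<noteq> 0" using fQ fin by (auto simp: E_def cycle_poly_def)
  then have H0: "H \<noteq> 0" using H E_def by auto
  \<comment> \<open>E has degree at most n, so division by 1 - y brings the degree of H below n, as
    \<open>Lam_relation\<close> demands.\<close>
  have "degree E \<le> (\<Sum>Q\<in>cycles S s. degree (1 - monom 1 (card Q) :: real poly))"
    unfolding E_def cycle_poly_def
    using degree_prod_sum_le[of "cycles S s" "\<lambda>Q. 1 - monom 1 (card Q)"] fin by (simp add: o_def)
  also have "\<dots> \<le> (\<Sum>Q\<in>cycles S s. card Q)"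
    by (intro sum_mono degree_diff_le) (auto simp: degree_monom_le)
  also have "\<dots> = n" using n by (simp flip: of_nat_sum)
  finally have "degree E \<le> n" .
  moreover have "degree E = degree (1 - X) + degree H"
    unfolding E_def H[symmetric] X_def[symmetric] using H0 \<open>E \<noteq> 0\<close> H E_def X_def by (intro degree_mult_eq) auto
  moreover have "degree (1 - X) = 1"
    unfolding X_def by (simp add: monom_altdef one_pCons)
  ultimately have "degree H < n" by simp
  then have "Lam n (smult (real n) (X * H) + (1 - monom 1 2) * pderiv H) = 0" unfolding X_def by (rule Lam_relation)
  then have "Lam n (smult (real n) E - X * pderiv E - B) = Lam n ((1 + X) * H)"
    unfolding eq Lam_diff[of _ "(1 + X) * H"] XX by simp
  then show ?thesis
    using sum_over_fpf_invol[OF fin s] by (simp only: n_def E_def B_def X_def)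
qed

section \<open>Asymptotics of the count\<close>

lemma binomial_mult_le: "(a choose i) * (b choose j) \<le> (a + b) choose (i + j)"
proof -
  have "(a choose i) * (b choose j) = (\<Sum>k\<in>{i}. (a choose k) * (b choose (i + j - k)))" by simp
  also have "\<dots> \<le> (\<Sum>k\<le>i + j. (a choose k) * (b choose (i + j - k)))" by (intro sum_mono2) auto
  also have "\<dots> = (a + b) choose (i + j)" by (rule vandermonde)
  finally show ?thesis .
qed

lemma binomial_cube_le: "(r choose j) ^ 3 \<le> (3 * r) choose (3 * j)"
proof -
  have "(r choose j) ^ 3 = (r choose j) * (r choose j) * (r choose j)" by (simp add: power3_eq_cube)
  also have "\<dots> \<le> ((r + r) choose (j + j)) * (r choose j)" by (intro mult_right_mono binomial_mult_le) simp
  also have "\<dots> \<le> (r + r + r) choose (j + j + j)" by (rule binomial_mult_le)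
  also have "r + r + r = 3 * r" by simp
  also have "j + j + j = 3 * j" by simp
  finally show ?thesis .
qed

lemma matching_number_pos: "even n \<Longrightarrow> matching_number n > 0"
  by (simp add: matching_number_def)

lemma matching_number_nonneg [simp]: "matching_number n \<ge> 0"
  by (simp add: matching_number_def)

text \<open>For even k, m(k) m(n - k) C(n, k) = m(n) C(n/2, k/2), and C(n/2, k/2)^2 is at most C(n,
  k). So a given k-set is preserved by a share of at most C(n, k)^(-1/2) of all matchings.\<close>

lemma matching_number_ratio_le:
  assumes "even n" "k \<le> n"
  shows "(matching_number k * matching_number (n - k)) ^ 2 * real (n choose k) \<le> matching_number n ^ 2"
proof (cases "even k")
  case True
  obtain a where k: "k = 2 * a" using True by (auto elim: evenE)
  obtain m where n: "n = 2 * m" using assms by (auto elim: evenE)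
  define b where "b = m - a"
  have m: "m = a + b" using assms k n by (simp add: b_def)
  define q where "q = matching_number k * matching_number (n - k)"
  have nk: "n - k = 2 * b" using k n m by simp
  have b1: "real (n choose k) = fact n / (fact k * fact (n - k))"
    using assms by (simp add: binomial_fact)
  have b2: "real (m choose a) = fact m / (fact a * fact b)"
    using binomial_fact[of a m, where 'a = real] m by simp
  have eq: "q * real (n choose k) = matching_number n * real (m choose a)"
    unfolding q_def b1 b2 using m by (simp add: matching_number_def k n power_add divide_simps)
  have "real ((m choose a) * (m choose a)) \<le> real (n choose k)"
    using binomial_mult_le[of m a m a] by (simp only: of_nat_le_iff n k mult_2)
  then have le: "real (m choose a) ^ 2 \<le> real (n choose k)" by (simp add: power2_eq_square)
  have pos: "real (n choose k) > 0" using assms by (simp add: zero_less_binomial)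
  have "(q ^ 2 * real (n choose k)) * real (n choose k) = (q * real (n choose k)) ^ 2" by (simp add: power2_eq_square)
  also have "\<dots> = matching_number n ^ 2 * real (m choose a) ^ 2" unfolding eq by (rule power_mult_distrib)
  also have "\<dots> \<le> matching_number n ^ 2 * real (n choose k)" using le by (intro mult_left_mono) auto
  finally show ?thesis using pos unfolding q_def by simp
qed (simp add: matching_number_def)

text \<open>For even n the odd exponents 1 and n - 1 contribute nothing, so the sum over the
  exponents other than 0 and n runs from 2 to n - 2.\<close>

definition tail_bound :: "nat \<Rightarrow> real" where
  "tail_bound n = (\<Sum>k\<in>{2..n - 2}. real (n choose k) powr (-1/6))"

lemma tail_bound_nonneg: "tail_bound n \<ge> 0"
  unfolding tail_bound_def by (intro sum_nonneg) simp

text \<open>The exponent: a third from the binomial cubes, minus a half from the matching numbers.\<close>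

lemma binomial_kernel_le:
  assumes "even n" "n = 3 * r + d" "j \<le> r" "i \<le> d" "k = i + 3 * j"
  shows "real (r choose j) * (matching_number k * matching_number (n - k)) \<le> real (n choose k) powr (-1/6) * matching_number n"
proof -
  define q where "q = matching_number k * matching_number (n - k)"
  define c where "c = real (n choose k)"
  have kn: "k \<le> n" using assms by simp
  have c: "c > 0" using kn by (simp add: c_def zero_less_binomial)
  have q0: "q \<ge> 0" by (simp add: q_def)
  have "(r choose j) ^ 3 \<le> (3 * r choose 3 * j) * (d choose i)"
    using binomial_cube_le[of r j] zero_less_binomial[OF assms(4)] by (metis le_trans mult_le_mono nat_mult_1_right Suc_leI One_nat_def)
  also have "\<dots> \<le> n choose k" using binomial_mult_le[of "3 * r" "3 * j" d i] assms by (simp add: add.commute)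
  finally have 1: "real (r choose j) ^ 3 \<le> c" unfolding c_def by (metis of_nat_le_iff of_nat_power)
  have 2: "q ^ 2 * c \<le> matching_number n ^ 2" unfolding q_def c_def using matching_number_ratio_le[OF assms(1) kn] .
  \<comment> \<open>Sixth powers clear the exponents of both estimates: the cube of the binomial
    coefficient is at most c, and q^2 c is at most m(n)^2.\<close>
  have "(real (r choose j) * q) ^ 6 = (real (r choose j) ^ 3) ^ 2 * (q ^ 2) ^ 3" by (simp add: power_mult_distrib flip: power_mult)
  also have "\<dots> \<le> c ^ 2 * (q ^ 2) ^ 3" using 1 q0 by (intro mult_right_mono power_mono) auto
  also have "\<dots> = (q ^ 2 * c) ^ 3 / c" using c by (simp add: field_simps power2_eq_square power3_eq_cube)
  also have "\<dots> \<le> (matching_number n ^ 2) ^ 3 / c" using 2 c q0 by (intro divide_right_mono power_mono) auto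
  also have "\<dots> = (c powr (-1/6) * matching_number n) ^ 6"
  proof -
    have "(c powr (-1/6)) ^ 6 = c powr (6 * (-1/6))" using c by (subst powr_power) auto
    also have "\<dots> = 1 / c" using powr_neg_one[OF c] by simp
    finally show ?thesis by (simp add: power_mult_distrib flip: power_mult)
  qed
  finally show ?thesis unfolding q_def[symmetric] c_def[symmetric]
    by (rule power_le_imp_le_base[of _ 5, unfolded Suc_numeral, simplified]) auto
qed

text \<open>The 24 indices from 2 to 13 and from n - 13 to n - 2 give terms of order n^(-1/3). Each
  of the at most n others is of order n^(-14/6), so their sum also tends to 0. Any cutoff above 6 in
  place of 14 would serve this purpose, and n at least 30 keeps the ranges apart.\<close>

lemma tail_bound_tendsto_0: "tail_bound \<longlonglongrightarrow> 0"
proof (rule tendsto_sandwich)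
  show "\<forall>\<^sub>F n in sequentially. 0 \<le> tail_bound n" by (simp add: tail_bound_nonneg)
  show "\<forall>\<^sub>F n in sequentially. tail_bound n \<le> 24 * ((real n / 2) ^ 2) powr (-1/6) + real n * ((real n / 14) ^ 14) powr (-1/6)"
  proof (rule eventually_sequentiallyI[of 30])
    fix n :: nat assume n: "30 \<le> n"
    have mono: "n choose m \<le> n choose k" if "m \<le> k" "k \<le> n - m" for m k
    proof (cases "2 * k \<le> n")
      case True then show ?thesis using that by (intro binomial_mono) auto
    next
      case False
      have "n choose m \<le> n choose (n - k)" using that False by (intro binomial_mono) auto
      also have "\<dots> = n choose k" using that by (intro binomial_symmetric[symmetric]) auto
      finally show ?thesis .
    qed
    have bd: "real (n choose k) powr (-1/6) \<le> ((real n / real m) ^ m) powr (-1/6)" if "0 < m" "m \<le> k" "k \<le> n - m" for m k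
    proof (rule powr_mono2')
      show "0 < (real n / real m) ^ m" using that n by simp
      have "(real n / real m) ^ m \<le> real (n choose m)" using that by (intro binomial_ge_n_over_k_pow_k) auto
      also have "\<dots> \<le> real (n choose k)" using mono that by simp
      finally show "(real n / real m) ^ m \<le> real (n choose k)" .
    qed simp
    have "tail_bound n = (\<Sum>k\<in>{2..13} \<union> {n - 13..n - 2}. real (n choose k) powr (-1/6)) + (\<Sum>k\<in>{14..n - 14}. real (n choose k) powr (-1/6))"
      unfolding tail_bound_def using n by (subst sum.union_disjoint[symmetric]) (auto intro!: sum.cong)
    also have "\<dots> \<le> real (card ({2..13} \<union> {n - 13..n - 2})) * ((real n / 2) ^ 2) powr (-1/6)
        + real (card {14..n - 14}) * ((real n / 14) ^ 14) powr (-1/6)"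
      using bd[of 2] bd[of 14] n by (intro add_mono sum_bounded_above) auto
    also have "\<dots> \<le> 24 * ((real n / 2) ^ 2) powr (-1/6) + real n * ((real n / 14) ^ 14) powr (-1/6)"
      using n by (intro add_mono mult_right_mono) (auto simp: card_Un_disjoint)
    finally show "tail_bound n \<le> 24 * ((real n / 2) ^ 2) powr (-1/6) + real n * ((real n / 14) ^ 14) powr (-1/6)" .
  qed
  show "(\<lambda>n. 24 * ((real n / 2) ^ 2) powr (-1/6) + real n * ((real n / 14) ^ 14) powr (-1/6)) \<longlonglongrightarrow> 0"
    by real_asymp
qed auto

section \<open>Only the terms of exponent 0 and n survive\<close>

lemma power_one_minus_monom:
  "(1 - monom 1 m) ^ r = (\<Sum>j\<le>r. monom ((-1) ^ j * real (r choose j)) (m * j))"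
proof -
  have "(1 - monom 1 m :: real poly) ^ r = (monom (-1) m + 1) ^ r" by (simp flip: minus_monom)
  also have "\<dots> = (\<Sum>j\<le>r. of_nat (r choose j) * monom (-1) m ^ j * 1 ^ (r - j))" by (rule binomial_ring)
  also have "\<dots> = (\<Sum>j\<le>r. monom ((-1) ^ j * real (r choose j)) (m * j))"
  proof (rule sum.cong[OF refl])
    fix j
    have "of_nat (r choose j) = monom (real (r choose j)) 0" by (simp add: of_nat_poly monom_0)
    then show "of_nat (r choose j) * monom (-1) m ^ j * 1 ^ (r - j) = monom ((-1) ^ j * real (r choose j)) (m * j)"
      by (simp add: monom_power mult_monom mult.commute)
  qed
  finally show ?thesis .
qed

text \<open>The coefficient of the matching number is 2 or 0 by parity: an n-cycle with n even is an
  odd permutation, while the sign of \<open>s \<circ> t\<close> is always (-1)^(n/2) times that of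
  s. At most b points lie outside the 3-cycles of T, and the factor 2^b bounds the number of their
  subsets.\<close>

theorem card_single_cycle_matchings_approx:
  assumes fin: "finite S" and s: "s permutes S" and ev: "even (card S)"
    and T: "T \<subseteq> cycles S s" "\<And>Q. Q \<in> T \<Longrightarrow> card Q = 3" "T \<noteq> {}" and le: "card S \<le> 3 * card T + b"
  shows "\<bar>real (card S) * real (card {t \<in> fpf_invol S. single_cycle S (s \<circ> t)})
      - (1 - (-1) ^ (card S div 2) * of_int (sign s)) * matching_number (card S)\<bar>
    \<le> 6 * 2 ^ b * tail_bound (card S) * matching_number (card S)"
proof -
  define n where "n = card S"
  define S' where "S' = S - \<Union>T"
  \<comment> \<open>One cycle of T is set aside: its factor 1 - y^3 is divided by 1 - y to form H
    and leaves 1 + y + y^2.\<close>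
  define r where "r = card T - 1"
  note inj = permutes_inj[OF s]
  have finT: "finite T" using T fin finite_cycles finite_subset by metis
  have cT: "card T = Suc r" using T finT by (simp add: r_def card_gt_0_iff Suc_diff_1)
  have TS: "\<Union>T \<subseteq> S" using T by (auto simp: cycles_def inv_sets_def)
  have cUT: "card (\<Union>T) = 3 * card T" using wt_Union_cycles(2)[OF fin inj T(1)] T(2) by simp
  have S'S: "S' \<subseteq> S" "finite S'" using fin by (auto simp: S'_def)
  have nS': "n = card S' + 3 + 3 * r"
    using TS cUT cT fin card_mono[OF fin TS] finite_subset[OF TS fin] by (simp add: S'_def n_def card_Diff_subset)
  have S'b: "card S' \<le> b" using le nS' cT by (simp add: n_def)
  have ne: "S \<noteq> {}" using nS' n_def by auto
  have sS: "s ` S = S" using permutes_image[OF s] .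
  have sUT: "s ` \<Union>T = \<Union>T" using T(1) by (fastforce simp: cycles_def inv_sets_def)
  have sS': "s ` S' = S'" unfolding S'_def using sS sUT by (simp add: image_set_diff[OF inj])
  have cyc: "cycles S' s = cycles S s - T"
  proof -
    have "C \<subseteq> S' \<longleftrightarrow> C \<notin> T" if C: "C \<in> cycles S s" for C
    proof -
      have "C \<subseteq> S" "C \<noteq> {}" using C by (auto simp: cycles_def inv_sets_def)
      moreover have "C \<inter> D = {}" if "D \<in> T" "C \<noteq> D" for D using cycles_disjoint[OF inj C, of D] that T(1) by blast
      ultimately show ?thesis unfolding S'_def by blast
    qed
    then show ?thesis using cycles_subset[OF S'S(1), of s] by auto
  qed
  define X where "X k = (monom 1 k :: real poly)" for k
  define H where "H = (\<Sum>c<3. X c) * (1 - X 3) ^ r * cycle_poly S' s"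
  have "cycle_poly S s = (\<Prod>Q\<in>T. 1 - monom 1 (card Q)) * cycle_poly S' s"
    unfolding cycle_poly_def cyc using prod.subset_diff[OF T(1), of "\<lambda>Q. 1 - monom 1 (card Q)"] fin by (simp add: mult.commute)
  also have "(\<Prod>Q\<in>T. 1 - monom 1 (card Q)) = (1 - X 3) ^ card T"
    using T(2) by (simp add: X_def)
  also have "\<dots> = (1 - X 1) * (\<Sum>c<3. X c) * (1 - X 3) ^ r"
    unfolding cT X_def geometric_monom by simp
  finally have H: "(1 - monom 1 1) * H = cycle_poly S s" by (simp add: H_def X_def mult.assoc)
  \<comment> \<open>A quadruple (a, c, U, j) is one term in the expansion of (1 + y) (1 + y + y^2)
    (1 - y^3)^r times the polynomial of S'; \<open>ex\<close> is its exponent and \<open>co\<close>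
    its coefficient.\<close>
  define I where "I = {..<2::nat} \<times> {..<3::nat} \<times> inv_sets S' s \<times> {..r}"
  define ex where "ex = (\<lambda>(a, c, U, j). a + c + card (U :: 'a set) + 3 * (j :: nat))"
  define co where "co = (\<lambda>(a::nat, c::nat, U, j). wt s U * ((-1) ^ j * real (r choose j)))"
  have sumI: "(\<Sum>q\<in>I. g q) = (\<Sum>a<2. \<Sum>c<3. \<Sum>U\<in>inv_sets S' s. \<Sum>j\<le>r. g (a, c, U, j))" for g :: "_ \<Rightarrow> 'c :: comm_monoid_add"
    by (simp add: I_def sum.cartesian_product case_prod_unfold)
  have "(1 + monom 1 1) * H = (\<Sum>a<2. X a) * H" by (simp add: X_def numeral_2_eq_2 monom_0 one_pCons)
  also have "\<dots> = (\<Sum>a<2. X a) * ((\<Sum>c<3. X c) * ((\<Sum>U\<in>inv_sets S' s. monom (wt s U) (card U)) * (\<Sum>j\<le>r. monom ((-1) ^ j * real (r choose j)) (3 * j))))"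
    unfolding H_def cycle_poly_eq_sum[OF S'S(2) inj] X_def power_one_minus_monom by (simp only: mult_ac)
  also have "\<dots> = (\<Sum>q\<in>I. monom (co q) (ex q))"
    unfolding sum_distrib_right unfolding sum_distrib_left sumI ex_def co_def
    by (simp add: X_def mult_monom add_ac)
  finally have "Lam n ((1 + monom 1 1) * H) = (\<Sum>q\<in>I. Lam n (monom (co q) (ex q)))" by (simp only: Lam_sum)
  also have exn: "ex q \<le> n" if "q \<in> I" for q
  proof -
    obtain a c U j where q: "q = (a, c, U, j)" by (cases q)
    then have "card U \<le> card S'" using that S'S by (auto simp: I_def inv_sets_def intro: card_mono)
    then show ?thesis using that nS' by (auto simp: ex_def q I_def)
  qed
  then have "(\<Sum>q\<in>I. Lam n (monom (co q) (ex q))) = (\<Sum>q\<in>I. co q * kernel n (ex q))"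
    by (intro sum.cong refl Lam_monom)
  finally have count: "real n * real (card {t \<in> fpf_invol S. single_cycle S (s \<circ> t)}) = (\<Sum>q\<in>I. co q * kernel n (ex q))"
    using card_single_cycle_matchings[OF fin s ne H] by (simp only: n_def)
  \<comment> \<open>q0 and q1 are the only quadruples with exponent 0 and exponent n.\<close>
  define q0 where "q0 = (0::nat, 0::nat, {} :: 'a set, 0::nat)"
  define q1 where "q1 = (1::nat, 2::nat, S', r)"
  define B where "B = - ((-1) ^ (n div 2) * of_int (sign s)) * matching_number n"
  define main where "main q = (if q = q0 then matching_number n else 0) + (if q = q1 then B else 0)" for q
  have finI: "finite I" using S'S by (simp add: I_def)
  have "q0 \<in> I" "q1 \<in> I" using sS' by (auto simp: q0_def q1_def I_def inv_sets_def)
  then have main_sum: "(\<Sum>q\<in>I. main q) = matching_number n + B"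
    unfolding main_def using finI by (simp add: sum.distrib)
  \<comment> \<open>The weights of S' and of the union of T multiply to the weight of S, which is
    the sign of s because n is even.\<close>
  have co_q1: "co q1 * (-1) ^ (n div 2) * matching_number n = B"
  proof -
    have "wt s S = wt s S' * wt s (\<Union>T)"
      using wt_Un[OF inj sS' sUT] S'S TS finite_subset[OF TS fin] by (auto simp: S'_def Un_absorb2)
    also have "wt s (\<Union>T) = (-1) ^ Suc r" using wt_Union_cycles(1)[OF fin inj T(1)] cT by simp
    finally have "wt s S' * (-1) ^ r = - wt s S" by simp
    moreover have "wt s S = of_int (sign s)" using ev s by (simp add: wt_def)
    ultimately show ?thesis by (simp add: co_def q1_def B_def)
  qed
  define x where "x k = (if 2 \<le> k \<and> k \<le> n - 2 then real (n choose k) powr (-1/6) * matching_number n else 0)" for k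
  have x0: "x k \<ge> 0" for k by (simp add: x_def)
  have ev: "even n" using ev by (simp add: n_def)
  have diff: "\<bar>co q * kernel n (ex q) - main q\<bar> \<le> x (ex q)" if qI: "q \<in> I" for q
  proof -
    obtain a c U j where q: "q = (a, c, U, j)" by (cases q)
    have acj: "a < 2" "c < 3" "j \<le> r" and U: "U \<in> inv_sets S' s" using qI by (auto simp: I_def q)
    have US: "U \<subseteq> S'" using U by (auto simp: inv_sets_def)
    have cU: "card U \<le> card S'" using US S'S by (auto intro: card_mono)
    have aw: "\<bar>wt s U\<bar> = 1" by (simp add: wt_def abs_mult flip: of_int_abs)
    have q0iff: "q = q0 \<longleftrightarrow> ex q = 0"
      using finite_subset[OF US S'S(2)] by (auto simp: q0_def q ex_def)
    have q1iff: "q = q1 \<longleftrightarrow> ex q = n"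
    proof
      assume "q = q1" then show "ex q = n" using nS' by (simp add: q1_def ex_def)
    next
      assume "ex q = n"
      then have "a = 1" "c = 2" "j = r" "card U = card S'" using acj cU nS' by (auto simp: ex_def q)
      then show "q = q1" using card_subset_eq[OF S'S(2) US] by (simp add: q q1_def)
    qed
    have kn: "ex q \<le> n" using exn[OF qI] .
    have n0: "n \<noteq> 0" using nS' by simp
    consider "ex q = 0" | "ex q = n" | "odd (ex q)" "ex q \<noteq> 0" "ex q \<noteq> n" | "2 \<le> ex q" "ex q \<le> n - 2"
    proof -
      have "even (ex q) \<Longrightarrow> ex q \<noteq> 0 \<Longrightarrow> ex q \<noteq> n \<Longrightarrow> 2 \<le> ex q \<and> ex q \<le> n - 2"
        using ev kn by presburger
      then show ?thesis using that by blast
    qed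
    then show ?thesis
    proof cases
      case 1
      then have "q = q0" "q \<noteq> q1" using q0iff q1iff n0 by auto
      then show ?thesis using x0[of "ex q"] 1 by (simp add: main_def co_def q0_def kernel_def)
    next
      case 2
      then have "q = q1" "q \<noteq> q0" using q0iff q1iff n0 by auto
      moreover have "co q * kernel n (ex q) = B" using co_q1 \<open>q = q1\<close> 2 by (simp add: kernel_def mult.assoc)
      ultimately show ?thesis using x0[of "ex q"] by (simp add: main_def)
    next
      case 3
      then have "main q = 0" "kernel n (ex q) = 0" using q0iff q1iff by (auto simp: main_def kernel_def matching_number_def)
      then show ?thesis using x0[of "ex q"] by simp
    next
      case 4
      then have "main q = 0" using q0iff q1iff n0 by (auto simp: main_def)
      then have "\<bar>co q * kernel n (ex q) - main q\<bar> = real (r choose j) * (matching_number (ex q) * matching_number (n - ex q))"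
        using aw by (simp add: co_def q kernel_def abs_mult power_abs)
      also have "\<dots> \<le> real (n choose ex q) powr (-1/6) * matching_number n"
        using acj cU nS' by (intro binomial_kernel_le[OF ev, of r "card S' + 3" j "a + c + card U"]) (auto simp: ex_def q)
      also have "\<dots> = x (ex q)" using 4 by (simp add: x_def)
      finally show ?thesis .
    qed
  qed
  have "\<bar>(\<Sum>q\<in>I. co q * kernel n (ex q)) - (\<Sum>q\<in>I. main q)\<bar> \<le> (\<Sum>q\<in>I. x (ex q))"
    using diff by (simp add: flip: sum_subtractf) (rule order_trans[OF sum_abs sum_mono])
  also have "\<dots> = (\<Sum>a<2. \<Sum>c<3. \<Sum>U\<in>inv_sets S' s. \<Sum>j\<le>r. x (a + c + card U + 3 * j))"
    by (simp add: I_def sum.cartesian_product ex_def case_prod_unfold)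
  also have "\<dots> \<le> (\<Sum>a<2::nat. \<Sum>c<3::nat. \<Sum>U\<in>inv_sets S' s. tail_bound n * matching_number n)"
  proof (intro sum_mono)
    fix a c U
    \<comment> \<open>For given a, c and U the exponents are pairwise different, so each term of the
      tail is used at most once. The factor 6 in the result counts the pairs (a, c).\<close>
    have "(\<Sum>j\<le>r. x (a + c + card U + 3 * j)) = (\<Sum>k\<in>(\<lambda>j. a + c + card U + 3 * j) ` {..r}. x k)"
      by (subst sum.reindex) (auto simp: inj_on_def)
    also have "\<dots> \<le> (\<Sum>k\<in>(\<lambda>j. a + c + card U + 3 * j) ` {..r} \<union> {2..n - 2}. x k)"
      using x0 by (intro sum_mono2) auto
    also have "\<dots> = (\<Sum>k\<in>{2..n - 2}. x k)" by (intro sum.mono_neutral_right) (auto simp: x_def)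
    also have "\<dots> = tail_bound n * matching_number n" by (simp add: tail_bound_def x_def sum_distrib_right)
    finally show "(\<Sum>j\<le>r. x (a + c + card U + 3 * j)) \<le> tail_bound n * matching_number n" .
  qed
  also have "\<dots> = 6 * real (card (inv_sets S' s)) * (tail_bound n * matching_number n)" by simp
  also have "\<dots> \<le> 6 * 2 ^ b * (tail_bound n * matching_number n)"
  proof -
    have "card (inv_sets S' s) \<le> card (Pow S')" using S'S by (intro card_mono) (auto simp: inv_sets_def)
    also have "\<dots> \<le> 2 ^ b" using S'S S'b by (simp add: card_Pow)
    finally have "real (card (inv_sets S' s)) \<le> 2 ^ b" by (metis of_nat_le_iff of_nat_numeral of_nat_power)
    then show ?thesis using tail_bound_nonneg by (intro mult_right_mono) auto
  qed
  finally show ?thesis unfolding count[unfolded n_def] main_sum[unfolded n_def]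
    using count main_sum by (simp add: B_def n_def algebra_simps)
qed

section \<open>Partial matchings\<close>

text \<open>The points of D are spliced out one by one. The assumption on invariant subsets is
  inherited by the shorter permutation, so no point is fixed when its turn comes and every removal
  flips the sign. That points with image outside D keep this image later preserves the cycles of s
  that avoid D.\<close>

lemma contract_permutation:
  assumes "finite D" "finite S" "D \<subseteq> S" "p permutes S"
    and "\<And>X. X \<subseteq> D \<Longrightarrow> p ` X = X \<Longrightarrow> X = {}"
  shows "\<exists>q. q permutes (S - D) \<and> sign q = (-1) ^ card D * sign p \<and>
    (\<forall>z\<in>S - D. p z \<notin> D \<longrightarrow> q z = p z) \<and>
    (\<forall>t. t permutes (S - D) \<longrightarrow> single_cycle S (p \<circ> t) = single_cycle (S - D) (q \<circ> t))"
  using assms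
proof (induction D arbitrary: S p rule: finite_induct)
  case empty
  then show ?case by (intro exI[of _ p]) auto
next
  case (insert x D)
  note p = insert.prems(3) and noinv = insert.prems(4)
  have x: "x \<in> S" using insert.prems by auto
  have px: "p x \<noteq> x" using noinv[of "{x}"] by auto
  note inj = permutes_inj[OF p]
  let ?p = "remove_point x p"
  have Seq: "S - insert x D = (S - {x}) - D" by auto
  have "X = {}" if X: "X \<subseteq> D" "?p ` X = X" for X
  proof (rule ccontr)
    assume "X \<noteq> {}"
    have "X \<subseteq> S - {x}" using X insert by auto
    from invariant_remove_point[OF p insert.prems(1) this X(2)] show False
      using noinv[of X] noinv[of "insert x X"] X \<open>X \<noteq> {}\<close> by auto
  qed
  moreover have "D \<subseteq> S - {x}" using insert by auto
  ultimately obtain q where q: "q permutes (S - {x} - D)" "sign q = (-1) ^ card D * sign ?p"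
      "\<And>z. z \<in> S - {x} - D \<Longrightarrow> ?p z \<notin> D \<Longrightarrow> q z = ?p z"
      "\<And>t. t permutes (S - {x} - D) \<Longrightarrow> single_cycle (S - {x}) (?p \<circ> t) = single_cycle (S - {x} - D) (q \<circ> t)"
    using insert.IH[of "S - {x}" ?p] remove_point_permutes[OF p x] insert.prems(1) by (metis finite_Diff)
  show ?case
    unfolding Seq
  proof (intro exI[of _ q] conjI ballI allI impI)
    show "sign q = (-1) ^ card (insert x D) * sign p"
      using q(2) sign_remove_point[OF p insert.prems(1) px] insert.hyps by simp
    show "q z = p z" if "z \<in> S - {x} - D" "p z \<notin> insert x D" for z
      using q(3)[OF that(1)] that remove_point_apply[OF inj, of z x] by auto
    fix t assume t: "t permutes (S - {x} - D)"
    then have tx: "t x = x" by (auto dest: permutes_not_in)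
    have "t permutes S" using permutes_subset[OF t, of S] by auto
    then have pt: "p \<circ> t permutes S" using p by (rule permutes_compose)
    have "single_cycle (S - {x}) (remove_point x (p \<circ> t)) = single_cycle S (p \<circ> t)"
      using px tx by (intro single_cycle_remove_point[OF pt insert.prems(1) x]) simp
    moreover have "remove_point x (p \<circ> t) = ?p \<circ> t" using tx by (simp add: remove_point_def comp_assoc)
    ultimately show "single_cycle S (p \<circ> t) = single_cycle (S - {x} - D) (q \<circ> t)" using q(4)[OF t] by simp
  qed (rule q(1))
qed

section \<open>Permutations all of whose cycles have length three\<close>

lemma three_cycles:
  assumes "finite S" "s permutes S" "\<And>x. x \<in> S \<Longrightarrow> s x \<noteq> x" "\<And>x. x \<in> S \<Longrightarrow> s (s (s x)) = x" "Q \<in> cycles S s"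
  shows "card Q = 3"
proof -
  have QS: "Q \<subseteq> S" "s ` Q = Q" "Q \<noteq> {}" "single_cycle Q s" using assms by (auto simp: cycles_def inv_sets_def)
  obtain x where x: "x \<in> Q" using QS by blast
  have xS: "x \<in> S" using x QS by blast
  have sub: "{x, s x, s (s x)} \<subseteq> Q" using x QS by blast
  have "s ` {x, s x, s (s x)} = {x, s x, s (s x)}" using assms(4)[OF xS] by auto
  then have Q: "Q = {x, s x, s (s x)}" using single_cycleD[OF QS(4) sub] by auto
  have "s x \<in> S" using x QS by blast
  then have "s (s x) \<noteq> s x" "s x \<noteq> x" using assms(3) xS by auto
  moreover have "s (s x) \<noteq> x" using assms(4)[OF xS] assms(3)[OF xS] by auto
  ultimately show ?thesis unfolding Q by auto
qed

lemma sign_three_cycles: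
  assumes fin: "finite S" and s: "s permutes S" and "\<And>Q. Q \<in> cycles S s \<Longrightarrow> card Q = 3"
  shows "sign s = 1" "card S = 3 * card (cycles S s)"
proof -
  note inj = permutes_inj[OF s]
  have U: "\<Union>(cycles S s) = S" using Union_cycles[OF fin inj permutes_image[OF s]] .
  show c: "card S = 3 * card (cycles S s)" using wt_Union_cycles(2)[OF fin inj, of "cycles S s"] U assms(3) by simp
  have "wt s S = (-1) ^ card (cycles S s)" using wt_Union_cycles(1)[OF fin inj, of "cycles S s"] U by simp
  then have "(-1) ^ (3 * card (cycles S s)) * (of_int (sign s) :: real) = (-1) ^ card (cycles S s)"
    using s c by (simp add: wt_def)
  moreover have "((-1) ^ (3 * card (cycles S s)) :: real) = (-1) ^ card (cycles S s)" by (simp add: power_mult)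
  ultimately have "(of_int (sign s) :: real) = 1" by simp
  then show "sign s = 1" by simp
qed

text \<open>Each point of D lies on one cycle, so at most |D| cycles are hit.\<close>

lemma cycles_avoiding:
  assumes fin: "finite S" and s: "s permutes S" and D: "D \<subseteq> S"
  shows "card (cycles S s) \<le> card {Q \<in> cycles S s. Q \<inter> D = {}} + card D"
proof -
  note inj = permutes_inj[OF s]
  have finD: "finite D" using D fin finite_subset by blast
  define c where "c x = (THE Q. Q \<in> cycles S s \<and> x \<in> Q)" for x
  have c: "c x = Q" if "Q \<in> cycles S s" "x \<in> Q" for x Q
    unfolding c_def using that cycles_disjoint[OF inj that(1)] by (intro the_equality) auto
  have "cycles S s \<subseteq> {Q \<in> cycles S s. Q \<inter> D = {}} \<union> c ` D"
  proof
    fix Q assume "Q \<in> cycles S s"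
    then show "Q \<in> {Q \<in> cycles S s. Q \<inter> D = {}} \<union> c ` D" using c[of Q] by (cases "Q \<inter> D = {}") auto
  qed
  then have "card (cycles S s) \<le> card ({Q \<in> cycles S s. Q \<inter> D = {}} \<union> c ` D)"
    using fin finD by (intro card_mono) auto
  also have "\<dots> \<le> card {Q \<in> cycles S s. Q \<inter> D = {}} + card (c ` D)" by (rule card_Un_le)
  also have "card (c ` D) \<le> card D" using finD by (rule card_image_le)
  finally show ?thesis by simp
qed

definition completions :: "'a set \<Rightarrow> ('a \<Rightarrow> 'a) \<Rightarrow> 'a set \<Rightarrow> ('a \<Rightarrow> 'a) \<Rightarrow> ('a \<Rightarrow> 'a) set" where
  "completions S s D m = {t \<in> fpf_invol S. (\<forall>x\<in>D. t x = m x) \<and> single_cycle S (s \<circ> t)}"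

text \<open>For every t extending m, such an X is also invariant under \<open>s \<circ> t\<close>:
  the prescribed pairs alone already close some vertex of the triangulation.\<close>

definition closes_face :: "('a \<Rightarrow> 'a) \<Rightarrow> 'a set \<Rightarrow> ('a \<Rightarrow> 'a) \<Rightarrow> bool" where
  "closes_face s D m \<longleftrightarrow> (\<exists>X\<subseteq>D. X \<noteq> {} \<and> (s \<circ> m) ` X = X)"

lemma completions_empty:
  assumes "closes_face s D m" "D \<subset> S"
  shows "completions S s D m = {}"
proof -
  obtain X where X: "X \<subseteq> D" "X \<noteq> {}" "(s \<circ> m) ` X = X" using assms(1) by (auto simp: closes_face_def)
  have False if "t \<in> completions S s D m" for t
  proof -
    have t: "single_cycle S (s \<circ> t)" "\<And>x. x \<in> D \<Longrightarrow> t x = m x" using that by (auto simp: completions_def)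
    have "(s \<circ> t) ` X = (s \<circ> m) ` X" using t(2) X(1) by (intro image_cong) auto
    then have "X = {} \<or> X = S" using X assms(2) by (intro single_cycleD[OF t(1)]) auto
    then show False using X assms(2) by auto
  qed
  then show ?thesis by blast
qed

text \<open>Splicing out D leaves a permutation of S - D that still has all 3-cycles of s avoiding
  D. There are at least 2N - |D| of these, so at most 2|D| of the 6N - |D| points lie outside them;
  this is the exponent of 2 in the error.\<close>

lemma card_completions_approx:
  assumes fin: "finite S" and s: "s permutes S" and no_fix: "\<And>x. x \<in> S \<Longrightarrow> s x \<noteq> x" and three: "\<And>x. x \<in> S \<Longrightarrow> s (s (s x)) = x"
    and D: "D \<subseteq> S" and m: "m \<in> fpf_invol D" and cS: "card S = 6 * N" "odd N" "card D < 2 * N"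
    and good: "\<not> closes_face s D m"
  shows "\<bar>real (card (S - D)) * real (card (completions S s D m)) - 2 * matching_number (card (S - D))\<bar>
    \<le> 6 * 2 ^ (2 * card D) * tail_bound (card (S - D)) * matching_number (card (S - D))"
proof -
  define p where "p = s \<circ> m"
  have finD: "finite D" using D fin finite_subset by blast
  note mD = fpf_involD[OF m]
  have mS: "m permutes S" using permutes_subset[OF mD(1) D] .
  have p: "p permutes S" unfolding p_def using permutes_compose[OF mS s] .
  have "X = {}" if "X \<subseteq> D" "p ` X = X" for X using good that by (auto simp: closes_face_def p_def)
  from contract_permutation[OF finD fin D p this] obtain q where
    q: "q permutes (S - D)" "sign q = (-1) ^ card D * sign p" "\<And>z. z \<in> S - D \<Longrightarrow> p z \<notin> D \<Longrightarrow> q z = p z"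
      "\<And>t. t permutes (S - D) \<Longrightarrow> single_cycle S (p \<circ> t) = single_cycle (S - D) (q \<circ> t)" by blast
  have c3: "card Q = 3" if "Q \<in> cycles S s" for Q using three_cycles[OF fin s no_fix three that] .
  note s3 = sign_three_cycles[OF fin s c3]
  have evD: "even (card D)" using sign_fpf_invol(2)[OF finD m] .
  then obtain e where e: "card D = 2 * e" by (auto elim: evenE)
  have cD: "card (S - D) = 6 * N - 2 * e" using card_Diff_subset[OF finD D] cS e by simp
  have eN: "2 * e < 2 * N" using cS e by simp
  have "sign p = sign s * sign m" unfolding p_def
    using permutes_imp_permutation[OF fin s] permutes_imp_permutation[OF fin mS] by (rule sign_compose)
  then have sq: "sign q = (-1) ^ e" using q(2) s3(1) sign_fpf_invol(1)[OF finD m] e by simp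
  \<comment> \<open>The sign of q is (-1)^e: splicing out the even number |D| of points changes
    nothing, and m contributes e transpositions. The total sign is then (-1)^(3N), and N odd makes
    the coefficient 2.\<close>
  have "card (S - D) div 2 + e = 3 * N" using cD eN by simp
  then have "(-1) ^ (card (S - D) div 2) * of_int (sign q) = ((-1) ^ (3 * N) :: real)"
    unfolding sq by (metis of_int_minus of_int_1 of_int_power power_add)
  also have "\<dots> = -1" using cS(2) by simp
  finally have const: "1 - (-1) ^ (card (S - D) div 2) * of_int (sign q) = (2 :: real)" by simp
  define T where "T = {Q \<in> cycles S s. Q \<inter> D = {}}"
  have TD: "T \<subseteq> cycles (S - D) q"
  proof
    fix Q assume Q: "Q \<in> T"
    then have QS: "Q \<subseteq> S" "Q \<inter> D = {}" "s ` Q = Q" "single_cycle Q s" "Q \<noteq> {}"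
      by (auto simp: T_def cycles_def inv_sets_def)
    have qs: "q x = s x" if "x \<in> Q" for x
    proof -
      have "m x = x" using that QS mD(6) by blast
      then have "p x = s x" by (simp add: p_def)
      moreover have "s x \<in> Q" using that QS by blast
      ultimately show ?thesis using q(3)[of x] that QS by auto
    qed
    then have "single_cycle Q q" "q ` Q = Q" using QS single_cycle_cong[of Q q s] by (auto cong: image_cong)
    then show "Q \<in> cycles (S - D) q" using QS by (auto simp: cycles_def inv_sets_def)
  qed
  have cT: "card (cycles S s) \<le> card T + card D" unfolding T_def by (rule cycles_avoiding[OF fin s D])
  have cc: "card (cycles S s) = 2 * N" using s3(2) cS by simp
  have le: "card (S - D) \<le> 3 * card T + 2 * card D" using cT cc cD e by simp
  have "T \<noteq> {}" using cT cc cS by auto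
  have approx: "\<bar>real (card (S - D)) * real (card {t \<in> fpf_invol (S - D). single_cycle (S - D) (q \<circ> t)}) - 2 * matching_number (card (S - D))\<bar>
    \<le> 6 * 2 ^ (2 * card D) * tail_bound (card (S - D)) * matching_number (card (S - D))"
    using card_single_cycle_matchings_approx[OF _ q(1) _ TD _ \<open>T \<noteq> {}\<close> le] fin cD c3 const by (simp add: T_def)
  have "bij_betw (\<lambda>t. m \<circ> t) {t \<in> fpf_invol (S - D). single_cycle (S - D) (q \<circ> t)} (completions S s D m)"
  proof (rule bij_betw_subset[OF bij_betw_fpf_invol_extend[OF m D]])
    have sc: "single_cycle S (s \<circ> (m \<circ> t)) \<longleftrightarrow> single_cycle (S - D) (q \<circ> t)" if "t \<in> fpf_invol (S - D)" for t
      using q(4)[OF fpf_involD(1)[OF that]] by (simp add: p_def comp_assoc)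
    have "completions S s D m = {t \<in> {t \<in> fpf_invol S. \<forall>x\<in>D. t x = m x}. single_cycle S (s \<circ> t)}"
      by (auto simp: completions_def)
    also have "\<dots> = {t \<in> (\<lambda>t. m \<circ> t) ` fpf_invol (S - D). single_cycle S (s \<circ> t)}"
      using bij_betw_imp_surj_on[OF bij_betw_fpf_invol_extend[OF m D]] by simp
    also have "\<dots> = (\<lambda>t. m \<circ> t) ` {t \<in> fpf_invol (S - D). single_cycle (S - D) (q \<circ> t)}" using sc by blast
    finally show "(\<lambda>t. m \<circ> t) ` {t \<in> fpf_invol (S - D). single_cycle (S - D) (q \<circ> t)} = completions S s D m" ..
  qed auto
  then show ?thesis using approx by (simp add: bij_betw_same_card)
qed

section \<open>Limits along odd N\<close>

definition odd_numbers :: "nat filter" where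
  "odd_numbers = inf sequentially (principal {N. odd N})"

lemma eventually_odd_numbers: "eventually P odd_numbers \<longleftrightarrow> (\<forall>\<^sub>F N in sequentially. odd N \<longrightarrow> P N)"
  by (simp add: odd_numbers_def eventually_inf_principal)

lemma tendsto_odd_numbers: "f \<longlonglongrightarrow> l \<Longrightarrow> (f \<longlongrightarrow> l) odd_numbers"
  unfolding odd_numbers_def by (rule filterlim_mono) auto

text \<open>Passing from 6N - 2e to 6N points multiplies the matching number by e factors, each
  asymptotic to 6N.\<close>

lemma matching_number_ratio:
  "(\<lambda>N. (matching_number (6 * N - 2 * e) / real (6 * N - 2 * e)) / (matching_number (6 * N) / real (6 * N)) * real (6 * N) ^ e)
    \<longlonglongrightarrow> 1"
proof -
  have prod: "matching_number (n + 2 * e) = (\<Prod>i<e. real (n + 2 * i + 1)) * matching_number n" for n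
    by (induction e) (auto simp: matching_number_Suc_Suc algebra_simps)
  have "(\<lambda>N. real (6 * N) / real (6 * N - 2 * e) * (\<Prod>i<e. real (6 * N) / real (6 * N - 2 * e + 2 * i + 1))) \<longlonglongrightarrow> 1 * (\<Prod>i<e. 1)"
    by (intro tendsto_mult tendsto_prod; real_asymp)
  moreover have "\<forall>\<^sub>F N in sequentially. real (6 * N) / real (6 * N - 2 * e) * (\<Prod>i<e. real (6 * N) / real (6 * N - 2 * e + 2 * i + 1))
     = (matching_number (6 * N - 2 * e) / real (6 * N - 2 * e)) / (matching_number (6 * N) / real (6 * N)) * real (6 * N) ^ e"
  proof (rule eventually_sequentiallyI[of "e + 1"])
    fix N assume N: "e + 1 \<le> N"
    define n where "n = 6 * N - 2 * e"
    have n: "6 * N = n + 2 * e" "0 < n" "even n" using N by (auto simp: n_def)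
    have pos: "matching_number n > 0" using matching_number_pos n by simp
    have "(\<Prod>i<e. real (6 * N) / real (n + 2 * i + 1)) = real (6 * N) ^ e / (\<Prod>i<e. real (n + 2 * i + 1))"
      by (simp add: prod_dividef)
    moreover have "(\<Prod>i<e. real (n + 2 * i + 1)) > 0" by (intro prod_pos) auto
    ultimately show "real (6 * N) / real (6 * N - 2 * e) * (\<Prod>i<e. real (6 * N) / real (6 * N - 2 * e + 2 * i + 1))
     = (matching_number (6 * N - 2 * e) / real (6 * N - 2 * e)) / (matching_number (6 * N) / real (6 * N)) * real (6 * N) ^ e"
      unfolding n_def[symmetric] using prod[of n] pos n by (simp add: divide_simps)
  qed
  ultimately show ?thesis by (simp add: filterlim_cong)
qed

text \<open>In the application x and y are the normalised counts with and without prescribed pairs,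
  both close to 2, and r is the deterministic correction. The 3 bounds x / y.\<close>

lemma ratio_bound:
  fixes x y r :: real
  assumes "\<bar>x - 2\<bar> \<le> d" "\<bar>y - 2\<bar> \<le> d'" "d \<le> 1" "d' \<le> 1"
  shows "\<bar>r * (x / y) - 1\<bar> \<le> 3 * \<bar>r - 1\<bar> + d + d'"
proof -
  have y: "1 \<le> y" and x: "0 \<le> x" "x \<le> 3" using assms by auto
  have "x \<le> 3 * y" using x y by simp
  then have xy: "\<bar>x / y\<bar> \<le> 3" using y x by (simp add: divide_simps)
  have "x / y - 1 = (x - y) / y" using y by (simp add: field_simps)
  then have "\<bar>x / y - 1\<bar> = \<bar>x - y\<bar> / y" using y by simp
  also have "\<dots> \<le> \<bar>x - y\<bar> / 1" using y by (intro divide_left_mono) auto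
  also have "\<dots> \<le> d + d'" using assms by auto
  finally have 1: "\<bar>x / y - 1\<bar> \<le> d + d'" .
  have "r * (x / y) - 1 = (r - 1) * (x / y) + (x / y - 1)" by (simp only: left_diff_distrib)
  then have "\<bar>r * (x / y) - 1\<bar> \<le> \<bar>r - 1\<bar> * \<bar>x / y\<bar> + \<bar>x / y - 1\<bar>" by (metis abs_mult abs_triangle_ineq)
  also have "\<dots> \<le> \<bar>r - 1\<bar> * 3 + (d + d')" using xy 1 by (intro add_mono mult_left_mono) auto
  finally show ?thesis by simp
qed

text \<open>The quantifiers over D and m stand inside the eventuality: the threshold for N depends
  on e and \<epsilon> only. This uniformity is needed because the number of partial matchings summed
  over grows with N.\<close>

lemma completions_ratio:
  fixes e :: nat and \<epsilon> :: real
  assumes "\<epsilon> > 0"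
  shows "\<forall>\<^sub>F N in odd_numbers. \<forall>(S :: 'a set) s D m.
    finite S \<longrightarrow> s permutes S \<longrightarrow> (\<forall>x\<in>S. s x \<noteq> x \<and> s (s (s x)) = x) \<longrightarrow> card S = 6 * N \<longrightarrow>
    D \<subseteq> S \<longrightarrow> m \<in> fpf_invol D \<longrightarrow> card D = 2 * e \<longrightarrow>
    0 < card (completions S s {} id) \<and>
    (if closes_face s D m then completions S s D m = {}
     else \<bar>real (card (completions S s D m)) / real (card (completions S s {} id)) * real (6 * N) ^ e - 1\<bar> < \<epsilon>)"
proof -
  define r where "r N = (matching_number (6 * N - 2 * e) / real (6 * N - 2 * e)) / (matching_number (6 * N) / real (6 * N)) * real (6 * N) ^ e" for N
  define d where "d N = 6 * 2 ^ (2 * (2 * e)) * tail_bound (6 * N - 2 * e)" for N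
  define d' where "d' N = 6 * tail_bound (6 * N)" for N
  have lim: "filterlim (\<lambda>N. 6 * N - 2 * e) sequentially sequentially" "filterlim (\<lambda>N::nat. 6 * N) sequentially sequentially"
    by real_asymp+
  have "(\<lambda>N. d N) \<longlonglongrightarrow> 6 * 2 ^ (2 * (2 * e)) * 0" unfolding d_def
    by (intro tendsto_mult tendsto_const filterlim_compose[OF tail_bound_tendsto_0] lim)
  moreover have "(\<lambda>N. d' N) \<longlonglongrightarrow> 6 * 0" unfolding d'_def
    by (intro tendsto_mult tendsto_const filterlim_compose[OF tail_bound_tendsto_0] lim)
  ultimately have dd: "d \<longlonglongrightarrow> 0" "d' \<longlonglongrightarrow> 0" by simp_all
  have "(\<lambda>N. 3 * \<bar>r N - 1\<bar> + d N + d' N) \<longlonglongrightarrow> 3 * \<bar>1 - 1\<bar> + 0 + 0"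
    unfolding r_def by (intro tendsto_intros matching_number_ratio dd)
  then have "\<forall>\<^sub>F N in sequentially. 3 * \<bar>r N - 1\<bar> + d N + d' N < \<epsilon>" using assms by (intro order_tendstoD(2)) auto
  moreover have "\<forall>\<^sub>F N in sequentially. d N < 1" "\<forall>\<^sub>F N in sequentially. d' N < 1"
    using dd by (auto intro: order_tendstoD(2))
  ultimately show ?thesis
    unfolding eventually_odd_numbers using eventually_ge_at_top[of "e + 1"]
  proof eventually_elim
    case (elim N)
    show ?case
    proof (intro impI allI)
      fix S :: "'a set" and s D m
      assume N: "odd N" and fin: "finite S" and s: "s permutes S" and s3: "\<forall>x\<in>S. s x \<noteq> x \<and> s (s (s x)) = x"
        and cS: "card S = 6 * N" and D: "D \<subseteq> S" and m: "m \<in> fpf_invol D" and cD: "card D = 2 * e"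
      define n where "n = card (S - D)"
      have n: "n = 6 * N - 2 * e" using card_Diff_subset[OF finite_subset[OF D fin] D] cS cD by (simp add: n_def)
      have n0: "0 < n" using n elim by simp
      have pos: "matching_number n > 0" "matching_number (6 * N) > 0" using n elim by (auto intro!: matching_number_pos)
      define x y where "x = real n * real (card (completions S s D m)) / matching_number n"
        and "y = real (6 * N) * real (card (completions S s {} id)) / matching_number (6 * N)"
      have "\<not> closes_face s {} id" "id \<in> fpf_invol {}" by (auto simp: closes_face_def fpf_invol_def)
      then have "\<bar>real (6 * N) * real (card (completions S s {} id)) - 2 * matching_number (6 * N)\<bar> \<le> d' N * matching_number (6 * N)"
        using card_completions_approx[OF fin s _ _ _ _ cS N, of "{}" id] s3 cS elim by (simp add: d'_def)
      moreover have "y - 2 = (real (6 * N) * real (card (completions S s {} id)) - 2 * matching_number (6 * N)) / matching_number (6 * N)"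
        using pos by (simp add: y_def diff_divide_distrib)
      ultimately have y: "\<bar>y - 2\<bar> \<le> d' N" using pos by (simp add: divide_le_eq)
      then have "y > 0" using elim by auto
      then have c0: "0 < card (completions S s {} id)" by (auto simp: y_def intro!: Nat.gr0I)
      show "0 < card (completions S s {} id) \<and>
        (if closes_face s D m then completions S s D m = {}
         else \<bar>real (card (completions S s D m)) / real (card (completions S s {} id)) * real (6 * N) ^ e - 1\<bar> < \<epsilon>)"
      proof (cases "closes_face s D m")
        case True
        have "D \<noteq> S" using cS cD elim by auto
        then show ?thesis using True c0 completions_empty[OF True, of S] D by auto
      next
        case False
        have "\<bar>real n * real (card (completions S s D m)) - 2 * matching_number n\<bar> \<le> d N * matching_number n"
          using card_completions_approx[OF fin s _ _ D m cS N _ False] s3 cD elim n by (simp add: d_def n_def)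
        moreover have "x - 2 = (real n * real (card (completions S s D m)) - 2 * matching_number n) / matching_number n"
          using pos by (simp add: x_def diff_divide_distrib)
        ultimately have x: "\<bar>x - 2\<bar> \<le> d N" using pos by (simp add: divide_le_eq)
        have "\<bar>r N * (x / y) - 1\<bar> \<le> 3 * \<bar>r N - 1\<bar> + d N + d' N" using ratio_bound[OF x y] elim by simp
        moreover have "r N * (x / y) = real (card (completions S s D m)) / real (card (completions S s {} id)) * real (6 * N) ^ e"
          unfolding r_def x_def y_def n[symmetric] using pos n0 c0 elim by (simp add: divide_simps)
        ultimately show ?thesis using False c0 elim by simp
      qed
    qed
  qed
qed

section \<open>One-vertex triangulations\<close>

definition matchings :: "nat set \<Rightarrow> nat set set set" where
  "matchings D = {M. partition_on D M \<and> (\<forall>e\<in>M. card e = 2)}"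

text \<open>Outside the support \<open>partner\<close> is an unspecified THE; filling in the
  identity yields a permutation of all naturals, as \<open>permutes\<close> demands.\<close>

definition pmap :: "nat set set \<Rightarrow> nat \<Rightarrow> nat" where
  "pmap M i = (if i \<in> \<Union>M then partner M i else i)"

lemma gluings_eq: "gluings N = matchings {1..6 * N}"
  by (simp add: gluings_def matchings_def)

lemma matchings_Union: "M \<in> matchings D \<Longrightarrow> \<Union>M = D"
  by (auto simp: matchings_def partition_on_def)

lemma matchings_eq_pair:
  assumes "M \<in> matchings D" "e \<in> M" "i \<in> e"
  obtains j where "j \<noteq> i" "e = {i, j}"
proof -
  have "card e = 2" using assms by (auto simp: matchings_def)
  then obtain a b where "e = {a, b}" "a \<noteq> b" by (auto simp: card_2_iff)
  then show ?thesis using assms that[of b] that[of a] by auto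
qed

lemma matchings_same_edge:
  assumes "M \<in> matchings D" "e \<in> M" "e' \<in> M" "i \<in> e" "i \<in> e'"
  shows "e = e'"
  using assms disjointD[of M e e'] by (auto simp: matchings_def partition_on_def)

lemma partner_eqI:
  assumes "M \<in> matchings D" "{i, j} \<in> M" "i \<noteq> j"
  shows "partner M i = j"
  unfolding partner_def
proof (rule the_equality)
  fix k assume "k \<noteq> i \<and> {i, k} \<in> M"
  then have "{i, k} = {i, j}" using matchings_same_edge[OF assms(1) _ assms(2), of "{i, k}" i] by simp
  then show "k = j" using assms(3) by (auto simp: doubleton_eq_iff)
qed (use assms in auto)

lemma pmap_edge:
  assumes "M \<in> matchings D" "i \<in> D"
  shows "{i, pmap M i} \<in> M" "pmap M i \<noteq> i"
proof -
  have "i \<in> \<Union>M" using assms matchings_Union by blast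
  then obtain e where e: "e \<in> M" "i \<in> e" by blast
  then obtain j where j: "j \<noteq> i" "e = {i, j}" using matchings_eq_pair[OF assms(1)] by blast
  then have "pmap M i = j" using e \<open>i \<in> \<Union>M\<close> partner_eqI[OF assms(1), of i j] by (auto simp: pmap_def)
  then show "{i, pmap M i} \<in> M" "pmap M i \<noteq> i" using e j by auto
qed

lemma pmap_eqI:
  assumes "M \<in> matchings D" "{i, j} \<in> M"
  shows "pmap M i = j" "i \<noteq> j"
proof -
  show "i \<noteq> j" using assms by (auto simp: matchings_def)
  then show "pmap M i = j" using partner_eqI[OF assms] assms(2) by (auto simp: pmap_def)
qed

lemma pmap_fpf_invol:
  assumes "M \<in> matchings D"
  shows "pmap M \<in> fpf_invol D"
proof (rule fpf_involI)
  fix i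
  show out: "i \<notin> D \<Longrightarrow> pmap M i = i" using matchings_Union[OF assms] by (auto simp: pmap_def)
  show "i \<in> D \<Longrightarrow> pmap M i \<noteq> i" using pmap_edge[OF assms] by blast
  show "pmap M (pmap M i) = i"
  proof (cases "i \<in> D")
    case True
    then have "{pmap M i, i} \<in> M" using pmap_edge[OF assms] by (simp add: insert_commute)
    then show ?thesis using pmap_eqI[OF assms] by blast
  qed (use out in auto)
qed

lemma bij_betw_pmap: "bij_betw pmap (matchings D) (fpf_invol D)"
proof (rule bij_betwI[where g = "\<lambda>t. (\<lambda>i. {i, t i}) ` D"])
  show "pmap \<in> matchings D \<rightarrow> fpf_invol D" using pmap_fpf_invol by blast
  have bk: "(\<lambda>i. {i, t i}) ` D \<in> matchings D" if "t \<in> fpf_invol D" for t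
  proof -
    note t = fpf_involD[OF that]
    have eq: "{i, t i} = {j, t j}" if "x \<in> {i, t i}" "x \<in> {j, t j}" for i j x
      using that t(3) by (metis insert_commute insertE singletonD)
    show ?thesis unfolding matchings_def partition_on_def disjoint_def
    proof (intro CollectI conjI ballI impI)
      show "\<Union>((\<lambda>i. {i, t i}) ` D) = D" using t(5) by auto
      show "{} \<notin> (\<lambda>i. {i, t i}) ` D" by auto
      fix a b assume "a \<in> (\<lambda>i. {i, t i}) ` D" "b \<in> (\<lambda>i. {i, t i}) ` D" "a \<noteq> b"
      then show "a \<inter> b = {}" using eq by blast
    next
      fix e assume "e \<in> (\<lambda>i. {i, t i}) ` D"
      then obtain i where "i \<in> D" "e = {i, t i}" by blast
      then show "card e = 2" using t(4)[of i] by simp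
    qed
  qed
  from bk show "(\<lambda>t. (\<lambda>i. {i, t i}) ` D) \<in> fpf_invol D \<rightarrow> matchings D" by blast
  fix M assume M: "M \<in> matchings D"
  show "(\<lambda>i. {i, pmap M i}) ` D = M"
  proof
    show "(\<lambda>i. {i, pmap M i}) ` D \<subseteq> M" using pmap_edge[OF M] by blast
    show "M \<subseteq> (\<lambda>i. {i, pmap M i}) ` D"
    proof
      fix e assume e: "e \<in> M"
      then have "e \<noteq> {}" using M by (auto simp: matchings_def partition_on_def)
      then obtain i where i: "i \<in> e" by blast
      then obtain j where "e = {i, j}" using matchings_eq_pair[OF M e] by blast
      moreover from this have "pmap M i = j" using pmap_eqI[OF M] e by blast
      moreover have "i \<in> D" using e i matchings_Union[OF M] by blast
      ultimately show "e \<in> (\<lambda>i. {i, pmap M i}) ` D" by blast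
    qed
  qed
next
  fix t assume t: "t \<in> fpf_invol D"
  let ?M = "(\<lambda>i. {i, t i}) ` D"
  have un: "\<Union>?M = D" using fpf_involD(5)[OF t] by auto
  have nf: "t i \<noteq> i" if "i \<in> D" for i using fpf_involD(4)[OF t that] .
  have "partner ?M i = t i" if "i \<in> D" for i
    unfolding partner_def
  proof (rule the_equality)
    show "t i \<noteq> i \<and> {i, t i} \<in> ?M" using nf[OF that] that by blast
    fix j assume j: "j \<noteq> i \<and> {i, j} \<in> ?M"
    then obtain k where k: "k \<in> D" "{i, j} = {k, t k}" by blast
    then show "j = t i" using j fpf_involD(3)[OF t, of k] by (auto simp: doubleton_eq_iff)
  qed
  then show "pmap ?M = t" using fpf_involD(6)[OF t] by (auto simp: pmap_def un fun_eq_iff)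
qed

lemma matchings_subset_iff:
  assumes M: "M \<in> matchings D" and w: "w \<in> matchings S"  and "D \<subseteq> S"
  shows "M \<subseteq> w \<longleftrightarrow> (\<forall>i\<in>D. pmap w i = pmap M i)"
proof
  assume "M \<subseteq> w"
  then show "\<forall>i\<in>D. pmap w i = pmap M i" using pmap_edge[OF M] pmap_eqI[OF w] by blast
next
  assume eq: "\<forall>i\<in>D. pmap w i = pmap M i"
  show "M \<subseteq> w"
  proof
    fix e assume e: "e \<in> M"
    then have "e \<noteq> {}" using M by (auto simp: matchings_def partition_on_def)
    then obtain i where i: "i \<in> e" by blast
    then obtain j where j: "e = {i, j}" using matchings_eq_pair[OF M e] by blast
    then have "pmap M i = j" using pmap_eqI[OF M] e by blast
    moreover have "i \<in> D" using e i matchings_Union[OF M] by blast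
    ultimately have "{i, pmap w i} = e" using eq j by auto
    then show "e \<in> w" using pmap_edge[OF w, of i] \<open>i \<in> D\<close> assms(3) by auto
  qed
qed

text \<open>\<open>next_side\<close> also moves numbers beyond 6N; cutting it off makes it a
  permutation in the sense of \<open>permutes\<close>.\<close>

definition side :: "nat \<Rightarrow> nat \<Rightarrow> nat" where
  "side N i = (if i \<in> {1..6 * N} then next_side i else i)"

lemma next_side_mod:
  "next_side (3 * a + 1) = 3 * a + 2" "next_side (3 * a + 2) = 3 * a + 3" "next_side (3 * a + 3) = 3 * a + 1"
  "triangle_of (3 * a + 1) = a + 1" "triangle_of (3 * a + 2) = a + 1" "triangle_of (3 * a + 3) = a + 1"
proof -
  have "\<not> 3 dvd 3 * a + 1" "\<not> 3 dvd 3 * a + 2" by presburger+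
  then show "next_side (3 * a + 1) = 3 * a + 2" "next_side (3 * a + 2) = 3 * a + 3" "next_side (3 * a + 3) = 3 * a + 1"
    by (auto simp: next_side_def)
qed (auto simp: triangle_of_def)

lemma side_cases:
  assumes "1 \<le> (i :: nat)"
  obtains a where "i = 3 * a + 1" | a where "i = 3 * a + 2" | a where "i = 3 * a + 3"
proof -
  have "\<exists>a. i = 3 * a + 1 \<or> i = 3 * a + 2 \<or> i = 3 * a + 3" using assms by presburger
  then show ?thesis using that by blast
qed

lemma next_side_props:
  assumes "1 \<le> i"
  shows "next_side (next_side (next_side i)) = i" "next_side i \<noteq> i" "1 \<le> next_side i"
    "triangle_of (next_side i) = triangle_of i" "next_side (next_side i) \<noteq> i"
proof -
  have "next_side (next_side (next_side i)) = i \<and> next_side i \<noteq> i \<and> 1 \<le> next_side i \<and>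
    triangle_of (next_side i) = triangle_of i \<and> next_side (next_side i) \<noteq> i"
    using assms by (cases i rule: side_cases) (simp_all only: next_side_mod, simp_all)
  then show "next_side (next_side (next_side i)) = i" "next_side i \<noteq> i" "1 \<le> next_side i"
    "triangle_of (next_side i) = triangle_of i" "next_side (next_side i) \<noteq> i" by auto
qed

lemma next_side_le:
  assumes "i \<in> {1..6 * N}"
  shows "next_side i \<in> {1..6 * N}"
proof -
  have "1 \<le> i" "i \<le> 6 * N" using assms by auto
  then show ?thesis by (cases i rule: side_cases) (simp_all only: next_side_mod atLeastAtMost_iff, presburger+)
qed

lemma triangle_of_eq_iff:
  assumes "1 \<le> i" "1 \<le> j"
  shows "triangle_of i = triangle_of j \<longleftrightarrow> j = i \<or> j = next_side i \<or> j = next_side (next_side i)"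
  using assms(1)
proof (cases i rule: side_cases)
  case i: (1 a)
  show ?thesis using assms(2) by (cases j rule: side_cases) (simp_all only: i next_side_mod, presburger+)
next
  case i: (2 a)
  show ?thesis using assms(2) by (cases j rule: side_cases) (simp_all only: i next_side_mod, presburger+)
next
  case i: (3 a)
  show ?thesis using assms(2) by (cases j rule: side_cases) (simp_all only: i next_side_mod, presburger+)
qed

lemma side_props:
  assumes "i \<in> {1..6 * N}"
  shows "side N i \<in> {1..6 * N}" "side N i \<noteq> i" "side N (side N (side N i)) = i" "side N i = next_side i"
  using next_side_le[of i N] next_side_le[of "next_side i" N] next_side_props[of i] assms by (auto simp: side_def)

lemma side_permutes: "side N permutes {1..6 * N}"
proof -
  have "bij_betw (side N) {1..6 * N} {1..6 * N}"
  proof (rule bij_betwI[where g = "\<lambda>i. side N (side N i)"])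
    show "side N \<in> {1..6 * N} \<rightarrow> {1..6 * N}" "(\<lambda>i. side N (side N i)) \<in> {1..6 * N} \<rightarrow> {1..6 * N}"
      using side_props(1) by blast+
  qed (use side_props(3) in blast)+
  then show ?thesis by (auto simp: permutes_altdef side_def)
qed

text \<open>Orbits are invariant, and an invariant set contains the orbit of each of its points. So
  having one orbit means having no proper nonempty invariant subset.\<close>

lemma card_orbits_eq_1_iff:
  assumes fin: "finite S" and p: "p permutes S" and ne: "S \<noteq> {}"
  shows "card (orbit p ` S) = 1 \<longleftrightarrow> single_cycle S p"
proof -
  have perm: "permutation p" using permutes_imp_permutation[OF fin p] .
  note self = permutation_self_in_orbit[OF perm]
  have sub: "orbit p x \<subseteq> S" if "x \<in> S" for x using permutes_orbit_subset[OF p that] .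
  have inv: "p ` orbit p x = orbit p x" if "x \<in> S" for x
    using finite_subset[OF sub[OF that] fin] permutes_inj[OF p]
    by (intro image_eq_of_subset) (auto intro: orbit.step)
  have small: "orbit p x \<subseteq> X" if "p ` X = X" "x \<in> X" for x X
  proof
    fix y assume "y \<in> orbit p x"
    then show "y \<in> X"
    proof induction
      case base then show ?case using that by blast
    next
      case (step y) then show ?case using that by blast
    qed
  qed
  show ?thesis
  proof
    assume "single_cycle S p"
    then have "orbit p x = S" if "x \<in> S" for x
      using single_cycleD[OF _ sub[OF that] inv[OF that]] orbit_nonempty[of p x] by auto
    then have "orbit p ` S = {S}" using ne by auto
    then show "card (orbit p ` S) = 1" by simp
  next
    assume "card (orbit p ` S) = 1"
    then obtain O' where O': "orbit p ` S = {O'}" by (auto simp: card_1_singleton_iff)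
    then have eq: "orbit p x = O'" if "x \<in> S" for x using that by blast
    have OS: "S \<subseteq> O'" using eq self by blast
    show "single_cycle S p" unfolding single_cycle_def
    proof (intro allI impI)
      fix X assume X: "X \<subseteq> S" "p ` X = X"
      show "X = {} \<or> X = S"
      proof (cases "X = {}")
        case False
        then obtain x where "x \<in> X" by blast
        then have "O' \<subseteq> X" using small[OF X(2)] eq X by blast
        then show ?thesis using OS X by blast
      qed simp
    qed
  qed
qed

text \<open>Maximal genus means a single left hand turn cycle. The two forms of the permutation
  agree on the sides and keep them in range, so their orbits there coincide.\<close>

lemma max_genus_gluings_iff:
  assumes "N \<ge> 1"
  shows "w \<in> max_genus_gluings N \<longleftrightarrow> w \<in> matchings {1..6 * N} \<and> single_cycle {1..6 * N} (side N \<circ> pmap w)"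
proof -
  have "LHT N w = 1 \<longleftrightarrow> single_cycle {1..6 * N} (side N \<circ> pmap w)" if w: "w \<in> matchings {1..6 * N}"
  proof -
    note pm = fpf_involD[OF pmap_fpf_invol[OF w]]
    have "orbit (next_side \<circ> partner w) x = orbit (side N \<circ> pmap w) x" if "x \<in> {1..6 * N}" for x
    proof (rule orbit_cong0[OF that])
      have eq: "(next_side \<circ> partner w) y = (side N \<circ> pmap w) y" if "y \<in> {1..6 * N}" for y
      proof -
        have "pmap w y = partner w y" using that matchings_Union[OF w] by (simp add: pmap_def)
        moreover have "pmap w y \<in> {1..6 * N}" using pm(5) that by simp
        ultimately show ?thesis by (simp add: side_def)
      qed
      then show "(next_side \<circ> partner w) y = (side N \<circ> pmap w) y" if "y \<in> {1..6 * N}" for y using that .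
      show "next_side \<circ> partner w \<in> {1..6 * N} \<rightarrow> {1..6 * N}"
      proof
        fix y assume y: "y \<in> {1..6 * N}"
        then have "side N (pmap w y) \<in> {1..6 * N}" using side_props(1) pm(5) by blast
        then show "(next_side \<circ> partner w) y \<in> {1..6 * N}" using eq[OF y] by simp
      qed
    qed
    then have "orbit (next_side \<circ> partner w) ` {1..6 * N} = orbit (side N \<circ> pmap w) ` {1..6 * N}"
      by (intro image_cong) auto
    moreover have "card (orbit (side N \<circ> pmap w) ` {1..6 * N}) = 1 \<longleftrightarrow> single_cycle {1..6 * N} (side N \<circ> pmap w)"
      using assms by (intro card_orbits_eq_1_iff permutes_compose[OF pm(1) side_permutes]) auto
    ultimately show ?thesis by (simp add: LHT_def)
  qed
  moreover have "genus N w = (real N + 1) / 2 \<longleftrightarrow> LHT N w = 1" by (auto simp: genus_def field_simps)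
  ultimately show ?thesis by (auto simp: max_genus_gluings_def gluings_eq)
qed

lemma card_max_genus_gluings_containing:
  assumes N: "N \<ge> 1" and M: "M \<in> matchings D" and D: "D \<subseteq> {1..6 * N}"
  shows "card {w \<in> max_genus_gluings N. M \<subseteq> w} = card (completions {1..6 * N} (side N) D (pmap M))"
proof -
  have "bij_betw pmap {w \<in> max_genus_gluings N. M \<subseteq> w} (completions {1..6 * N} (side N) D (pmap M))"
  proof (rule bij_betw_subset[OF bij_betw_pmap[of "{1..6 * N}"]])
    define P where "P t \<longleftrightarrow> (\<forall>i\<in>D. t i = pmap M i) \<and> single_cycle {1..6 * N} (side N \<circ> t)" for t
    have gen: "f ` {w \<in> A. Q (f w)} = {t \<in> f ` A. Q t}" for f :: "nat set set \<Rightarrow> nat \<Rightarrow> nat" and A Q by blast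
    have eq: "{w \<in> max_genus_gluings N. M \<subseteq> w} = {w \<in> matchings {1..6 * N}. P (pmap w)}"
    proof (intro Collect_cong iffI)
      fix w assume "w \<in> max_genus_gluings N \<and> M \<subseteq> w"
      then show "w \<in> matchings {1..6 * N} \<and> P (pmap w)"
        using max_genus_gluings_iff[OF N, of w] matchings_subset_iff[OF M _ D, of w] by (simp add: P_def)
    next
      fix w assume "w \<in> matchings {1..6 * N} \<and> P (pmap w)"
      then show "w \<in> max_genus_gluings N \<and> M \<subseteq> w"
        using max_genus_gluings_iff[OF N, of w] matchings_subset_iff[OF M _ D, of w] by (simp add: P_def)
    qed
    show "pmap ` {w \<in> max_genus_gluings N. M \<subseteq> w} = completions {1..6 * N} (side N) D (pmap M)"
      unfolding eq gen bij_betw_imp_surj_on[OF bij_betw_pmap, of "{1..6 * N}"]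
      by (simp only: completions_def P_def)
    show "{w \<in> max_genus_gluings N. M \<subseteq> w} \<subseteq> matchings {1..6 * N}" unfolding eq by blast
  qed
  then show ?thesis by (rule bij_betw_same_card)
qed

definition contain_prob :: "nat \<Rightarrow> nat set set \<Rightarrow> real" where
  "contain_prob N M = real (card {w \<in> max_genus_gluings N. M \<subseteq> w}) / real (card (max_genus_gluings N))"

text \<open>The case of no prescribed pairs shows that one-vertex gluings exist for all large odd N,
  so that \<open>contain_prob\<close> is a genuine conditional probability.\<close>

lemma contain_prob_asymptotics:
  assumes "\<epsilon> > 0"
  shows "\<forall>\<^sub>F N in odd_numbers. 0 < card (max_genus_gluings N) \<and>
    (\<forall>D M. M \<in> matchings D \<longrightarrow> D \<subseteq> {1..6 * N} \<longrightarrow> card D = 2 * e \<longrightarrow>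
      (if closes_face (side N) D (pmap M) then contain_prob N M = 0
       else \<bar>contain_prob N M * real (6 * N) ^ e - 1\<bar> < \<epsilon>))"
proof -
  have "\<forall>\<^sub>F N in odd_numbers. N \<ge> 1"
    unfolding eventually_odd_numbers by (rule eventually_mono[OF eventually_ge_at_top[of 1]]) simp
  then show ?thesis
    using completions_ratio[OF assms, where e = 0, where 'a = nat] completions_ratio[OF assms, of e, where 'a = nat]
  proof eventually_elim
    case (elim N)
    note N = elim(1)
    have sp: "\<forall>x\<in>{1..6 * N}. side N x \<noteq> x \<and> side N (side N (side N x)) = x" using side_props by blast
    have emp: "{} \<in> matchings {}" "pmap {} = id" by (auto simp: matchings_def pmap_def partition_on_def)
    have c: "card (max_genus_gluings N) = card (completions {1..6 * N} (side N) {} id)"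
      using card_max_genus_gluings_containing[OF N emp(1)] emp(2) by simp
    have "id \<in> fpf_invol ({} :: nat set)" by (simp add: fpf_invol_def)
    then have "0 < card (completions {1..6 * N} (side N) {} id)"
      using elim(2)[rule_format, of "{1..6 * N}" "side N" "{}" id] side_permutes sp by simp
    moreover have "if closes_face (side N) D (pmap M) then contain_prob N M = 0
       else \<bar>contain_prob N M * real (6 * N) ^ e - 1\<bar> < \<epsilon>"
      if M: "M \<in> matchings D" and D: "D \<subseteq> {1..6 * N}" "card D = 2 * e" for D M
    proof -
      have "if closes_face (side N) D (pmap M) then completions {1..6 * N} (side N) D (pmap M) = {}
        else \<bar>real (card (completions {1..6 * N} (side N) D (pmap M))) / real (card (completions {1..6 * N} (side N) {} id)) * real (6 * N) ^ e - 1\<bar> < \<epsilon>"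
        by (rule elim(3)[THEN spec, THEN spec, THEN spec, THEN spec, THEN mp, THEN mp, THEN mp, THEN mp, THEN mp, THEN mp, THEN mp, THEN conjunct2])
          (use side_permutes sp D pmap_fpf_invol[OF M] in auto)
      then show ?thesis
        unfolding contain_prob_def c card_max_genus_gluings_containing[OF N M D(1)] by (simp split: if_splits)
    qed
    ultimately show ?case unfolding c by blast
  qed
qed

section \<open>Circuits and words\<close>

text \<open>Words and circuits carry the same structure: rotations and a reversal that applies an
  involution f to each entry. It is \<open>swap_letter\<close> for letters and
  \<open>prod.swap\<close> for passages.\<close>

definition dihedral_class :: "('a \<Rightarrow> 'a) \<Rightarrow> 'a list \<Rightarrow> 'a list set" where
  "dihedral_class f w = {v. \<exists>k. v = rotate k w \<or> v = rotate k (rev (map f w))}"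

lemma word_class_dihedral: "word_class w = dihedral_class swap_letter w"
  by (simp add: word_class_def dihedral_class_def word_star_def)

lemma circuit_of_dihedral: "circuit_of p = dihedral_class prod.swap p"
  by (simp add: circuit_of_def dihedral_class_def reverse_path_def)

lemma rotate_back: "\<exists>k'. rotate k' (rotate k w) = w"
proof (cases "w = []")
  case False
  define r where "r = k mod length w"
  have r: "r \<le> length w" using False by (simp add: r_def less_imp_le)
  have "rotate (length w - r) (rotate k w) = rotate (length w - r) (rotate r w)"
    by (subst rotate_conv_mod) (simp add: r_def)
  also have "\<dots> = rotate (length w) w" using r by (simp add: rotate_rotate)
  finally show ?thesis by auto
qed simp

lemma rev_rotate: "\<exists>k'. rev (rotate k w) = rotate k' (rev w)"
proof (cases "k mod length w = 0")
  case True
  then have "rotate k w = w" by (rule rotate_id)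
  then show ?thesis by (auto intro: exI[of _ 0])
next
  case False
  define r where "r = k mod length w"
  have r: "0 < r" "r < length w \<or> w = []" using False by (auto simp: r_def)
  show ?thesis
  proof (cases "w = []")
    case ne: False
    have "rotate (length w - r) (rev w) = rev (rotate (length w - (length w - r) mod length w) w)" by (rule rotate_rev)
    also have "(length w - r) mod length w = length w - r" using r ne by simp
    also have "length w - (length w - r) = r" using r ne by simp
    also have "rotate r w = rotate k w" unfolding r_def by (rule rotate_conv_mod[symmetric])
    finally show ?thesis by metis
  qed simp
qed

lemma dihedral_class_self: "w \<in> dihedral_class f w"
  by (auto simp: dihedral_class_def intro: exI[of _ 0])

lemma dihedral_class_length: "v \<in> dihedral_class f w \<Longrightarrow> length v = length w"
  by (auto simp: dihedral_class_def)

lemma dihedral_class_subset: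
  assumes f: "\<And>x. f (f x) = x" and v: "v \<in> dihedral_class f w"
  shows "dihedral_class f v \<subseteq> dihedral_class f w"
proof
  fix u assume "u \<in> dihedral_class f v"
  then obtain l where l: "u = rotate l v \<or> u = rotate l (rev (map f v))" by (auto simp: dihedral_class_def)
  obtain k where k: "v = rotate k w \<or> v = rotate k (rev (map f w))" using v by (auto simp: dihedral_class_def)
  have ff: "map f (map f x) = x" for x using f by (simp add: comp_def)
  have rr: "\<exists>k'. rev (map f (rotate k x)) = rotate k' (rev (map f x))" for x
    using rev_rotate[of k "map f x"] by (simp add: rotate_map)
  from k show "u \<in> dihedral_class f w"
  proof
    assume "v = rotate k w"
    then show ?thesis using l rr[of w] by (auto simp: dihedral_class_def rotate_rotate)
  next
    assume v: "v = rotate k (rev (map f w))"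
    obtain k' where "rev (map f v) = rotate k' (rev (map f (rev (map f w))))" using rr[of "rev (map f w)"] v by blast
    also have "rev (map f (rev (map f w))) = w" using ff[of w] by (simp add: rev_map)
    finally show ?thesis using l v by (auto simp: dihedral_class_def rotate_rotate)
  qed
qed

lemma dihedral_class_sym:
  assumes f: "\<And>x. f (f x) = x" and v: "v \<in> dihedral_class f w"
  shows "w \<in> dihedral_class f v"
proof -
  obtain k where k: "v = rotate k w \<or> v = rotate k (rev (map f w))" using v by (auto simp: dihedral_class_def)
  then show ?thesis
  proof
    assume "v = rotate k w"
    then obtain k' where "w = rotate k' v" using rotate_back by metis
    then show ?thesis unfolding dihedral_class_def by blast
  next
    assume "v = rotate k (rev (map f w))"
    then obtain l where "rotate l v = rev (map f w)" using rotate_back by metis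
    moreover have "rotate l v \<in> dihedral_class f v" by (auto simp: dihedral_class_def)
    ultimately have "dihedral_class f (rev (map f w)) \<subseteq> dihedral_class f v" using dihedral_class_subset[OF f] by metis
    moreover have "rev (map f (rev (map f w))) = w" using f by (simp add: rev_map comp_def)
    then have "w \<in> dihedral_class f (rev (map f w))"
      unfolding dihedral_class_def by (intro CollectI exI[of _ 0]) simp
    ultimately show ?thesis by blast
  qed
qed

lemma dihedral_class_eq:
  assumes "\<And>x. f (f x) = x" "v \<in> dihedral_class f w"
  shows "dihedral_class f v = dihedral_class f w"
  using dihedral_class_subset[OF assms] dihedral_class_subset[OF assms(1) dihedral_class_sym[OF assms]] by blast

lemma swap_letter_swap [simp]: "swap_letter (swap_letter x) = x"
  by (cases x) auto

lemma word_class_eq: "v \<in> word_class w \<Longrightarrow> word_class v = word_class w"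
  unfolding word_class_dihedral by (rule dihedral_class_eq) simp_all

lemma circuit_of_eq: "q \<in> circuit_of p \<Longrightarrow> circuit_of q = circuit_of p"
  unfolding circuit_of_dihedral by (rule dihedral_class_eq) simp_all

lemma circuit_of_self: "p \<in> circuit_of p"
  by (simp add: circuit_of_dihedral dihedral_class_self)

lemma word_class_self: "w \<in> word_class w"
  by (simp add: word_class_dihedral dihedral_class_self)

section \<open>Circuits as lists of passages through triangles\<close>

definition tri :: "nat \<times> nat \<Rightarrow> nat" where
  "tri x = triangle_of (fst x)"

text \<open>These are the conditions of \<open>circuit_path\<close> that do not mention the gluing,
  so that paths can be counted before a gluing is given.\<close>

definition good_path :: "(nat \<times> nat) list \<Rightarrow> bool" where
  "good_path p \<longleftrightarrow> p \<noteq> [] \<and> (\<forall>x\<in>set p. fst x \<noteq> snd x \<and> triangle_of (fst x) = triangle_of (snd x)) \<and> distinct (map tri p)"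

lemma good_pathD:
  assumes "good_path p"
  shows "p \<noteq> []" "x \<in> set p \<Longrightarrow> fst x \<noteq> snd x" "x \<in> set p \<Longrightarrow> triangle_of (snd x) = tri x"
    "x \<in> set p \<Longrightarrow> y \<in> set p \<Longrightarrow> tri x = tri y \<Longrightarrow> x = y" "distinct p"
proof -
  show "p \<noteq> []" "x \<in> set p \<Longrightarrow> fst x \<noteq> snd x" "x \<in> set p \<Longrightarrow> triangle_of (snd x) = tri x"
    using assms by (auto simp: good_path_def tri_def)
  show "x \<in> set p \<Longrightarrow> y \<in> set p \<Longrightarrow> tri x = tri y \<Longrightarrow> x = y" "distinct p"
    using assms by (auto simp: good_path_def distinct_map dest: inj_onD)
qed

lemma set_path_edges:
  "set (path_edges p) = (\<lambda>k. {snd (p ! k), fst (p ! (Suc k mod length p))}) ` {..<length p}"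
  by (auto simp: path_edges_def)

lemma Union_path_edges: "\<Union>(set (path_edges p)) = fst ` set p \<union> snd ` set p"
proof
  show "\<Union>(set (path_edges p)) \<subseteq> fst ` set p \<union> snd ` set p"
  proof -
    have "p ! (Suc k mod length p) \<in> set p" if "k < length p" for k
      using that by (intro nth_mem mod_less_divisor) auto
    then show ?thesis by (auto simp: set_path_edges)
  qed
  show "fst ` set p \<union> snd ` set p \<subseteq> \<Union>(set (path_edges p))"
  proof
    fix i assume "i \<in> fst ` set p \<union> snd ` set p"
    then obtain k where k: "k < length p" "i = fst (p ! k) \<or> i = snd (p ! k)"
      by (auto simp: in_set_conv_nth)
    define k' where "k' = (if k = 0 then length p - 1 else k - 1)"
    have "k' < length p" "Suc k' mod length p = k" using k by (auto simp: k'_def)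
    then show "i \<in> \<Union>(set (path_edges p))" using k by (force simp: set_path_edges)
  qed
qed

text \<open>A half-edge determines its triangle and hence the passage. If two edges agreed with
  their ends exchanged, the exit of a passage would be the entrance of a passage through the same
  triangle, that is, its own entrance.\<close>

lemma distinct_path_edges:
  assumes "good_path p"
  shows "distinct (path_edges p)"
proof -
  note g = good_pathD[OF assms]
  define m where "m = length p"
  have m: "0 < m" using g by (simp add: m_def)
  have idx: "k = l" if "k < m" "l < m" "tri (p ! k) = tri (p ! l)" for k l
    using that g(4)[of "p ! k" "p ! l"] nth_eq_iff_index_eq[OF g(5)] by (simp add: m_def)
  have "inj_on (\<lambda>k. {snd (p ! k), fst (p ! (Suc k mod m))}) {..<m}"
  proof (rule inj_onI)
    fix k l assume k: "k \<in> {..<m}" and l: "l \<in> {..<m}"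
      and eq: "{snd (p ! k), fst (p ! (Suc k mod m))} = {snd (p ! l), fst (p ! (Suc l mod m))}"
    have km: "Suc k mod m < m" "Suc l mod m < m" using m by auto
    have set: "p ! k \<in> set p" "p ! l \<in> set p" "p ! (Suc l mod m) \<in> set p" using k l km by (auto simp: m_def)
    show "k = l"
    proof (cases "snd (p ! k) = snd (p ! l)")
      case True
      then have "tri (p ! k) = tri (p ! l)" using g(3) set by metis
      then show ?thesis using idx k l by simp
    next
      case False
      then have "snd (p ! k) = fst (p ! (Suc l mod m))" using eq by (auto simp: doubleton_eq_iff)
      then have "tri (p ! k) = tri (p ! (Suc l mod m))" using g(3)[OF set(1)] by (simp add: tri_def)
      then have "k = Suc l mod m" using idx k km by simp
      then have "snd (p ! k) = fst (p ! k)" using \<open>snd (p ! k) = fst (p ! (Suc l mod m))\<close> by simp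
      then show ?thesis using g(2)[OF set(1)] by simp
    qed
  qed
  then show ?thesis by (simp add: path_edges_def distinct_map m_def atLeast_upt lessThan_atLeast0 inj_on_def)
qed

lemma circuit_path_iff: "circuit_path w p \<longleftrightarrow> good_path p \<and> set (path_edges p) \<subseteq> w"
proof -
  have "(\<lambda>(i, j). triangle_of i) = tri" by (auto simp: tri_def)
  then have "circuit_path w p \<longleftrightarrow> good_path p \<and> set (path_edges p) \<subseteq> w \<and> distinct (path_edges p)"
    unfolding circuit_path_def good_path_def by (simp add: case_prod_unfold) blast
  then show ?thesis using distinct_path_edges by blast
qed

lemma path_edges_rotate_subset: "set (path_edges (rotate n p)) \<subseteq> set (path_edges p)"
proof
  fix e assume "e \<in> set (path_edges (rotate n p))"
  then obtain k where k: "k < length p" "e = {snd (rotate n p ! k), fst (rotate n p ! (Suc k mod length p))}"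
    by (auto simp: set_path_edges)
  define k' where "k' = (n + k) mod length p"
  have m: "0 < length p" using k by linarith
  then have "k' < length p" "(n + Suc k mod length p) mod length p = Suc k' mod length p"
    by (auto simp: k'_def mod_simps)
  moreover have "e = {snd (p ! k'), fst (p ! ((n + Suc k mod length p) mod length p))}"
    using k m by (simp add: nth_rotate k'_def)
  ultimately show "e \<in> set (path_edges p)" by (auto simp: set_path_edges)
qed

lemma path_edges_rotate: "set (path_edges (rotate n p)) = set (path_edges p)"
proof -
  obtain n' where "rotate n' (rotate n p) = p" using rotate_back by blast
  then show ?thesis using path_edges_rotate_subset[of n p] path_edges_rotate_subset[of n' "rotate n p"] by auto
qed

lemma path_edges_reverse_subset: "set (path_edges (reverse_path p)) \<subseteq> set (path_edges p)"
proof
  fix e assume "e \<in> set (path_edges (reverse_path p))"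
  then obtain k where k: "k < length p" "e = {snd (reverse_path p ! k), fst (reverse_path p ! (Suc k mod length p))}"
    by (auto simp: set_path_edges reverse_path_def)
  have nth: "reverse_path p ! l = prod.swap (p ! (length p - 1 - l))" if "l < length p" for l
    using that by (simp add: reverse_path_def rev_nth)
  define k' where "k' = (if Suc k = length p then k else length p - 2 - k)"
  have m: "0 < length p" using k by linarith
  have "e = {fst (p ! (length p - 1 - k)), snd (p ! (length p - 1 - Suc k mod length p))}"
    using k m by (simp add: nth)
  moreover have "k' < length p" "Suc k' mod length p = length p - 1 - k" "k' = length p - 1 - Suc k mod length p"
    using k by (auto simp: k'_def)
  ultimately have "e = {snd (p ! k'), fst (p ! (Suc k' mod length p))}" by (simp add: insert_commute)
  then show "e \<in> set (path_edges p)" using \<open>k' < length p\<close> by (auto simp: set_path_edges)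
qed

lemma reverse_path_reverse [simp]: "reverse_path (reverse_path p) = p"
  by (simp add: reverse_path_def rev_map)

lemma path_edges_reverse: "set (path_edges (reverse_path p)) = set (path_edges p)"
  using path_edges_reverse_subset[of p] path_edges_reverse_subset[of "reverse_path p"] by auto

lemma good_path_rotate: "good_path p \<Longrightarrow> good_path (rotate n p)"
  by (simp add: good_path_def flip: rotate_map)

lemma good_path_reverse:
  assumes "good_path p"
  shows "good_path (reverse_path p)"
proof -
  have "map tri (reverse_path p) = rev (map tri p)"
    using good_pathD(3)[OF assms] by (simp add: reverse_path_def rev_map tri_def)
  then show ?thesis using assms by (auto simp: good_path_def reverse_path_def)
qed

lemma circuit_path_circuit_of:
  assumes "circuit_path w p" "q \<in> circuit_of p"
  shows "circuit_path w q"
  using assms by (auto simp: circuit_of_def circuit_path_iff good_path_rotate good_path_reverse path_edges_rotate path_edges_reverse)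

text \<open>Rotations differ because the passages do. No rotation of the reversed path equals one of
  the path, since a passage and its swap lie in the same triangle and the path enters that triangle
  only once.\<close>

lemma card_circuit_of:
  assumes "good_path p"
  shows "card (circuit_of p) = 2 * length p"
proof -
  have rot: "card ((\<lambda>k. rotate k q) ` {..<length q}) = length q" if q: "good_path q" for q
  proof -
    have "inj_on (\<lambda>k. rotate k q) {..<length q}"
    proof (rule inj_onI)
      fix k l assume kl: "k \<in> {..<length q}" "l \<in> {..<length q}" "rotate k q = rotate l q"
      have "rotate i q ! 0 = q ! i" if "i < length q" for i
      proof -
        have "0 < length q" using that by linarith
        then show ?thesis using nth_rotate[of 0 q i] that by simp
      qed
      then have "q ! k = q ! l" using kl by (metis lessThan_iff)
      then show "k = l" using kl nth_eq_iff_index_eq[OF good_pathD(5)[OF q]] by simp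
    qed
    then show ?thesis by (simp add: card_image)
  qed
  have all: "(\<lambda>k. rotate k q) ` {..<length q} = range (\<lambda>k. rotate k q)" if "q \<noteq> []" for q :: "(nat \<times> nat) list"
  proof -
    have "rotate k q \<in> (\<lambda>k. rotate k q) ` {..<length q}" for k
      using that by (intro image_eqI[of _ _ "k mod length q"]) (auto simp: rotate_conv_mod[of k])
    then show ?thesis by blast
  qed
  have ne: "reverse_path p \<noteq> []" "length (reverse_path p) = length p" using good_pathD(1)[OF assms] by (auto simp: reverse_path_def)
  have "circuit_of p = range (\<lambda>k. rotate k p) \<union> range (\<lambda>k. rotate k (reverse_path p))"
    by (auto simp: circuit_of_def)
  moreover have "range (\<lambda>k. rotate k p) \<inter> range (\<lambda>k. rotate k (reverse_path p)) = {}"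
  proof (rule ccontr)
    assume "\<not> ?thesis"
    then obtain k l where "rotate k p = rotate l (reverse_path p)" by auto
    then have "set (rotate k p) = set (rotate l (reverse_path p))" by (rule arg_cong)
    then have "set p = prod.swap ` set p" by (simp add: reverse_path_def)
    moreover obtain x where x: "x \<in> set p" using good_pathD(1)[OF assms] by (cases p) auto
    ultimately have sx: "prod.swap x \<in> set p" by blast
    have "tri (prod.swap x) = tri x" using good_pathD(3)[OF assms x] by (simp add: tri_def)
    then have "prod.swap x = x" by (rule good_pathD(4)[OF assms sx x])
    then have "fst x = snd x" by (metis fst_swap)
    then show False using good_pathD(2)[OF assms x] by simp
  qed
  ultimately show ?thesis
    using rot[OF assms] rot[OF good_path_reverse[OF assms]] all[OF good_pathD(1)[OF assms]] all[OF ne(1)] ne(2)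
    by (metis card_Un_disjoint finite_imageI finite_lessThan mult_2)
qed

lemma circuit_path_in_range:
  assumes "w \<in> matchings S" "circuit_path w p"
  shows "fst ` set p \<union> snd ` set p \<subseteq> S"
proof -
  have "\<Union>(set (path_edges p)) \<subseteq> \<Union>w" using assms(2) by (auto simp: circuit_path_iff)
  then show ?thesis using matchings_Union[OF assms(1)] Union_path_edges[of p] by simp
qed

lemma turn_cases:
  assumes "1 \<le> fst x" "1 \<le> snd x" "fst x \<noteq> snd x" "triangle_of (fst x) = triangle_of (snd x)"
  shows "turn x = L \<and> snd x = next_side (fst x) \<or> turn x = R \<and> snd x = next_side (next_side (fst x))"
    "turn x = L \<Longrightarrow> fst x = next_side (next_side (snd x))" "turn x = R \<Longrightarrow> fst x = next_side (snd x)"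
proof -
  obtain i j where x: "x = (i, j)" by (cases x)
  have "j = next_side i \<or> j = next_side (next_side i)"
    using assms triangle_of_eq_iff[of i j] by (auto simp: x)
  moreover have "next_side (next_side i) \<noteq> next_side i" using next_side_props(2,3)[of i] next_side_props(2)[of "next_side i"] assms by (simp add: x)
  ultimately show "turn x = L \<and> snd x = next_side (fst x) \<or> turn x = R \<and> snd x = next_side (next_side (fst x))"
    by (auto simp: x)
  then show "turn x = L \<Longrightarrow> fst x = next_side (next_side (snd x))" "turn x = R \<Longrightarrow> fst x = next_side (snd x)"
    using next_side_props(1)[of i] assms by (auto simp: x split: if_splits)
qed

lemma turn_swap:
  assumes "1 \<le> fst x" "1 \<le> snd x" "fst x \<noteq> snd x" "triangle_of (fst x) = triangle_of (snd x)"
  shows "turn (prod.swap x) = swap_letter (turn x)"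
proof -
  have x: "1 \<le> fst (prod.swap x)" "1 \<le> snd (prod.swap x)" "fst (prod.swap x) \<noteq> snd (prod.swap x)"
    "triangle_of (fst (prod.swap x)) = triangle_of (snd (prod.swap x))" using assms by auto
  show ?thesis
    using turn_cases[OF assms] turn_cases(1)[OF x] next_side_props(2)[of "snd x"] next_side_props(2)[of "next_side (snd x)"]
      next_side_props(3)[of "snd x"] assms
    by (cases "turn x"; cases "turn (prod.swap x)") auto
qed

text \<open>Reversal exchanges entrance and exit at every vertex and hence left and right, which
  matches \<open>word_star\<close>.\<close>

lemma turn_circuit_of:
  assumes w: "w \<in> matchings {1..n}" and p: "circuit_path w p" and q: "q \<in> circuit_of p"
  shows "map turn q \<in> word_class (map turn p)"
proof -
  have "map turn (reverse_path p) = word_star (map turn p)"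
  proof -
    have "turn (prod.swap x) = swap_letter (turn x)" if "x \<in> set p" for x
    proof (rule turn_swap)
      show "1 \<le> fst x" "1 \<le> snd x" using circuit_path_in_range[OF w p] that by force+
      show "fst x \<noteq> snd x" "triangle_of (fst x) = triangle_of (snd x)" using p that by (auto simp: circuit_path_iff good_path_def)
    qed
    then show ?thesis by (simp add: reverse_path_def word_star_def rev_map)
  qed
  then show ?thesis using q by (auto simp: circuit_of_def word_class_def simp flip: rotate_map)
qed

section \<open>Word classes and the circuits that carry them\<close>

definition class_length :: "letter list set \<Rightarrow> nat" where
  "class_length A = the_elem (length ` A)"

lemma word_classesD:
  assumes "A \<in> word_classes" "v \<in> A"
  shows "word_class v = A" "length v = class_length A" "v \<noteq> []"
proof -
  obtain u where u: "A = word_class u" "u \<noteq> []" using assms by (auto simp: word_classes_def)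
  show A: "word_class v = A" using word_class_eq assms u by blast
  have len: "length x = length u" if "x \<in> A" for x using that u dihedral_class_length by (auto simp: word_class_dihedral)
  have "length ` A = {length u}" using len assms(2) by force
  then show "length v = class_length A" using len assms(2) by (simp add: class_length_def)
  then show "v \<noteq> []" using len[OF assms(2)] u by auto
qed

lemma word_classes_disjoint: "A \<in> word_classes \<Longrightarrow> B \<in> word_classes \<Longrightarrow> v \<in> A \<Longrightarrow> v \<in> B \<Longrightarrow> A = B"
  using word_classesD(1) by metis

lemma word_classes_nonempty: "A \<in> word_classes \<Longrightarrow> A \<noteq> {}"
  using word_class_self by (auto simp: word_classes_def)

lemma finite_word_class:
  assumes "A \<in> word_classes"
  shows "finite A"
proof (rule finite_subset)
  show "A \<subseteq> {v. set v \<subseteq> {L, R} \<and> length v = class_length A}" using word_classesD(2)[OF assms] letter.exhaust by blast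
  show "finite {v. set v \<subseteq> {L, R} \<and> length v = class_length A}" by (rule finite_lists_length_eq) simp
qed

definition carrying_paths :: "nat set set \<Rightarrow> letter list set \<Rightarrow> (nat \<times> nat) list set" where
  "carrying_paths w A = {p. circuit_path w p \<and> map turn p \<in> A}"

definition carrying_circuits :: "nat set set \<Rightarrow> letter list set \<Rightarrow> (nat \<times> nat) list set set" where
  "carrying_circuits w A = {C \<in> circuits w. carries C A}"

lemma carrying_circuits_eq:
  "carrying_circuits w A = circuit_of ` carrying_paths w A"
proof (intro set_eqI iffI)
  fix C assume "C \<in> carrying_circuits w A"
  then obtain p q where p: "circuit_path w p" "C = circuit_of p" and q: "q \<in> C" "map turn q \<in> A"
    by (auto simp: carrying_circuits_def circuits_def carries_def)
  then have "C = circuit_of q" "q \<in> carrying_paths w A"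
    using circuit_of_eq circuit_path_circuit_of by (auto simp: carrying_paths_def)
  then show "C \<in> circuit_of ` carrying_paths w A" by blast
next
  fix C assume "C \<in> circuit_of ` carrying_paths w A"
  then obtain p where "circuit_path w p" "map turn p \<in> A" "C = circuit_of p" by (auto simp: carrying_paths_def)
  then show "C \<in> carrying_circuits w A"
    using circuit_of_self by (auto simp: carrying_circuits_def circuits_def carries_def)
qed

text \<open>\<open>carries\<close> asks for one representative only; but all representatives of a
  circuit have their words in a single class.\<close>

lemma circuit_of_carrying_iff:
  assumes w: "w \<in> matchings {1..n}" and A: "A \<in> word_classes" and p: "circuit_path w p"
  shows "circuit_of p \<in> carrying_circuits w A \<longleftrightarrow> map turn p \<in> A"
proof
  assume "circuit_of p \<in> carrying_circuits w A"
  then obtain q where q: "circuit_path w q" "map turn q \<in> A" "circuit_of p = circuit_of q"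
    by (auto simp: carrying_circuits_eq carrying_paths_def)
  then have "p \<in> circuit_of q" using circuit_of_self by metis
  then have "map turn p \<in> word_class (map turn q)" using turn_circuit_of[OF w q(1)] by blast
  then show "map turn p \<in> A" using word_classesD(1)[OF A q(2)] by simp
qed (use p in \<open>auto simp: carrying_circuits_eq carrying_paths_def\<close>)

lemma finite_carrying_paths:
  assumes w: "w \<in> matchings {1..n}" and A: "A \<in> word_classes"
  shows "finite (carrying_paths w A)"
proof (rule finite_subset)
  show "carrying_paths w A \<subseteq> {p. set p \<subseteq> {1..n} \<times> {1..n} \<and> length p = class_length A}"
  proof
    fix p assume "p \<in> carrying_paths w A"
    then have p: "circuit_path w p" "map turn p \<in> A" by (auto simp: carrying_paths_def)
    have "length p = class_length A" using word_classesD(2)[OF A p(2)] by simp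
    moreover have "set p \<subseteq> {1..n} \<times> {1..n}" using circuit_path_in_range[OF w p(1)] by force
    ultimately show "p \<in> {p. set p \<subseteq> {1..n} \<times> {1..n} \<and> length p = class_length A}" by blast
  qed
qed (simp add: finite_lists_length_eq)

text \<open>A circuit of length l consists of 2 l paths with base point and direction, and different
  circuits share none. K stands for the circuits already used in a tuple.\<close>

lemma card_carrying_paths_avoiding:
  assumes w: "w \<in> matchings {1..n}" and A: "A \<in> word_classes"
  shows "card {p \<in> carrying_paths w A. circuit_of p \<notin> K} = 2 * class_length A * card (carrying_circuits w A - K)"
proof -
  have fin: "finite (carrying_circuits w A)" using finite_carrying_paths[OF assms] by (simp add: carrying_circuits_eq)
  have C: "circuit_of p = C" "p \<in> carrying_paths w A" if "C \<in> carrying_circuits w A" "p \<in> C" for C p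
  proof -
    obtain q where q: "circuit_path w q" "C = circuit_of q" using \<open>C \<in> carrying_circuits w A\<close> by (auto simp: carrying_circuits_eq carrying_paths_def)
    then show "circuit_of p = C" using circuit_of_eq that by blast
    then show "p \<in> carrying_paths w A"
      using circuit_of_carrying_iff[OF assms, of p] circuit_path_circuit_of[OF q(1), of p] that q by (auto simp: carrying_paths_def)
  qed
  have "{p \<in> carrying_paths w A. circuit_of p \<notin> K} = \<Union>(carrying_circuits w A - K)"
  proof (intro set_eqI iffI)
    fix p assume "p \<in> {p \<in> carrying_paths w A. circuit_of p \<notin> K}"
    then have "circuit_of p \<in> carrying_circuits w A - K" by (simp add: carrying_circuits_eq)
    then show "p \<in> \<Union>(carrying_circuits w A - K)" using circuit_of_self by blast
  next
    fix p assume "p \<in> \<Union>(carrying_circuits w A - K)"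
    then obtain D where "D \<in> carrying_circuits w A" "D \<notin> K" "p \<in> D" by blast
    then show "p \<in> {p \<in> carrying_paths w A. circuit_of p \<notin> K}" using C by simp
  qed
  also have "card \<dots> = (\<Sum>C\<in>carrying_circuits w A - K. card C)"
  proof (rule card_Union_disjoint)
    show "pairwise disjnt (carrying_circuits w A - K)"
    proof (rule pairwiseI)
      fix D E assume DE: "D \<in> carrying_circuits w A - K" "E \<in> carrying_circuits w A - K" "D \<noteq> E"
      have False if "p \<in> D" "p \<in> E" for p using C(1)[of D p] C(1)[of E p] that DE by simp
      then show "disjnt D E" unfolding disjnt_iff by blast
    qed
    fix C assume "C \<in> carrying_circuits w A - K"
    then show "finite C" using C(2) finite_carrying_paths[OF assms] finite_subset[of C] by blast
  qed
  also have "\<dots> = (\<Sum>C\<in>carrying_circuits w A - K. 2 * class_length A)"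
  proof (rule sum.cong[OF refl])
    fix C assume "C \<in> carrying_circuits w A - K"
    then obtain q where q: "circuit_path w q" "map turn q \<in> A" "C = circuit_of q"
      by (auto simp: carrying_circuits_eq carrying_paths_def)
    have "length q = class_length A" using word_classesD(2)[OF A q(2)] by simp
    then show "card C = 2 * class_length A" using card_circuit_of[of q] q by (simp add: circuit_path_iff)
  qed
  finally show ?thesis by simp
qed

text \<open>Ordered tuples of pairwise different circuits, with base points and directions. Their
  number is a product of falling factorials of the \<open>Z A\<close>, up to powers of 2
  \<open>class_length A\<close>, which makes it a joint factorial moment.\<close>

definition carrying_tuples :: "letter list set list \<Rightarrow> nat set set \<Rightarrow> (nat \<times> nat) list list set" where
  "carrying_tuples As w = {ps. list_all2 (\<lambda>p A. p \<in> carrying_paths w A) ps As \<and> distinct (map circuit_of ps)}"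

lemma card_circuits_in_tuple:
  assumes w: "w \<in> matchings {1..n}" and A: "A \<in> word_classes" and "set As \<subseteq> word_classes" "ps \<in> carrying_tuples As w"
  shows "card (carrying_circuits w A \<inter> circuit_of ` set ps) = count_list As A"
proof -
  have "list_all2 (\<lambda>p A. p \<in> carrying_paths w A) ps As" using assms by (auto simp: carrying_tuples_def)
  moreover have "distinct (map circuit_of ps)" using assms by (auto simp: carrying_tuples_def)
  ultimately show ?thesis using assms(3)
  proof (induction rule: list_all2_induct)
    case (Cons p ps B As)
    then have p: "circuit_path w p" "map turn p \<in> B" by (auto simp: carrying_paths_def)
    have B: "circuit_of p \<in> carrying_circuits w A \<longleftrightarrow> A = B"
      using circuit_of_carrying_iff[OF w A p(1)] p(2) word_classes_disjoint[OF A, of B] Cons.prems by auto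
    have IH: "card (carrying_circuits w A \<inter> circuit_of ` set ps) = count_list As A" using Cons by auto
    have "circuit_of p \<notin> circuit_of ` set ps" using Cons.prems by auto
    then show ?case using B IH by (cases "A = B") (auto simp: Int_insert_right)
  qed simp
qed

lemma finite_carrying_tuples:
  assumes w: "w \<in> matchings {1..n}"
  shows "set As \<subseteq> word_classes \<Longrightarrow> finite (carrying_tuples As w)"
proof (induction As)
  case Nil
  then show ?case by (simp add: carrying_tuples_def)
next
  case (Cons A As)
  have "carrying_tuples (A # As) w \<subseteq> (\<lambda>(p, ps). p # ps) ` (carrying_paths w A \<times> carrying_tuples As w)"
    by (force simp: carrying_tuples_def list_all2_Cons2)
  then show ?case using Cons finite_carrying_paths[OF w, of A] finite_subset by fastforce
qed

text \<open>Whatever tuple is given, exactly \<open>count_list As A\<close> of the circuits carrying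
  A are taken, and each remaining one offers 2 \<open>class_length A\<close> paths.\<close>

lemma card_carrying_tuples_Cons:
  assumes w: "w \<in> matchings {1..n}" and A: "A \<in> word_classes" and As: "set As \<subseteq> word_classes"
  shows "real (card (carrying_tuples (A # As) w))
    = 2 * real (class_length A) * (real (Z A w) - real (count_list As A)) * real (card (carrying_tuples As w))"
proof -
  define ext where "ext ps = (\<lambda>p. p # ps) ` {p \<in> carrying_paths w A. circuit_of p \<notin> circuit_of ` set ps}" for ps
  have fin: "finite (carrying_circuits w A)" using finite_carrying_paths[OF w A] by (simp add: carrying_circuits_eq)
  have "carrying_tuples (A # As) w = (\<Union>ps\<in>carrying_tuples As w. ext ps)"
    by (auto simp: carrying_tuples_def list_all2_Cons2 ext_def)
  also have "card \<dots> = (\<Sum>ps\<in>carrying_tuples As w. card (ext ps))"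
    using finite_carrying_tuples[OF w As] finite_carrying_paths[OF w A]
    by (intro card_UN_disjoint) (auto simp: ext_def)
  also have "real \<dots> = (\<Sum>ps\<in>carrying_tuples As w. 2 * real (class_length A) * (real (Z A w) - real (count_list As A)))"
    unfolding of_nat_sum
  proof (rule sum.cong[OF refl])
    fix ps assume ps: "ps \<in> carrying_tuples As w"
    have "card (ext ps) = card {p \<in> carrying_paths w A. circuit_of p \<notin> circuit_of ` set ps}"
      unfolding ext_def by (rule card_image) (simp add: inj_on_def)
    also have "\<dots> = 2 * class_length A * card (carrying_circuits w A - circuit_of ` set ps)"
      by (rule card_carrying_paths_avoiding[OF w A])
    finally have "card (ext ps) = 2 * class_length A * card (carrying_circuits w A - circuit_of ` set ps)" .
    moreover have "card (carrying_circuits w A) = card (carrying_circuits w A - circuit_of ` set ps) + card (carrying_circuits w A \<inter> circuit_of ` set ps)"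
      using fin by (metis Int_Diff_disjoint Int_Diff_Un card_Un_disjoint finite_Diff finite_Int add.commute)
    then have "real (card (carrying_circuits w A - circuit_of ` set ps)) = real (Z A w) - real (count_list As A)"
      using card_circuits_in_tuple[OF w A As ps] by (simp add: Z_def carrying_circuits_def)
    ultimately show "real (card (ext ps)) = 2 * real (class_length A) * (real (Z A w) - real (count_list As A))" by simp
  qed
  finally show ?thesis by simp
qed

text \<open>Prescribing words rather than classes fixes the turn at every vertex, so that each exit
  is determined by its entrance.\<close>

definition word_tuples :: "letter list list \<Rightarrow> nat set set \<Rightarrow> (nat \<times> nat) list list set" where
  "word_tuples vs w = {ps. list_all2 (\<lambda>p v. circuit_path w p \<and> map turn p = v) ps vs \<and> distinct (map circuit_of ps)}"

definition choices :: "'a set list \<Rightarrow> 'a list set" where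
  "choices As = {vs. list_all2 (\<lambda>v A. v \<in> A) vs As}"

lemma choices_Cons: "choices (A # As) = (\<lambda>(v, vs). v # vs) ` (A \<times> choices As)"
  by (auto simp: choices_def list_all2_Cons2)

lemma choices_card:
  assumes "\<And>A. A \<in> set As \<Longrightarrow> finite A"
  shows "finite (choices As)" "card (choices As) = prod_list (map card As)"
  using assms
proof (induction As)
  case Nil
  { case 1 show ?case by (simp add: choices_def) next case 2 show ?case by (simp add: choices_def) }
next
  case (Cons A As)
  { case 1 then show ?case using Cons by (simp add: choices_Cons) next
    case 2
    have "inj_on (\<lambda>(v, vs). v # vs) (A \<times> choices As)" by (auto simp: inj_on_def)
    then show ?case using Cons 2 by (simp add: choices_Cons card_image card_cartesian_product) }
qed

lemma card_carrying_tuples: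
  assumes w: "w \<in> matchings {1..n}" and As: "set As \<subseteq> word_classes"
  shows "card (carrying_tuples As w) = (\<Sum>vs\<in>choices As. card (word_tuples vs w))"
proof -
  have eq: "carrying_tuples As w = (\<Union>vs\<in>choices As. word_tuples vs w)"
  proof (intro set_eqI iffI)
    fix ps assume "ps \<in> carrying_tuples As w"
    then have "map (map turn) ps \<in> choices As" "ps \<in> word_tuples (map (map turn) ps) w"
      by (auto simp: carrying_tuples_def choices_def word_tuples_def list_all2_map1 list_all2_map2 carrying_paths_def
          list_all2_same elim: list_all2_mono) (auto simp: list_all2_conv_all_nth in_set_conv_nth)
    then show "ps \<in> (\<Union>vs\<in>choices As. word_tuples vs w)" by blast
  next
    fix ps assume "ps \<in> (\<Union>vs\<in>choices As. word_tuples vs w)"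
    then show "ps \<in> carrying_tuples As w"
      by (auto simp: carrying_tuples_def choices_def word_tuples_def carrying_paths_def list_all2_conv_all_nth)
  qed
  have inj: "vs = map (map turn) ps" if "ps \<in> word_tuples vs w" for vs ps
    using that by (auto simp: word_tuples_def list_all2_conv_all_nth intro!: nth_equalityI)
  have "finite (word_tuples vs w)" if "vs \<in> choices As" for vs
    using finite_carrying_tuples[OF w As] finite_subset[of "word_tuples vs w"] eq that by blast
  then show ?thesis unfolding eq using inj As finite_word_class
    by (intro card_UN_disjoint choices_card) (auto, metis)
qed

section \<open>Tuples of circuits\<close>

definition halves :: "(nat \<times> nat) list list \<Rightarrow> nat set" where
  "halves ps = fst ` set (concat ps) \<union> snd ` set (concat ps)"

definition tuple_edges :: "(nat \<times> nat) list list \<Rightarrow> nat set set" where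
  "tuple_edges ps = (\<Union>p\<in>set ps. set (path_edges p))"

definition disjoint_tuple :: "(nat \<times> nat) list list \<Rightarrow> bool" where
  "disjoint_tuple ps \<longleftrightarrow> (\<forall>p\<in>set ps. good_path p) \<and> distinct (map tri (concat ps))"

lemma Union_tuple_edges: "\<Union>(tuple_edges ps) = halves ps"
proof -
  have "\<Union>(tuple_edges ps) = (\<Union>p\<in>set ps. \<Union>(set (path_edges p)))" by (auto simp: tuple_edges_def)
  then show ?thesis by (auto simp: Union_path_edges halves_def)
qed

lemma tuple_edgesE:
  assumes "e \<in> tuple_edges ps"
  obtains p k where "p \<in> set ps" "k < length p" "e = {snd (p ! k), fst (p ! (Suc k mod length p))}"
    "p ! k \<in> set p" "p ! (Suc k mod length p) \<in> set p"
proof -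
  obtain p k where pk: "p \<in> set ps" "k < length p" "e = {snd (p ! k), fst (p ! (Suc k mod length p))}"
    using assms by (auto simp: tuple_edges_def set_path_edges)
  have "0 < length p" using pk(2) by linarith
  then have "Suc k mod length p < length p" by simp
  then show ?thesis using that pk by simp
qed

lemma disjoint_tuple_unique:
  assumes "disjoint_tuple ps" "p \<in> set ps" "q \<in> set ps" "x \<in> set p" "y \<in> set q" "tri x = tri y"
  shows "x = y" "p = q"
proof -
  have d: "distinct (concat ps)" "inj_on tri (set (concat ps))" using assms(1) by (auto simp: disjoint_tuple_def distinct_map)
  have "x \<in> set (concat ps)" "y \<in> set (concat ps)" using assms by auto
  then show "x = y" using d(2) assms(6) by (auto dest: inj_onD)
  then show "p = q" using d(1) assms by (auto simp: distinct_concat_iff)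
qed

lemma disjoint_tuple_index:
  assumes "disjoint_tuple ps" "p \<in> set ps" "q \<in> set ps" "k < length p" "l < length q" "tri (p ! k) = tri (q ! l)"
  shows "p = q" "k = l"
proof -
  have mem: "p ! k \<in> set p" "q ! l \<in> set q" using assms by auto
  note * = disjoint_tuple_unique[OF assms(1-3) mem assms(6)]
  show "p = q" by (rule *(2))
  have "distinct p" using assms(1,2) good_pathD(5) by (auto simp: disjoint_tuple_def)
  then show "k = l" using * assms by (simp add: nth_eq_iff_index_eq)
qed

lemma Suc_mod_inj: "k < m \<Longrightarrow> l < m \<Longrightarrow> Suc k mod m = Suc l mod m \<Longrightarrow> k = l"
  by (auto simp: mod_Suc split: if_splits)

text \<open>In a disjoint tuple a half-edge determines its triangle, hence the passage and its role
  as entrance or exit in it, hence its edge.\<close>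

lemma tuple_edges_matching:
  assumes dt: "disjoint_tuple ps"
  shows "tuple_edges ps \<in> matchings (halves ps)"
proof -
  have gp: "good_path p" if "p \<in> set ps" for p using dt that by (auto simp: disjoint_tuple_def)
  have tr: "tri x = triangle_of (snd x)" "tri x = triangle_of (fst x)" "fst x \<noteq> snd x" if "p \<in> set ps" "x \<in> set p" for p x
    using good_pathD[OF gp[OF that(1)]] that(2) by (auto simp: tri_def)
  have cross: False if "p \<in> set ps" "q \<in> set ps" "x \<in> set p" "y \<in> set q" "snd x = fst y" for p q x y
  proof -
    have "tri x = tri y" using tr(1)[OF that(1,3)] tr(2)[OF that(2,4)] that(5) by simp
    then have "x = y" using disjoint_tuple_unique[OF dt that(1-4)] by simp
    then show False using tr(3)[OF that(1,3)] that(5) by simp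
  qed
  have same: "e = f" if e: "e \<in> tuple_edges ps" and f: "f \<in> tuple_edges ps" and a: "a \<in> e" "a \<in> f" for e f a
  proof -
    obtain p k where p: "p \<in> set ps" "k < length p" "e = {snd (p ! k), fst (p ! (Suc k mod length p))}"
      "p ! k \<in> set p" "p ! (Suc k mod length p) \<in> set p" using tuple_edgesE[OF e] .
    obtain q l where q: "q \<in> set ps" "l < length q" "f = {snd (q ! l), fst (q ! (Suc l mod length q))}"
      "q ! l \<in> set q" "q ! (Suc l mod length q) \<in> set q" using tuple_edgesE[OF f] .
    have m: "Suc k mod length p < length p" "Suc l mod length q < length q" using p(2) q(2) by (auto intro!: mod_less_divisor)
    consider "snd (p ! k) = snd (q ! l)" | "fst (p ! (Suc k mod length p)) = fst (q ! (Suc l mod length q))"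
      | "snd (p ! k) = fst (q ! (Suc l mod length q))" | "snd (q ! l) = fst (p ! (Suc k mod length p))"
      using a p(3) q(3) by auto
    then show ?thesis
    proof cases
      case 1
      then have "tri (p ! k) = tri (q ! l)" using tr(1)[OF p(1,4)] tr(1)[OF q(1,4)] by simp
      then have "p = q" "k = l" using disjoint_tuple_index[OF dt p(1) q(1) p(2) q(2)] by auto
      then show ?thesis using p(3) q(3) by simp
    next
      case 2
      then have "tri (p ! (Suc k mod length p)) = tri (q ! (Suc l mod length q))" by (simp add: tri_def)
      then have "p = q" "Suc k mod length p = Suc l mod length q" using disjoint_tuple_index[OF dt p(1) q(1) m] by auto
      moreover from this have "k = l" using Suc_mod_inj p(2) q(2) by metis
      ultimately show ?thesis using p(3) q(3) by simp
    next
      case 3 then show ?thesis using cross[OF p(1) q(1) p(4) q(5)] by simp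
    next
      case 4 then show ?thesis using cross[OF q(1) p(1) q(4) p(5)] by simp
    qed
  qed
  show ?thesis
    unfolding matchings_def partition_on_def
  proof (intro CollectI conjI)
    show "\<Union>(tuple_edges ps) = halves ps" by (rule Union_tuple_edges)
    show "disjoint (tuple_edges ps)" unfolding disjoint_def using same by blast
    show "{} \<notin> tuple_edges ps" by (auto elim: tuple_edgesE)
    show "\<forall>e\<in>tuple_edges ps. card e = 2"
    proof
      fix e assume "e \<in> tuple_edges ps"
      then obtain p k where p: "p \<in> set ps" "k < length p" "e = {snd (p ! k), fst (p ! (Suc k mod length p))}"
        "p ! k \<in> set p" "p ! (Suc k mod length p) \<in> set p" by (rule tuple_edgesE)
      then have "snd (p ! k) \<noteq> fst (p ! (Suc k mod length p))" using cross by blast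
      then show "card e = 2" using p(3) by simp
    qed
  qed
qed

lemma card_halves:
  assumes dt: "disjoint_tuple ps"
  shows "card (halves ps) = 2 * length (concat ps)"
proof -
  let ?X = "set (concat ps)"
  have d: "distinct (concat ps)" "inj_on tri ?X" using dt by (auto simp: disjoint_tuple_def distinct_map)
  have tr: "tri x = triangle_of (snd x)" "tri x = triangle_of (fst x)" "fst x \<noteq> snd x" if x: "x \<in> ?X" for x
  proof -
    obtain p where p: "p \<in> set ps" "x \<in> set p" using x by auto
    then have "good_path p" using dt by (simp add: disjoint_tuple_def)
    from good_pathD(2,3)[OF this p(2)]
    show "tri x = triangle_of (snd x)" "tri x = triangle_of (fst x)" "fst x \<noteq> snd x" by (simp_all add: tri_def)
  qed
  have "inj_on fst ?X" using d(2) tr(2) unfolding inj_on_def by metis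
  moreover have "inj_on snd ?X" using d(2) tr(1) unfolding inj_on_def by metis
  moreover have "fst ` ?X \<inter> snd ` ?X = {}"
  proof (rule ccontr)
    assume "\<not> ?thesis"
    then obtain a where "a \<in> fst ` ?X" "a \<in> snd ` ?X" by blast
    then obtain x where x: "x \<in> ?X" "a = fst x" by (elim imageE)
    obtain y where y: "y \<in> ?X" "a = snd y" using \<open>a \<in> snd ` ?X\<close> by (elim imageE)
    have xy: "x \<in> ?X" "y \<in> ?X" "fst x = snd y" using x y by simp_all
    then have "tri x = tri y" using tr(2)[OF xy(1)] tr(1)[OF xy(2)] by simp
    then have "x = y" using d(2) xy by (auto dest: inj_onD)
    then show False using tr(3)[OF xy(1)] xy(3) by simp
  qed
  ultimately have "card (halves ps) = card ?X + card ?X"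
    unfolding halves_def by (subst card_Un_disjoint) (simp_all add: card_image)
  then show ?thesis using distinct_card[OF d(1)] by simp
qed

lemma cyclic_closure:
  assumes "\<And>k. k < m \<Longrightarrow> P k \<Longrightarrow> P (Suc k mod m)" "k0 < m" "P k0" "k < m"
  shows "P k"
proof -
  have "P ((k0 + i) mod m)" for i
  proof (induction i)
    case 0 then show ?case using assms by simp
  next
    case (Suc i)
    have "(k0 + i) mod m < m" using assms(2) by (intro mod_less_divisor) linarith
    then have "P (Suc ((k0 + i) mod m) mod m)" using assms(1) Suc by blast
    then show ?case by (simp add: mod_Suc_eq)
  qed
  then have "P ((k0 + (m - k0 + k)) mod m)" .
  then show ?thesis using assms(2,4) by simp
qed

lemma cyclic_closure_down:
  assumes "\<And>k. k < m \<Longrightarrow> P (Suc k mod m) \<Longrightarrow> P k" "k0 < m" "P k0" "k < m"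
  shows "P k"
proof (rule ccontr)
  assume "\<not> P k"
  then have "\<not> P k0" using cyclic_closure[of m "\<lambda>k. \<not> P k" k k0] assms by blast
  then show False using assms(3) by blast
qed

text \<open>A face bounded by half-edges of the circuits only would turn the same way all along one of them.\<close>

lemma disjoint_tuple_not_closes_face:
  assumes dt: "disjoint_tuple ps" and range: "halves ps \<subseteq> {1..6 * N}"
    and LR: "\<And>p. p \<in> set ps \<Longrightarrow> L \<in> set (map turn p) \<and> R \<in> set (map turn p)"
  shows "\<not> closes_face (side N) (halves ps) (pmap (tuple_edges ps))"
proof
  define M where "M = tuple_edges ps"
  note M = tuple_edges_matching[OF dt, folded M_def]
  assume "closes_face (side N) (halves ps) (pmap (tuple_edges ps))"
  then obtain X where X: "X \<subseteq> halves ps" "X \<noteq> {}" "(side N \<circ> pmap M) ` X = X" by (auto simp: closes_face_def M_def)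
  have gp: "good_path p" if "p \<in> set ps" for p using dt that by (auto simp: disjoint_tuple_def)
  have el: "fst x \<in> {1..6 * N}" "snd x \<in> {1..6 * N}" "fst x \<noteq> snd x" "triangle_of (fst x) = triangle_of (snd x)"
    if "p \<in> set ps" "x \<in> set p" for p x
  proof -
    have "fst x \<in> halves ps" "snd x \<in> halves ps" using that by (auto simp: halves_def)
    then show "fst x \<in> {1..6 * N}" "snd x \<in> {1..6 * N}" using range by blast+
    show "fst x \<noteq> snd x" "triangle_of (fst x) = triangle_of (snd x)"
      using good_pathD(2,3)[OF gp[OF that(1)] that(2)] by (simp_all add: tri_def)
  qed
  \<comment> \<open>A triangle visited by a disjoint tuple has only two half-edges in use, those of
    its only passage.\<close>
  have in_tri: "a = fst x \<or> a = snd x" if a: "a \<in> halves ps" and x: "p \<in> set ps" "x \<in> set p" "triangle_of a = tri x" for a p x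
  proof -
    obtain q y where q: "q \<in> set ps" "y \<in> set q" "a = fst y \<or> a = snd y" using a by (auto simp: halves_def)
    then have "tri y = tri x" using el(4)[OF q(1,2)] x(3) by (auto simp: tri_def)
    then have "y = x" using disjoint_tuple_unique[OF dt q(1) x(1) q(2) x(2)] by simp
    then show ?thesis using q(3) by blast
  qed
  have step: "side N (pmap M a) \<in> X" if "a \<in> X" for a using that X(3) by force
  have fwd: "pmap M (snd (p ! k)) = fst (p ! (Suc k mod length p))" "pmap M (fst (p ! (Suc k mod length p))) = snd (p ! k)"
    if "p \<in> set ps" "k < length p" for p k
  proof -
    have "{snd (p ! k), fst (p ! (Suc k mod length p))} \<in> M" using that by (auto simp: M_def tuple_edges_def set_path_edges)
    then show "pmap M (snd (p ! k)) = fst (p ! (Suc k mod length p))" "pmap M (fst (p ! (Suc k mod length p))) = snd (p ! k)"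
      using pmap_eqI(1)[OF M] by (auto simp: insert_commute)
  qed
  have nth: "p ! k \<in> set p" "p ! (Suc k mod length p) \<in> set p" "Suc k mod length p < length p" if "k < length p" for p :: "(nat \<times> nat) list" and k
  proof -
    have "0 < length p" using that by linarith
    then show "Suc k mod length p < length p" by simp
    then show "p ! k \<in> set p" "p ! (Suc k mod length p) \<in> set p" using that by auto
  qed
  \<comment> \<open>Against the direction of the path: from an entrance in X the face crosses to the
    preceding exit and moves on to the next side. That side is again in use, so it is the entrance
    of that passage, which is therefore a right turn.\<close>
  have right: "turn (p ! k) = R \<and> fst (p ! k) \<in> X" if p: "p \<in> set ps" "k < length p" and fX: "fst (p ! (Suc k mod length p)) \<in> X" for p k
  proof -
    define x where "x = p ! k"
    have x: "x \<in> set p" using nth(1)[OF p(2)] by (simp add: x_def)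
    note e = el[OF p(1) x]
    have "side N (snd x) \<in> X" using step[OF fX] fwd(2)[OF p] by (simp add: x_def)
    then have nX: "next_side (snd x) \<in> X" using side_props(4)[OF e(2)] by simp
    have "triangle_of (next_side (snd x)) = tri x" using next_side_props(4)[of "snd x"] e by (simp add: tri_def)
    then have "next_side (snd x) = fst x \<or> next_side (snd x) = snd x" using in_tri[OF _ p(1) x] nX X(1) by blast
    then have nf: "next_side (snd x) = fst x" using next_side_props(2)[of "snd x"] e by auto
    have "snd x \<noteq> next_side (fst x)" using nf next_side_props(5)[of "snd x"] e(2) by auto
    then have "turn x = R" by (cases x) auto
    then show ?thesis using nf nX by (simp add: x_def)
  qed
  \<comment> \<open>The same argument along the direction of the path, with exits and left
    turns.\<close>
  have left: "turn (p ! (Suc k mod length p)) = L \<and> snd (p ! (Suc k mod length p)) \<in> X"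
    if p: "p \<in> set ps" "k < length p" and sX: "snd (p ! k) \<in> X" for p k
  proof -
    define x where "x = p ! (Suc k mod length p)"
    have x: "x \<in> set p" using nth(2)[OF p(2)] by (simp add: x_def)
    note e = el[OF p(1) x]
    have "side N (fst x) \<in> X" using step[OF sX] fwd(1)[OF p] by (simp add: x_def)
    then have nX: "next_side (fst x) \<in> X" using side_props(4)[OF e(1)] by simp
    have "triangle_of (next_side (fst x)) = tri x" using next_side_props(4)[of "fst x"] e by (simp add: tri_def)
    then have "next_side (fst x) = fst x \<or> next_side (fst x) = snd x" using in_tri[OF _ p(1) x] nX X(1) by blast
    then have nf: "next_side (fst x) = snd x" using next_side_props(2)[of "fst x"] e by auto
    then have "turn x = L" by (cases x) auto
    then show ?thesis using nf nX by (simp add: x_def)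
  qed
  obtain a where "a \<in> X" using X(2) by blast
  then obtain p x where p: "p \<in> set ps" and x: "x \<in> set p" "a = fst x \<or> a = snd x" using X(1) by (auto simp: halves_def)
  obtain k where k: "k < length p" "x = p ! k" using x by (auto simp: in_set_conv_nth)
  define j where "j = (if k = 0 then length p - 1 else k - 1)"
  have j: "j < length p" "Suc j mod length p = k" using k by (auto simp: j_def)
  from x(2) show False
  proof
    assume "a = fst x"
    then have f0: "fst (p ! k) \<in> X" using \<open>a \<in> X\<close> k by simp
    have all: "fst (p ! i) \<in> X" if "i < length p" for i
      by (rule cyclic_closure_down[of "length p" "\<lambda>i. fst (p ! i) \<in> X" k i]) (use right[OF p] f0 k that in auto)
    have "turn (p ! i) = R" if "i < length p" for i using right[OF p that] all[OF nth(3)[OF that]] by blast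
    then have "\<forall>x\<in>set p. turn x = R" by (metis in_set_conv_nth)
    then have "L \<notin> set (map turn p)" by (metis imageE letter.distinct(1) set_map)
    then show False using LR[OF p] by blast
  next
    assume "a = snd x"
    then have s0: "snd (p ! k) \<in> X" using \<open>a \<in> X\<close> k by simp
    have all: "snd (p ! i) \<in> X" if "i < length p" for i
      by (rule cyclic_closure[of "length p" "\<lambda>i. snd (p ! i) \<in> X" k i]) (use left[OF p] s0 k that in auto)
    have "turn (p ! i) = L" if i: "i < length p" for i
    proof -
      define j where "j = (if i = 0 then length p - 1 else i - 1)"
      have "j < length p" "Suc j mod length p = i" using i by (auto simp: j_def)
      then show ?thesis using left[OF p, of j] all[of j] by simp
    qed
    then have "\<forall>x\<in>set p. turn x = L" by (metis in_set_conv_nth)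
    then have "R \<notin> set (map turn p)" by (metis imageE letter.distinct(1) set_map)
    then show False using LR[OF p] by blast
  qed
qed

section \<open>Intersecting circuits\<close>

lemma matchings_subset:
  assumes "w \<in> matchings S" "M \<subseteq> w"
  shows "M \<in> matchings (\<Union>M)"
  using assms by (auto simp: matchings_def partition_on_def disjoint_def)

text \<open>The gluing carries each exit to one entrance, and at a common triangle the shared pair
  of half-edges then fixes the next exit. So q follows p step by step, and if it were longer it
  would revisit its first triangle.\<close>

lemma circuits_equal_aux:
  assumes w: "w \<in> matchings S" and p: "circuit_path w p" and q: "circuit_path w q" and hd: "p ! 0 = q ! 0"
    and same: "\<And>x y. x \<in> set p \<Longrightarrow> y \<in> set q \<Longrightarrow> tri x = tri y \<Longrightarrow> {fst x, snd x} = {fst y, snd y}"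
    and len: "length p \<le> length q"
  shows "p = q"
proof -
  have gp: "good_path p" and gq: "good_path q" using p q by (auto simp: circuit_path_iff)
  have ne: "0 < length p" using good_pathD(1)[OF gp] by simp
  have edge: "{snd (r ! k), fst (r ! (Suc k mod length r))} \<in> w" if "circuit_path w r" "k < length r" for r k
    using that by (auto simp: circuit_path_iff set_path_edges)
  have eq: "p ! k = q ! k" if "k < length p" for k
    using that
  proof (induction k)
    case 0 then show ?case using hd by simp
  next
    case (Suc k)
    have k: "Suc k mod length p = Suc k" "Suc k mod length q = Suc k" using Suc.prems len by auto
    have "{snd (q ! k), fst (p ! Suc k)} \<in> w" using edge[OF p, of k] Suc k by simp
    moreover have "{snd (q ! k), fst (q ! Suc k)} \<in> w" using edge[OF q, of k] Suc.prems len k by simp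
    ultimately have f: "fst (p ! Suc k) = fst (q ! Suc k)" using pmap_eqI(1)[OF w] by metis
    then have "{fst (p ! Suc k), snd (p ! Suc k)} = {fst (q ! Suc k), snd (q ! Suc k)}"
      using same[of "p ! Suc k" "q ! Suc k"] Suc.prems len by (simp add: tri_def)
    then have "snd (p ! Suc k) = snd (q ! Suc k)" using f by (auto simp: doubleton_eq_iff)
    then show ?case using f by (simp add: prod_eq_iff)
  qed
  have "length p = length q"
  proof (rule ccontr)
    assume "length p \<noteq> length q"
    then have lt: "length p < length q" using len by simp
    define k where "k = length p - 1"
    have k: "k < length p" "Suc k mod length p = 0" "Suc k mod length q = Suc k" "Suc k < length q" using ne lt by (auto simp: k_def)
    have "{snd (q ! k), fst (p ! 0)} \<in> w" using edge[OF p k(1)] k eq[OF k(1)] by simp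
    moreover have "{snd (q ! k), fst (q ! Suc k)} \<in> w" using edge[OF q, of k] k by simp
    ultimately have "fst (q ! 0) = fst (q ! Suc k)" using pmap_eqI(1)[OF w] hd by metis
    then have "tri (q ! 0) = tri (q ! Suc k)" by (simp add: tri_def)
    then have "q ! 0 = q ! Suc k" using k by (intro good_pathD(4)[OF gq] nth_mem) auto
    moreover have "0 < length q" using k by linarith
    ultimately show False using nth_eq_iff_index_eq[OF good_pathD(5)[OF gq], of 0 "Suc k"] k by simp
  qed
  then show ?thesis using eq by (intro nth_equalityI) auto
qed

lemma set_circuit_of:
  assumes "q \<in> circuit_of p"
  shows "set q = set p \<or> set q = prod.swap ` set p"
  using assms by (auto simp: circuit_of_def reverse_path_def)

text \<open>Rotating both paths, and reversing the second if it runs the other way, moves the common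
  triangle to the front of both.\<close>

lemma circuits_equal:
  assumes w: "w \<in> matchings S" and p: "circuit_path w p" and q: "circuit_path w q"
    and same: "\<And>x y. x \<in> set p \<Longrightarrow> y \<in> set q \<Longrightarrow> tri x = tri y \<Longrightarrow> {fst x, snd x} = {fst y, snd y}"
    and common: "x \<in> set p" "y \<in> set q" "tri x = tri y"
  shows "circuit_of p = circuit_of q"
proof -
  have gp: "good_path p" and gq: "good_path q" using p q by (auto simp: circuit_path_iff)
  have rot: "\<exists>r\<in>circuit_of s. r ! 0 = z \<and> set r = set s" if z: "z \<in> set s" for z and s :: "(nat \<times> nat) list"
  proof -
    obtain k where k: "k < length s" "z = s ! k" using z by (auto simp: in_set_conv_nth)
    have "0 < length s" using k by linarith
    then have "rotate k s ! 0 = z" using nth_rotate[of 0 s k] k by simp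
    moreover have "rotate k s \<in> circuit_of s" by (auto simp: circuit_of_def)
    ultimately show ?thesis by (intro bexI[of _ "rotate k s"]) auto
  qed
  have swap_tri: "tri (prod.swap z) = tri z" if "z \<in> set q" for z using good_pathD(3)[OF gq that] by (simp add: tri_def)
  have "\<exists>q'\<in>circuit_of q. x \<in> set q' \<and> (set q' = set q \<or> set q' = prod.swap ` set q)"
  proof -
    have "{fst x, snd x} = {fst y, snd y}" using same common by blast
    then consider "x = y" | "x = prod.swap y" by (auto simp: doubleton_eq_iff prod_eq_iff)
    then show ?thesis
    proof cases
      case 1 then show ?thesis using common circuit_of_self[of q] by blast
    next
      case 2
      have "reverse_path q \<in> circuit_of q" unfolding circuit_of_def by (intro CollectI exI[of _ 0]) simp
      moreover have "set (reverse_path q) = prod.swap ` set q" by (simp add: reverse_path_def)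
      ultimately show ?thesis using 2 common by blast
    qed
  qed
  then obtain q' where q': "q' \<in> circuit_of q" "x \<in> set q'" "set q' = set q \<or> set q' = prod.swap ` set q" by blast
  obtain p1 where p1: "p1 \<in> circuit_of p" "p1 ! 0 = x" "set p1 = set p" using rot[OF common(1)] by blast
  obtain q1 where q1: "q1 \<in> circuit_of q'" "q1 ! 0 = x" "set q1 = set q'" using rot[OF q'(2)] by blast
  have q1q: "circuit_of q1 = circuit_of q" using circuit_of_eq q1(1) q'(1) by metis
  then have "q1 \<in> circuit_of q" using circuit_of_self by metis
  then have cq1: "circuit_path w q1" by (rule circuit_path_circuit_of[OF q])
  have cp1: "circuit_path w p1" by (rule circuit_path_circuit_of[OF p p1(1)])
  have same1: "{fst a, snd a} = {fst b, snd b}" if "a \<in> set p1" "b \<in> set q1" "tri a = tri b" for a b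
  proof -
    have a: "a \<in> set p" using that p1 by simp
    from q'(3) show ?thesis
    proof
      assume "set q' = set q"
      then show ?thesis using same[OF a, of b] that q1 by simp
    next
      assume "set q' = prod.swap ` set q"
      then have "b \<in> prod.swap ` set q" using \<open>b \<in> set q1\<close> q1(3) by simp
      then obtain c where c: "c \<in> set q" "b = prod.swap c" by blast
      then have "{fst a, snd a} = {fst c, snd c}" using same[OF a c(1)] that swap_tri[OF c(1)] by simp
      then show ?thesis using c by (simp add: insert_commute)
    qed
  qed
  have "p1 = q1"
  proof (cases "length p1 \<le> length q1")
    case True
    show ?thesis
    proof (rule circuits_equal_aux[OF w cp1 cq1])
      show "p1 ! 0 = q1 ! 0" using p1(2) q1(2) by simp
      show "{fst a, snd a} = {fst b, snd b}" if "a \<in> set p1" "b \<in> set q1" "tri a = tri b" for a b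
        using that by (rule same1)
    qed (rule True)
  next
    case False
    have "q1 = p1"
    proof (rule circuits_equal_aux[OF w cq1 cp1])
      show "q1 ! 0 = p1 ! 0" using p1(2) q1(2) by simp
      show "{fst b, snd b} = {fst a, snd a}" if "b \<in> set q1" "a \<in> set p1" "tri b = tri a" for a b
        using same1[OF that(2,1) that(3)[symmetric]] by (rule sym)
      show "length q1 \<le> length p1" using False by simp
    qed
    then show ?thesis by simp
  qed
  then show ?thesis using q1q circuit_of_eq[OF p1(1)] by simp
qed

text \<open>Every visited triangle has at least two half-edges in use. If there were exactly two
  everywhere, circuits meeting in a triangle would use the same pair in each common triangle and
  hence be equal. Thus an intersection forces a third half-edge in some triangle.\<close>

lemma card_halves_intersecting:
  assumes w: "w \<in> matchings S" and circ: "\<And>p. p \<in> set ps \<Longrightarrow> circuit_path w p"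
    and dist: "distinct (map circuit_of ps)" and nd: "\<not> distinct (map tri (concat ps))"
  shows "2 * card (tri ` set (concat ps)) < card (halves ps)"
proof (rule ccontr)
  assume "\<not> ?thesis"
  then have le: "card (halves ps) \<le> 2 * card (tri ` set (concat ps))" by simp
  define X where "X = set (concat ps)"
  define T where "T = tri ` X"
  define H where "H t = {a \<in> halves ps. triangle_of a = t}" for t
  have gp: "good_path p" if "p \<in> set ps" for p using circ[OF that] by (simp add: circuit_path_iff)
  have el: "fst x \<noteq> snd x" "triangle_of (snd x) = tri x" "triangle_of (fst x) = tri x" "fst x \<in> halves ps" "snd x \<in> halves ps" if x: "x \<in> X" for x
  proof -
    obtain p where p: "p \<in> set ps" "x \<in> set p" using x by (auto simp: X_def)
    from good_pathD(2,3)[OF gp[OF p(1)] p(2)]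
    show "fst x \<noteq> snd x" "triangle_of (snd x) = tri x" "triangle_of (fst x) = tri x" by (simp_all add: tri_def)
    show "fst x \<in> halves ps" "snd x \<in> halves ps" using x by (auto simp: X_def halves_def)
  qed
  have fin: "finite X" "finite (halves ps)" by (auto simp: X_def halves_def)
  have "triangle_of a \<in> T" if a: "a \<in> halves ps" for a
  proof -
    obtain x where x: "x \<in> X" "a = fst x \<or> a = snd x" using a by (auto simp: halves_def X_def)
    then have "triangle_of a = tri x" using el(2,3)[OF x(1)] by (elim disjE) simp_all
    then show ?thesis using x(1) by (simp add: T_def)
  qed
  then have "halves ps = (\<Union>t\<in>T. H t)" by (auto simp: H_def)
  then have sum: "card (halves ps) = (\<Sum>t\<in>T. card (H t))"
    using fin by (subst card_UN_disjoint[symmetric]) (auto simp: H_def T_def)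
  have ge: "2 \<le> card (H t)" if t: "t \<in> T" for t
  proof -
    obtain x where x: "x \<in> X" "t = tri x" using t by (auto simp: T_def)
    have "card {fst x, snd x} \<le> card (H t)" using fin el[OF x(1)] x(2) by (intro card_mono) (auto simp: H_def)
    then show ?thesis using el(1)[OF x(1)] by simp
  qed
  have H2: "card (H t) = 2" if "t \<in> T" for t
  proof (rule ccontr)
    assume "card (H t) \<noteq> 2"
    then have "2 < card (H t)" using ge[OF that] by simp
    then have "(\<Sum>t\<in>T. 2) < (\<Sum>t\<in>T. card (H t))"
      using that ge fin by (intro sum_strict_mono_ex1) (auto simp: T_def)
    then show False using le sum by (simp add: T_def X_def)
  qed
  have pair: "{fst x, snd x} = H (tri x)" if "x \<in> X" for x
  proof (rule card_subset_eq)
    show "finite (H (tri x))" using fin by (simp add: H_def)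
    show "{fst x, snd x} \<subseteq> H (tri x)" using el[OF that] by (auto simp: H_def)
    show "card {fst x, snd x} = card (H (tri x))" using el(1)[OF that] H2[of "tri x"] that by (simp add: T_def)
  qed
  have inj: "inj_on circuit_of (set ps)" and dps: "distinct ps" using dist by (auto simp: distinct_map)
  have "distinct (concat (map (map tri) ps))"
  proof (rule distinct_concat)
    have disj: "p = q" if pq: "p \<in> set ps" "q \<in> set ps" "x \<in> set p" "y \<in> set q" "tri x = tri y" for p q x y
    proof -
      have "circuit_of p = circuit_of q"
      proof (rule circuits_equal[OF w circ[OF pq(1)] circ[OF pq(2)] _ pq(3-5)])
        fix a b assume "a \<in> set p" "b \<in> set q" "tri a = tri b"
        then show "{fst a, snd a} = {fst b, snd b}" using pair[of a] pair[of b] pq by (auto simp: X_def)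
      qed
      then show ?thesis using inj pq by (auto dest: inj_onD)
    qed
    show "distinct (map (map tri) ps)"
      unfolding distinct_map
    proof (intro conjI dps inj_onI)
      fix p q assume pq: "p \<in> set ps" "q \<in> set ps" "map tri p = map tri q"
      have "p \<noteq> []" using good_pathD(1)[OF gp[OF pq(1)]] .
      then obtain x where x: "x \<in> set p" by (cases p) auto
      then have "tri x \<in> tri ` set q" using pq(3) by (metis image_eqI set_map)
      then obtain y where "y \<in> set q" "tri x = tri y" by blast
      then show "p = q" using disj pq x by blast
    qed
    show "distinct ys" if "ys \<in> set (map (map tri) ps)" for ys using that gp by (auto simp: good_path_def)
    show "set ys \<inter> set zs = {}" if "ys \<in> set (map (map tri) ps)" "zs \<in> set (map (map tri) ps)" "ys \<noteq> zs" for ys zs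
      using that disj by fastforce
  qed
  then show False using nd by (simp add: map_concat)
qed

lemma circuit_of_tri:
  assumes "good_path p" "good_path q" "circuit_of p = circuit_of q"
  shows "tri ` set p = tri ` set q"
proof -
  have "p \<in> circuit_of q" using assms(3) circuit_of_self by metis
  moreover have "tri ` prod.swap ` set q = tri ` set q"
    unfolding image_image using good_pathD(3)[OF assms(2)] by (intro image_cong) (auto simp: tri_def)
  ultimately show ?thesis using set_circuit_of by metis
qed

lemma disjoint_tuple_distinct_circuits:
  assumes "disjoint_tuple ps"
  shows "distinct (map circuit_of ps)"
  using assms
proof (induction ps)
  case (Cons p ps)
  have gp: "good_path q" if "q \<in> set (p # ps)" for q using Cons.prems that by (auto simp: disjoint_tuple_def)
  have "circuit_of p \<noteq> circuit_of q" if "q \<in> set ps" for q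
  proof
    assume "circuit_of p = circuit_of q"
    then have eq: "tri ` set p = tri ` set q" using circuit_of_tri gp that by auto
    have dis: "tri ` set p \<inter> tri ` set (concat ps) = {}" using Cons.prems by (auto simp: disjoint_tuple_def)
    have "tri ` set q \<subseteq> tri ` set (concat ps)" using that by (intro image_mono) auto
    then have "tri ` set p = tri ` set p \<inter> tri ` set (concat ps)" unfolding eq by (rule inf.absorb1[symmetric])
    then have "tri ` set p = {}" using dis by simp
    then have "p = []" by simp
    then show False using good_pathD(1)[of p] gp by simp
  qed
  moreover have "disjoint_tuple ps" using Cons.prems by (auto simp: disjoint_tuple_def)
  ultimately show ?case using Cons.IH by auto
qed simp

section \<open>Expected number of tuples\<close>

text \<open>The conditional expectation; it is 0 when there is no one-vertex gluing, by division by
  zero.\<close>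

definition avg :: "nat \<Rightarrow> (nat set set \<Rightarrow> real) \<Rightarrow> real" where
  "avg N f = (\<Sum>w\<in>max_genus_gluings N. f w) / real (card (max_genus_gluings N))"

text \<open>Candidates that do not refer to a gluing, so that the sums over gluings and over tuples
  can be exchanged.\<close>

definition potential_tuples :: "nat \<Rightarrow> letter list list \<Rightarrow> (nat \<times> nat) list list set" where
  "potential_tuples N vs = {ps. list_all2 (\<lambda>p v. good_path p \<and> map turn p = v) ps vs \<and>
     distinct (map circuit_of ps) \<and> halves ps \<subseteq> {1..6 * N}}"

definition exit_side :: "letter \<Rightarrow> nat \<Rightarrow> nat" where
  "exit_side l i = (case l of L \<Rightarrow> next_side i | R \<Rightarrow> next_side (next_side i))"

text \<open>Once the words are prescribed, these half-edges encode the whole tuple: turns give the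
  exits, and word lengths give the cuts between paths.\<close>

definition entrances :: "(nat \<times> nat) list list \<Rightarrow> nat list" where
  "entrances ps = map fst (concat ps)"

lemma potential_tuplesD:
  assumes "ps \<in> potential_tuples N vs"
  shows "vs = map (map turn) ps" "\<And>p. p \<in> set ps \<Longrightarrow> good_path p" "distinct (map circuit_of ps)" "halves ps \<subseteq> {1..6 * N}"
    "concat vs = map turn (concat ps)" "length (concat ps) = length (concat vs)"
proof -
  have a: "list_all2 (\<lambda>p v. good_path p \<and> map turn p = v) ps vs" using assms by (simp add: potential_tuples_def)
  show "vs = map (map turn) ps" using a by (auto simp: list_all2_conv_all_nth intro!: nth_equalityI)
  then show "concat vs = map turn (concat ps)" by (simp add: map_concat)
  then show "length (concat ps) = length (concat vs)" by (metis length_map)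
  show "good_path p" if "p \<in> set ps" for p using a that by (auto simp: list_all2_conv_all_nth in_set_conv_nth)
qed (use assms in \<open>auto simp: potential_tuples_def\<close>)

lemma potential_tuplesI:
  assumes "vs = map (map turn) ps" "\<And>p. p \<in> set ps \<Longrightarrow> good_path p" "distinct (map circuit_of ps)" "halves ps \<subseteq> {1..6 * N}"
  shows "ps \<in> potential_tuples N vs"
  using assms by (auto simp: potential_tuples_def list_all2_conv_all_nth)

lemma entrances_in_range: "ps \<in> potential_tuples N vs \<Longrightarrow> set (entrances ps) \<subseteq> {1..6 * N}"
  using potential_tuplesD(4) by (auto simp: entrances_def halves_def)

lemma concat_from_entrances:
  assumes "ps \<in> potential_tuples N vs"
  shows "concat ps = map2 (\<lambda>i l. (i, exit_side l i)) (entrances ps) (concat vs)"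
proof -
  have "x = (fst x, exit_side (turn x) (fst x))" if x: "x \<in> set (concat ps)" for x
  proof -
    obtain p where p: "p \<in> set ps" "x \<in> set p" using x by auto
    note g = good_pathD(2,3)[OF potential_tuplesD(2)[OF assms p(1)] p(2)]
    have "fst x \<in> halves ps" "snd x \<in> halves ps" using x by (auto simp: halves_def)
    then have r: "1 \<le> fst x" "1 \<le> snd x" using potential_tuplesD(4)[OF assms] by auto
    have "snd x = exit_side (turn x) (fst x)"
      using turn_cases(1)[OF r g(1)] g(2) by (auto simp: exit_side_def tri_def simp del: turn.simps)
    then show ?thesis by (simp add: prod_eq_iff)
  qed
  then have "concat ps = map (\<lambda>x. (fst x, exit_side (turn x) (fst x))) (concat ps)"
    by (intro map_idI[symmetric]) simp
  also have "\<dots> = map2 (\<lambda>i l. (i, exit_side l i)) (entrances ps) (concat vs)"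
    unfolding entrances_def potential_tuplesD(5)[OF assms] by (simp add: zip_map_map zip_same_conv_map comp_def)
  finally show ?thesis .
qed

lemma inj_on_entrances: "inj_on entrances (potential_tuples N vs)"
proof (rule inj_onI)
  fix ps qs assume ps: "ps \<in> potential_tuples N vs" and qs: "qs \<in> potential_tuples N vs" and eq: "entrances ps = entrances qs"
  have "concat ps = concat qs" using concat_from_entrances[OF ps] concat_from_entrances[OF qs] eq by metis
  moreover have m: "map (map turn) ps = map (map turn) qs" using potential_tuplesD(1)[OF ps] potential_tuplesD(1)[OF qs] by simp
  have "length ps = length qs" using m by (metis length_map)
  moreover have "length (ps ! i) = length (qs ! i)" if "i < length ps" for i
    using m that \<open>length ps = length qs\<close> by (metis length_map nth_map)
  then have "\<forall>(x, y)\<in>set (zip ps qs). length x = length y" by (auto simp: set_zip)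
  ultimately show "ps = qs" using concat_eq_concat_iff by blast
qed

lemma entrances_in_lists:
  "entrances ` potential_tuples N vs \<subseteq> {xs. set xs \<subseteq> {1..6 * N} \<and> length xs = length (concat vs)}"
proof clarify
  fix ps assume ps: "ps \<in> potential_tuples N vs"
  show "set (entrances ps) \<subseteq> {1..6 * N} \<and> length (entrances ps) = length (concat vs)"
    using entrances_in_range[OF ps] potential_tuplesD(6)[OF ps] by (simp add: entrances_def)
qed

lemma finite_potential_tuples: "finite (potential_tuples N vs)"
  by (rule inj_on_finite[OF inj_on_entrances entrances_in_lists]) (simp add: finite_lists_length_eq)

text \<open>Linearity of expectation: a candidate occurs in a gluing precisely when the gluing
  contains its edges.\<close>

lemma avg_word_tuples:
  assumes "N \<ge> 1"
  shows "avg N (\<lambda>w. real (card (word_tuples vs w))) = (\<Sum>ps\<in>potential_tuples N vs. contain_prob N (tuple_edges ps))"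
proof -
  let ?G = "max_genus_gluings N" and ?P = "potential_tuples N vs"
  have wt: "word_tuples vs w = {ps \<in> ?P. tuple_edges ps \<subseteq> w}" if w: "w \<in> ?G" for w
  proof (intro set_eqI iffI)
    fix ps assume ps: "ps \<in> word_tuples vs w"
    then have la: "list_all2 (\<lambda>p v. circuit_path w p \<and> map turn p = v) ps vs" "distinct (map circuit_of ps)" by (auto simp: word_tuples_def)
    have c: "circuit_path w p" if "p \<in> set ps" for p using la that by (auto simp: list_all2_conv_all_nth in_set_conv_nth)
    then have sub: "tuple_edges ps \<subseteq> w" by (auto simp: tuple_edges_def circuit_path_iff)
    have "w \<in> matchings {1..6 * N}" using w max_genus_gluings_iff[OF assms] by blast
    then have "halves ps \<subseteq> {1..6 * N}" using Union_mono[OF sub] Union_tuple_edges[of ps] matchings_Union by metis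
    moreover have "vs = map (map turn) ps" using la by (auto simp: list_all2_conv_all_nth intro!: nth_equalityI)
    ultimately show "ps \<in> {ps \<in> ?P. tuple_edges ps \<subseteq> w}"
      using sub c la(2) by (auto intro!: potential_tuplesI simp: circuit_path_iff)
  next
    fix ps assume "ps \<in> {ps \<in> ?P. tuple_edges ps \<subseteq> w}"
    then have ps: "ps \<in> ?P" and sub: "tuple_edges ps \<subseteq> w" by auto
    have "circuit_path w p" if "p \<in> set ps" for p
      using potential_tuplesD(2)[OF ps that] sub that by (auto simp: circuit_path_iff tuple_edges_def)
    then show "ps \<in> word_tuples vs w"
      using potential_tuplesD(1,3)[OF ps] by (auto simp: word_tuples_def list_all2_conv_all_nth)
  qed
  have finG: "finite ?G"
  proof (rule ccontr)
    assume "infinite ?G"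
    moreover have "?G \<subseteq> Pow (Pow {1..6 * N})"
      using max_genus_gluings_iff[OF assms] matchings_Union by blast
    ultimately show False using finite_subset by blast
  qed
  have "(\<Sum>w\<in>?G. real (card (word_tuples vs w))) = (\<Sum>w\<in>?G. \<Sum>ps\<in>?P. if tuple_edges ps \<subseteq> w then 1 else 0)"
    using wt finite_potential_tuples by (intro sum.cong refl) (simp flip: sum.inter_filter)
  also have "\<dots> = (\<Sum>ps\<in>?P. \<Sum>w\<in>?G. if tuple_edges ps \<subseteq> w then 1 else 0)" by (rule sum.swap)
  also have "\<dots> = (\<Sum>ps\<in>?P. real (card {w \<in> ?G. tuple_edges ps \<subseteq> w}))"
    using finG by (intro sum.cong refl) (simp flip: sum.inter_filter)
  finally show ?thesis by (simp add: avg_def contain_prob_def sum_divide_distrib)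
qed

section \<open>Counting the candidates\<close>

definition rainbow_lists :: "nat \<Rightarrow> nat \<Rightarrow> nat list set" where
  "rainbow_lists N m = {xs. set xs \<subseteq> {1..6 * N} \<and> length xs = m \<and> distinct (map triangle_of xs)}"

lemma triangle_fiber:
  assumes "x \<in> {1..6 * N}"
  shows "{y \<in> {1..6 * N}. triangle_of y = triangle_of x} = {x, next_side x, next_side (next_side x)}"
    "card {y \<in> {1..6 * N}. triangle_of y = triangle_of x} = 3"
proof -
  note n = next_side_props[of x] next_side_props[of "next_side x"]
  have x: "1 \<le> x" "next_side x \<in> {1..6 * N}" "next_side (next_side x) \<in> {1..6 * N}"
    using assms next_side_le by auto
  have "y = x \<or> y = next_side x \<or> y = next_side (next_side x)" if "y \<in> {1..6 * N}" "triangle_of y = triangle_of x" for y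
    using triangle_of_eq_iff[of x y] that x(1) by simp
  then show eq: "{y \<in> {1..6 * N}. triangle_of y = triangle_of x} = {x, next_side x, next_side (next_side x)}"
    using assms x n by auto
  have "next_side x \<noteq> x" "next_side (next_side x) \<noteq> x" "next_side (next_side x) \<noteq> next_side x" using n x by auto
  then show "card {y \<in> {1..6 * N}. triangle_of y = triangle_of x} = 3" unfolding eq by simp
qed

text \<open>Each side already chosen excludes the three sides of its triangle.\<close>

lemma card_rainbow_lists: "card (rainbow_lists N m) = (\<Prod>i<m. 6 * N - 3 * i)"
proof (induction m)
  case 0
  have "rainbow_lists N 0 = {[]}" by (auto simp: rainbow_lists_def)
  then show ?case by simp
next
  case (Suc m)
  define A where "A xs = {x \<in> {1..6 * N}. triangle_of x \<notin> triangle_of ` set xs}" for xs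
  have fin: "finite (rainbow_lists N m)"
    by (rule finite_subset[OF _ finite_lists_length_eq[of "{1..6 * N}" m]]) (auto simp: rainbow_lists_def)
  have "rainbow_lists N (Suc m) = (\<Union>xs\<in>rainbow_lists N m. (\<lambda>x. x # xs) ` A xs)"
    by (auto simp: rainbow_lists_def A_def length_Suc_conv image_iff)
  also have "card \<dots> = (\<Sum>xs\<in>rainbow_lists N m. card ((\<lambda>x. x # xs) ` A xs))"
    using fin by (intro card_UN_disjoint) (auto simp: A_def)
  also have "\<dots> = (\<Sum>xs\<in>rainbow_lists N m. 6 * N - 3 * m)"
  proof (rule sum.cong[OF refl])
    fix xs assume xs: "xs \<in> rainbow_lists N m"
    define B where "B = {x \<in> {1..6 * N}. triangle_of x \<in> triangle_of ` set xs}"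
    have xsr: "set xs \<subseteq> {1..6 * N}" "length xs = m" "distinct (map triangle_of xs)" using xs by (auto simp: rainbow_lists_def)
    have "B = (\<Union>t\<in>triangle_of ` set xs. {y \<in> {1..6 * N}. triangle_of y = t})" by (auto simp: B_def)
    also have "card \<dots> = (\<Sum>t\<in>triangle_of ` set xs. card {y \<in> {1..6 * N}. triangle_of y = t})"
      by (intro card_UN_disjoint) auto
    also have "\<dots> = (\<Sum>t\<in>triangle_of ` set xs. 3)"
      using triangle_fiber(2) xsr(1) by (intro sum.cong refl) blast
    also have "\<dots> = 3 * m" using distinct_card[OF xsr(3)] xsr(2) by simp
    finally have B: "card B = 3 * m" .
    have "A xs = {1..6 * N} - B" by (auto simp: A_def B_def)
    moreover have "card ({1..6 * N} - B) = 6 * N - 3 * m" using B by (subst card_Diff_subset) (auto simp: B_def)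
    moreover have "card ((\<lambda>x. x # xs) ` A xs) = card (A xs)" by (intro card_image) (auto simp: inj_on_def)
    ultimately show "card ((\<lambda>x. x # xs) ` A xs) = 6 * N - 3 * m" by simp
  qed
  finally show ?case using Suc by simp
qed

lemma split_by_lengths: "length c = length (concat vs) \<Longrightarrow> \<exists>ps. concat ps = c \<and> map length ps = map length vs"
proof (induction vs arbitrary: c)
  case (Cons v vs)
  have "length (drop (length v) c) = length (concat vs)" using Cons.prems by simp
  from Cons.IH[OF this] obtain ps where "concat ps = drop (length v) c" "map length ps = map length vs" by blast
  then show ?case using Cons.prems by (intro exI[of _ "take (length v) c # ps"]) auto
qed simp

text \<open>Entrances may be chosen freely in different triangles: words prescribe the exits,
  lengths cut the list into paths, and having no common triangle already makes the circuits
  different.\<close>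

lemma entrances_disjoint_tuples:
  assumes ne: "[] \<notin> set vs"
  shows "entrances ` {ps \<in> potential_tuples N vs. disjoint_tuple ps} = rainbow_lists N (length (concat vs))"
proof (intro set_eqI iffI)
  fix xs assume "xs \<in> entrances ` {ps \<in> potential_tuples N vs. disjoint_tuple ps}"
  then obtain ps where ps: "ps \<in> potential_tuples N vs" "disjoint_tuple ps" "xs = entrances ps" by blast
  have "xs \<in> {xs. set xs \<subseteq> {1..6 * N} \<and> length xs = length (concat vs)}" using entrances_in_lists ps by blast
  moreover have "map triangle_of xs = map tri (concat ps)" by (simp add: ps(3) entrances_def tri_def)
  ultimately show "xs \<in> rainbow_lists N (length (concat vs))" using ps(2) by (simp add: rainbow_lists_def disjoint_tuple_def)
next
  fix xs assume "xs \<in> rainbow_lists N (length (concat vs))"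
  then have xs: "set xs \<subseteq> {1..6 * N}" "length xs = length (concat vs)" "distinct (map triangle_of xs)" by (auto simp: rainbow_lists_def)
  define c where "c = map2 (\<lambda>i l. (i, exit_side l i)) xs (concat vs)"
  obtain ps where ps: "concat ps = c" "map length ps = map length vs" using split_by_lengths[of c vs] xs by (auto simp: c_def)
  have ex: "turn (i, exit_side l i) = l \<and> i \<noteq> exit_side l i \<and> triangle_of (exit_side l i) = triangle_of i \<and> exit_side l i \<in> {1..6 * N}"
    if "i \<in> {1..6 * N}" for i l
    using next_side_props[of i] next_side_props[of "next_side i"] next_side_le[of i N] next_side_le[of "next_side i" N] that
    by (cases l) (auto simp: exit_side_def)
  have el: "fst x \<noteq> snd x \<and> triangle_of (fst x) = triangle_of (snd x) \<and> fst x \<in> {1..6 * N} \<and> snd x \<in> {1..6 * N}" if x: "x \<in> set c" for x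
  proof -
    obtain i l where il: "(i, l) \<in> set (zip xs (concat vs))" "x = (i, exit_side l i)" using x by (auto simp: c_def)
    then have "i \<in> {1..6 * N}" using xs(1) set_zip_leftD by fastforce
    then show ?thesis using ex il(2) by simp
  qed
  have tc: "map tri c = map triangle_of xs"
    using xs(2) by (intro nth_equalityI) (auto simp: c_def tri_def)
  have "map turn c = concat vs"
  proof (rule nth_equalityI)
    show "length (map turn c) = length (concat vs)" using xs by (simp add: c_def)
    fix i assume "i < length (map turn c)"
    then have i: "i < length xs" "i < length (concat vs)" using xs by (auto simp: c_def)
    then have "xs ! i \<in> {1..6 * N}" using xs(1) nth_mem by blast
    then show "map turn c ! i = concat vs ! i" using ex i by (simp add: c_def del: turn.simps)
  qed
  then have "concat (map (map turn) ps) = concat vs" using ps(1) by (metis map_concat)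
  moreover have lp: "length ps = length vs" using ps(2) by (metis length_map)
  have "length (ps ! i) = length (vs ! i)" if "i < length ps" for i using ps(2) that lp by (metis nth_map)
  then have "\<forall>(x, y)\<in>set (zip (map (map turn) ps) vs). length x = length y" by (auto simp: set_zip)
  ultimately have vs: "vs = map (map turn) ps" using concat_eq_concat_iff[of "map (map turn) ps" vs] lp by simp
  have dist: "distinct (concat (map (map tri) ps))" using tc xs(3) ps(1) by (simp flip: map_concat)
  have gp: "good_path p" if p: "p \<in> set ps" for p
  proof -
    have "p \<noteq> []" using ne p vs by force
    moreover have "set p \<subseteq> set c" using p ps(1) by auto
    moreover have "distinct (map tri p)" using dist p by (auto simp: distinct_concat_iff)
    ultimately show ?thesis using el by (auto simp: good_path_def)
  qed
  have dt: "disjoint_tuple ps" using gp dist by (simp add: disjoint_tuple_def map_concat)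
  have "halves ps \<subseteq> {1..6 * N}" using el ps(1) by (auto simp: halves_def)
  then have "ps \<in> potential_tuples N vs" using vs gp disjoint_tuple_distinct_circuits[OF dt] by (intro potential_tuplesI) auto
  moreover have "entrances ps = xs"
    using xs(2) by (simp add: entrances_def ps(1) c_def case_prod_unfold comp_def map_fst_zip)
  ultimately show "xs \<in> entrances ` {ps \<in> potential_tuples N vs. disjoint_tuple ps}" using dt by blast
qed

lemma card_disjoint_tuples:
  assumes "[] \<notin> set vs"
  shows "card {ps \<in> potential_tuples N vs. disjoint_tuple ps} = (\<Prod>i<length (concat vs). 6 * N - 3 * i)"
proof -
  have "card (entrances ` {ps \<in> potential_tuples N vs. disjoint_tuple ps}) = card {ps \<in> potential_tuples N vs. disjoint_tuple ps}"
    by (rule card_image, rule inj_on_subset[OF inj_on_entrances]) auto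
  then show ?thesis unfolding entrances_disjoint_tuples[OF assms] card_rainbow_lists by simp
qed

text \<open>One entrance is selected in each of the k triangles, in at most (6N)^k ways; all
  entrances then lie among the at most 3k sides of these triangles.\<close>

lemma card_tuples_with_triangles:
  "card {ps \<in> potential_tuples N vs. card (tri ` set (concat ps)) = k} \<le> (6 * N) ^ k * (3 * k) ^ length (concat vs)"
proof -
  let ?P = "{ps \<in> potential_tuples N vs. card (tri ` set (concat ps)) = k}"
  define m where "m = length (concat vs)"
  define Y where "Y = {ys. set ys \<subseteq> {1..6 * N} \<and> length ys = k}"
  define F where "F ys = (\<Union>y\<in>set ys. {y, next_side y, next_side (next_side y)})" for ys
  define B where "B ys = {xs. set xs \<subseteq> F ys \<and> length xs = m}" for ys
  have "entrances ps \<in> (\<Union>ys\<in>Y. B ys)" if ps: "ps \<in> ?P" for ps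
  proof -
    define E where "E = set (entrances ps)"
    have E: "E \<subseteq> {1..6 * N}" "length (entrances ps) = m" using entrances_in_lists[of N vs] ps by (auto simp: E_def m_def)
    have "triangle_of ` E = tri ` set (concat ps)" by (auto simp: E_def entrances_def tri_def image_image)
    then have cE: "card (triangle_of ` E) = k" using ps by simp
    obtain T where T: "T \<subseteq> E" "inj_on triangle_of T" "triangle_of ` E = triangle_of ` T" using subset_image_inj[of "triangle_of ` E" triangle_of E] by auto
    have "finite T" using T(1) finite_subset by (auto simp: E_def)
    then obtain ys where ys: "set ys = T" "distinct ys" using finite_distinct_list by blast
    have "length ys = k" using ys cE T(2,3) by (metis card_image distinct_card)
    then have "ys \<in> Y" using ys T(1) E(1) by (auto simp: Y_def)
    moreover have "E \<subseteq> F ys"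
    proof
      fix x assume x: "x \<in> E"
      then have "triangle_of x \<in> triangle_of ` T" unfolding T(3)[symmetric] by (rule imageI)
      then obtain y where y: "y \<in> T" "triangle_of x = triangle_of y" by (elim imageE)
      have yx: "y \<in> {1..6 * N}" "x \<in> {1..6 * N}" using x y(1) T(1) E(1) by blast+
      then have "x \<in> {z \<in> {1..6 * N}. triangle_of z = triangle_of y}" using y(2) by blast
      then have "x \<in> {y, next_side y, next_side (next_side y)}" unfolding triangle_fiber(1)[OF yx(1)] .
      then show "x \<in> F ys" using y(1) ys(1) unfolding F_def by blast
    qed
    ultimately show ?thesis using E(2) by (auto simp: B_def E_def)
  qed
  then have "entrances ` ?P \<subseteq> (\<Union>ys\<in>Y. B ys)" by blast
  moreover have finF: "finite (F ys)" for ys by (simp add: F_def)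
  have finY: "finite Y" unfolding Y_def by (rule finite_lists_length_eq) simp
  have "finite (\<Union>ys\<in>Y. B ys)" using finY finF by (auto simp: B_def intro!: finite_lists_length_eq)
  ultimately have "card (entrances ` ?P) \<le> card (\<Union>ys\<in>Y. B ys)" by (intro card_mono)
  also have "\<dots> \<le> (\<Sum>ys\<in>Y. card (B ys))" by (rule card_UN_le[OF finY])
  also have "\<dots> \<le> (\<Sum>ys\<in>Y. (3 * k) ^ m)"
  proof (rule sum_mono)
    fix ys assume ys: "ys \<in> Y"
    have "card (F ys) \<le> (\<Sum>y\<in>set ys. card {y, next_side y, next_side (next_side y)})" unfolding F_def by (rule card_UN_le) simp
    also have "\<dots> \<le> (\<Sum>y\<in>set ys. 3)" by (intro sum_mono) (simp add: card_insert_if)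
    also have "\<dots> \<le> 3 * k" using ys card_length[of ys] by (auto simp: Y_def)
    finally have "card (F ys) \<le> 3 * k" .
    then show "card (B ys) \<le> (3 * k) ^ m" unfolding B_def card_lists_length_eq[OF finF] by (rule power_mono) simp
  qed
  also have "\<dots> = (6 * N) ^ k * (3 * k) ^ m" by (simp add: Y_def card_lists_length_eq)
  also have "card (entrances ` ?P) = card ?P" by (rule card_image, rule inj_on_subset[OF inj_on_entrances]) auto
  finally show ?thesis by (simp add: m_def)
qed

text \<open>If some gluing contains the tuple, its edges number e > k, where k is the number of
  triangles. The probability is then at most 2 (6N)^(-e), with 2 being 1 plus the tolerance
  1.\<close>

lemma contain_prob_intersecting:
  assumes N: "N \<ge> 1" and ps: "ps \<in> potential_tuples N vs" "\<not> disjoint_tuple ps"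
    and asymp: "\<And>e D M. e \<le> length (concat vs) \<Longrightarrow> M \<in> matchings D \<Longrightarrow> D \<subseteq> {1..6 * N} \<Longrightarrow> card D = 2 * e \<Longrightarrow>
      contain_prob N M = 0 \<or> \<bar>contain_prob N M * real (6 * N) ^ e - 1\<bar> < 1"
  shows "contain_prob N (tuple_edges ps) \<le> 2 / real (6 * N) ^ Suc (card (tri ` set (concat ps)))"
proof (cases "contain_prob N (tuple_edges ps) = 0")
  case False
  have "{w \<in> max_genus_gluings N. tuple_edges ps \<subseteq> w} \<noteq> {}"
  proof
    assume "{w \<in> max_genus_gluings N. tuple_edges ps \<subseteq> w} = {}"
    then show False using False by (simp only: contain_prob_def card.empty of_nat_0 div_0)
  qed
  then obtain w where w: "w \<in> max_genus_gluings N" "tuple_edges ps \<subseteq> w" by blast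
  have wm: "w \<in> matchings {1..6 * N}" using w max_genus_gluings_iff[OF N] by blast
  note pd = potential_tuplesD[OF ps(1)]
  have circ: "circuit_path w p" if "p \<in> set ps" for p using pd(2)[OF that] w(2) that by (auto simp: circuit_path_iff tuple_edges_def)
  have nd: "\<not> distinct (map tri (concat ps))" using ps(2) pd(2) by (auto simp: disjoint_tuple_def)
  define k where "k = card (tri ` set (concat ps))"
  have lt: "2 * k < card (halves ps)" unfolding k_def by (rule card_halves_intersecting[OF wm circ pd(3) nd])
  have M: "tuple_edges ps \<in> matchings (halves ps)" using matchings_subset[OF wm w(2)] by (simp add: Union_tuple_edges)
  have finh: "finite (halves ps)" by (auto simp: halves_def)
  have "even (card (halves ps))" using sign_fpf_invol(2)[OF finh pmap_fpf_invol[OF M]] .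
  then obtain e where e: "card (halves ps) = 2 * e" by (auto elim: evenE)
  have "card (halves ps) \<le> card (fst ` set (concat ps)) + card (snd ` set (concat ps))" unfolding halves_def by (rule card_Un_le)
  also have "\<dots> \<le> card (set (concat ps)) + card (set (concat ps))" by (intro add_mono card_image_le) auto
  also have "\<dots> \<le> 2 * length (concat vs)" using card_length[of "concat ps"] pd(6) by simp
  finally have "e \<le> length (concat vs)" using e by simp
  then have "\<bar>contain_prob N (tuple_edges ps) * real (6 * N) ^ e - 1\<bar> < 1" using asymp[OF _ M pd(4) e] False by blast
  then have "contain_prob N (tuple_edges ps) * real (6 * N) ^ e \<le> 2" by (simp only: abs_less_iff) linarith
  then have "contain_prob N (tuple_edges ps) \<le> 2 / real (6 * N) ^ e" using N by (simp add: field_simps)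
  also have "\<dots> \<le> 2 / real (6 * N) ^ Suc k" using lt e N by (intro divide_left_mono power_increasing) auto
  finally show ?thesis by (simp add: k_def)
qed simp

text \<open>With m the total length, there are about (6N)^m disjoint tuples, each of probability
  about (6N)^(-m). Intersecting tuples on k triangles number O(N^k) and have probability O(N^(-k-1))
  each, so they add up to O(1/N).\<close>

lemma avg_word_tuples_tendsto:
  assumes LR: "\<And>v. v \<in> set vs \<Longrightarrow> L \<in> set v \<and> R \<in> set v"
  shows "((\<lambda>N. avg N (\<lambda>w. real (card (word_tuples vs w)))) \<longlongrightarrow> 1) odd_numbers"
proof (rule tendstoI)
  fix \<epsilon> :: real assume \<epsilon>: "\<epsilon> > 0"
  define m where "m = length (concat vs)"
  define K where "K = (\<Sum>k\<le>m. 2 * real ((3 * k) ^ m))"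
  define c where "c N = real (\<Prod>i<m. 6 * N - 3 * i) / real (6 * N) ^ m" for N
  have ne: "[] \<notin> set vs" using LR by force
  have "(\<lambda>N. \<Prod>i<m. real (6 * N - 3 * i) / real (6 * N)) \<longlonglongrightarrow> (\<Prod>i<m. 1)"
    by (intro tendsto_prod) real_asymp
  then have "c \<longlonglongrightarrow> 1" by (simp add: c_def [abs_def] prod_dividef)
  then have ev1: "\<forall>\<^sub>F N in odd_numbers. dist (c N) 1 < \<epsilon> / 3" using tendsto_odd_numbers \<epsilon> tendstoD by (metis zero_less_divide_iff zero_less_numeral)
  have "(\<lambda>N. K / real (6 * N)) \<longlonglongrightarrow> 0" by real_asymp
  then have ev2: "\<forall>\<^sub>F N in odd_numbers. dist (K / real (6 * N)) 0 < \<epsilon> / 3" using tendsto_odd_numbers \<epsilon> tendstoD by (metis zero_less_divide_iff zero_less_numeral)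
  have ev3: "\<forall>\<^sub>F N in odd_numbers. N \<ge> 1"
    unfolding eventually_odd_numbers by (rule eventually_mono[OF eventually_ge_at_top[of 1]]) simp
  \<comment> \<open>The bound on intersecting tuples needs a tolerance of at most 1; the disjoint
    ones get a third of \<epsilon>.\<close>
  define \<delta> where "\<delta> = min 1 (\<epsilon> / 3)"
  have \<delta>: "\<delta> > 0" "\<delta> \<le> 1" "\<delta> \<le> \<epsilon> / 3" using \<epsilon> by (auto simp: \<delta>_def)
  have "\<forall>\<^sub>F N in odd_numbers. \<forall>e\<in>{..m}. 0 < card (max_genus_gluings N) \<and>
    (\<forall>D M. M \<in> matchings D \<longrightarrow> D \<subseteq> {1..6 * N} \<longrightarrow> card D = 2 * e \<longrightarrow>
      (if closes_face (side N) D (pmap M) then contain_prob N M = 0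
       else \<bar>contain_prob N M * real (6 * N) ^ e - 1\<bar> < \<delta>))"
    by (intro eventually_ball_finite ballI contain_prob_asymptotics \<delta>) simp
  then show "\<forall>\<^sub>F N in odd_numbers. dist (avg N (\<lambda>w. real (card (word_tuples vs w)))) 1 < \<epsilon>"
    using ev1 ev2 ev3
  proof eventually_elim
    case (elim N)
    note N = elim(4)
    define P where "P = potential_tuples N vs"
    define n where "n = real (6 * N)"
    have n: "n > 0" using N by (simp add: n_def)
    have finP: "finite P" unfolding P_def by (rule finite_potential_tuples)
    have asymp: "if closes_face (side N) D (pmap M) then contain_prob N M = 0 else \<bar>contain_prob N M * n ^ e - 1\<bar> < \<delta>"
      if "e \<le> m" "M \<in> matchings D" "D \<subseteq> {1..6 * N}" "card D = 2 * e" for e D M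
      using elim(1) that unfolding n_def by blast
    define P0 where "P0 = {ps \<in> P. disjoint_tuple ps}"
    define P1 where "P1 = {ps \<in> P. \<not> disjoint_tuple ps}"
    have split: "(\<Sum>ps\<in>P. contain_prob N (tuple_edges ps)) = (\<Sum>ps\<in>P0. contain_prob N (tuple_edges ps)) + (\<Sum>ps\<in>P1. contain_prob N (tuple_edges ps))"
      unfolding P0_def P1_def using finP by (subst sum.union_disjoint[symmetric]) (auto intro!: sum.cong)
    have c: "real (card P0) / n ^ m = c N" using card_disjoint_tuples[OF ne, of N] by (simp add: P0_def P_def c_def m_def n_def)
    have cle: "real (card P0) / n ^ m \<le> 1"
    proof -
      have "(\<Prod>i<m. 6 * N - 3 * i) \<le> (\<Prod>i<m. 6 * N)" by (intro prod_mono) auto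
      then have "real (\<Prod>i<m. 6 * N - 3 * i) \<le> real ((6 * N) ^ m)" by (metis of_nat_le_iff prod_constant card_lessThan)
      then show ?thesis unfolding c c_def using N by (simp add: divide_le_eq)
    qed
    have each: "\<bar>contain_prob N (tuple_edges ps) - 1 / n ^ m\<bar> \<le> \<delta> / n ^ m" if ps: "ps \<in> P0" for ps
    proof -
      have dt: "disjoint_tuple ps" and pp: "ps \<in> potential_tuples N vs" using ps by (auto simp: P0_def P_def)
      note pd = potential_tuplesD[OF pp]
      have "card (halves ps) = 2 * m" using card_halves[OF dt] pd(6) by (simp add: m_def)
      moreover have "\<not> closes_face (side N) (halves ps) (pmap (tuple_edges ps))"
      proof (rule disjoint_tuple_not_closes_face[OF dt pd(4)])
        fix p assume "p \<in> set ps"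
        then have "map turn p \<in> set vs" using pd(1) by simp
        then show "L \<in> set (map turn p) \<and> R \<in> set (map turn p)" by (rule LR)
      qed
      ultimately have "\<bar>contain_prob N (tuple_edges ps) * n ^ m - 1\<bar> < \<delta>"
        using asymp[OF order_refl tuple_edges_matching[OF dt] pd(4)] by simp
      moreover have "contain_prob N (tuple_edges ps) - 1 / n ^ m = (contain_prob N (tuple_edges ps) * n ^ m - 1) / n ^ m"
        using n by (simp add: field_simps)
      ultimately show ?thesis using n by (simp add: divide_right_mono)
    qed
    have "\<bar>(\<Sum>ps\<in>P0. contain_prob N (tuple_edges ps)) - (\<Sum>ps\<in>P0. 1 / n ^ m)\<bar> \<le> (\<Sum>ps\<in>P0. \<delta> / n ^ m)"
      using each by (simp only: sum_subtractf[symmetric]) (rule order_trans[OF sum_abs sum_mono])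
    also have "\<dots> = \<delta> * (real (card P0) / n ^ m)" by simp
    also have "\<dots> \<le> \<delta> * 1" using cle \<delta> by (intro mult_left_mono) auto
    finally have main: "\<bar>(\<Sum>ps\<in>P0. contain_prob N (tuple_edges ps)) - c N\<bar> \<le> \<delta>" using c by simp
    have "(\<Sum>ps\<in>P1. contain_prob N (tuple_edges ps)) \<le> (\<Sum>ps\<in>P1. 2 / n ^ Suc (card (tri ` set (concat ps))))"
    proof (rule sum_mono)
      fix ps assume ps: "ps \<in> P1"
      show "contain_prob N (tuple_edges ps) \<le> 2 / n ^ Suc (card (tri ` set (concat ps)))"
        unfolding n_def
      proof (rule contain_prob_intersecting[OF N])
        show "ps \<in> potential_tuples N vs" "\<not> disjoint_tuple ps" using ps by (auto simp: P1_def P_def)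
        fix e D M assume "e \<le> length (concat vs)" "M \<in> matchings D" "D \<subseteq> {1..6 * N}" "card D = 2 * e"
        then show "contain_prob N M = 0 \<or> \<bar>contain_prob N M * real (6 * N) ^ e - 1\<bar> < 1"
          using asymp[of e M D] \<delta> by (auto simp: m_def n_def split: if_splits)
      qed
    qed
    also have "\<dots> \<le> (\<Sum>ps\<in>P. 2 / n ^ Suc (card (tri ` set (concat ps))))"
      using finP n by (intro sum_mono2) (auto simp: P1_def)
    also have "\<dots> = (\<Sum>k\<le>m. \<Sum>ps\<in>{ps \<in> P. card (tri ` set (concat ps)) = k}. 2 / n ^ Suc (card (tri ` set (concat ps))))"
    proof (rule sum.group[symmetric, OF finP])
      show "(\<lambda>ps. card (tri ` set (concat ps))) ` P \<subseteq> {..m}"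
      proof clarify
        fix ps assume "ps \<in> P"
        then have "length (concat ps) = m" using potential_tuplesD(6) by (simp add: P_def m_def)
        moreover have "card (tri ` set (concat ps)) \<le> card (set (concat ps))" by (rule card_image_le) simp
        ultimately show "card (tri ` set (concat ps)) \<le> m" using card_length[of "concat ps"] by simp
      qed
    qed simp
    also have "\<dots> \<le> (\<Sum>k\<le>m. 2 * real ((3 * k) ^ m) / n)"
    proof (rule sum_mono)
      fix k assume "k \<in> {..m}"
      have "(\<Sum>ps\<in>{ps \<in> P. card (tri ` set (concat ps)) = k}. 2 / n ^ Suc (card (tri ` set (concat ps))))
          = real (card {ps \<in> P. card (tri ` set (concat ps)) = k}) * (2 / n ^ Suc k)" by simp
      also have "\<dots> \<le> real ((6 * N) ^ k * (3 * k) ^ m) * (2 / n ^ Suc k)"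
        unfolding P_def m_def using card_tuples_with_triangles n by (intro mult_right_mono) (auto simp only: of_nat_le_iff, simp)
      also have "\<dots> = 2 * real ((3 * k) ^ m) / n" using n by (simp add: n_def)
      finally show "(\<Sum>ps\<in>{ps \<in> P. card (tri ` set (concat ps)) = k}. 2 / n ^ Suc (card (tri ` set (concat ps)))) \<le> 2 * real ((3 * k) ^ m) / n" .
    qed
    also have "\<dots> = K / n" by (simp add: K_def sum_divide_distrib)
    finally have err: "(\<Sum>ps\<in>P1. contain_prob N (tuple_edges ps)) \<le> K / n" .
    have "0 \<le> (\<Sum>ps\<in>P1. contain_prob N (tuple_edges ps))" by (intro sum_nonneg) (simp add: contain_prob_def)
    moreover have "\<bar>K / n\<bar> < \<epsilon> / 3" "\<bar>c N - 1\<bar> < \<epsilon> / 3"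
      using elim(2,3) by (simp_all only: dist_real_def n_def diff_0_right)
    ultimately have "\<bar>(\<Sum>ps\<in>P. contain_prob N (tuple_edges ps)) - 1\<bar> < \<epsilon>"
      using main err \<delta>(3) unfolding split by linarith
    then show ?case by (simp only: avg_word_tuples[OF N] dist_real_def P_def)
  qed
qed

section \<open>Poisson limit\<close>

lemma alternating_binomial_sum:
  "(\<Sum>r\<le>s. (-1) ^ r * real (Suc m choose r)) = (-1) ^ s * real (m choose s)"
  by (induction s) (auto simp: algebra_simps)

text \<open>Truncated inclusion-exclusion. Taking out C(x, k) leaves the alternating partial sum of
  the C(x - k, r). For x > k that sum is (-1)^s C(x - k - 1, s), which the first omitted term
  dominates.\<close>

lemma bonferroni:
  "\<bar>of_bool (x = k) - (\<Sum>r\<le>s. (-1) ^ r * real ((k + r) choose k) * real (x choose (k + r)))\<bar>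
    \<le> real ((k + Suc s) choose k) * real (x choose (k + Suc s))"
proof -
  have mult: "real ((k + r) choose k) * real (x choose (k + r)) = real (x choose k) * real ((x - k) choose r)" for r
  proof (cases "k + r \<le> x")
    case True
    then have "(x choose (k + r)) * ((k + r) choose k) = (x choose k) * ((x - k) choose (k + r - k))"
      by (intro choose_mult) auto
    then show ?thesis by (simp add: mult.commute flip: of_nat_mult)
  next
    case False
    then show ?thesis by (cases "k \<le> x") (auto simp: binomial_eq_0)
  qed
  have sum: "(\<Sum>r\<le>s. (-1) ^ r * real ((k + r) choose k) * real (x choose (k + r)))
      = real (x choose k) * (\<Sum>r\<le>s. (-1) ^ r * real ((x - k) choose r))"
    unfolding sum_distrib_left by (intro sum.cong refl) (simp only: mult.assoc mult, simp only: mult_ac)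
  consider "x < k" | "x = k" | m where "x = k + Suc m" by (metis less_imp_Suc_add linorder_neqE_nat add_Suc_right)
  then show ?thesis
  proof cases
    case 1 then show ?thesis unfolding sum by (simp add: binomial_eq_0)
  next
    case 2
    have "(\<Sum>r\<le>s. (-1) ^ r * real (0 choose r)) = (\<Sum>r\<in>{0}. (-1) ^ r * real (0 choose r))"
      by (intro sum.mono_neutral_right) (auto simp: binomial_eq_0)
    then show ?thesis unfolding sum using 2 by simp
  next
    case 3
    have "real (x choose k) * \<bar>(-1) ^ s * real (m choose s)\<bar> \<le> real (x choose k) * real (Suc m choose Suc s)"
      by (intro mult_left_mono) (auto simp: abs_mult power_abs)
    then show ?thesis
      unfolding sum mult using 3 by (simp add: alternating_binomial_sum abs_mult del: binomial_Suc_Suc)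
  qed
qed

section \<open>From binomial moments to point probabilities\<close>

lemma avg_sum: "avg N (\<lambda>w. \<Sum>i\<in>I. f i w) = (\<Sum>i\<in>I. avg N (f i))"
  unfolding avg_def by (subst sum.swap) (simp add: sum_divide_distrib)

lemma avg_cmult: "avg N (\<lambda>w. c * f w) = c * avg N f"
  by (simp add: avg_def sum_distrib_left)

lemma avg_diff: "avg N (\<lambda>w. f w - g w) = avg N f - avg N g"
  by (simp add: avg_def sum_subtractf diff_divide_distrib)

lemma avg_mono: "(\<And>w. w \<in> max_genus_gluings N \<Longrightarrow> f w \<le> g w) \<Longrightarrow> avg N f \<le> avg N g"
  unfolding avg_def by (intro divide_right_mono sum_mono) auto

lemma avg_cong: "(\<And>w. w \<in> max_genus_gluings N \<Longrightarrow> f w = g w) \<Longrightarrow> avg N f = avg N g"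
  unfolding avg_def by (metis (mono_tags, lifting) sum.cong)

lemma abs_avg_le: "\<bar>avg N f\<bar> \<le> avg N (\<lambda>w. \<bar>f w\<bar>)"
  unfolding avg_def by (simp add: abs_divide divide_right_mono sum_abs)

text \<open>A nonnegative weight \<open>Y\<close> makes the one-variable statement strong enough for induction over the variables.\<close>

lemma weighted_poisson_limit:
  fixes X :: "nat set set \<Rightarrow> nat" and Y :: "nat set set \<Rightarrow> real" and F :: "nat filter"
  assumes F: "F \<noteq> bot" and Y: "\<And>w. Y w \<ge> 0" and lam: "lam \<ge> 0"
    and lim: "\<And>r. ((\<lambda>N. avg N (\<lambda>w. Y w * real (X w choose r))) \<longlongrightarrow> y * (lam ^ r / fact r)) F"
  shows "((\<lambda>N. avg N (\<lambda>w. Y w * of_bool (X w = k))) \<longlongrightarrow> y * (lam ^ k / fact k * exp (- lam))) F"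
proof (rule tendstoI)
  fix \<epsilon> :: real assume \<epsilon>: "\<epsilon> > 0"
  define c where "c = y * lam ^ k / fact k"
  define S where "S s N = (\<Sum>r\<le>s. (-1) ^ r * real ((k + r) choose k) * avg N (\<lambda>w. Y w * real (X w choose (k + r))))" for s N
  define B where "B s N = real ((k + Suc s) choose k) * avg N (\<lambda>w. Y w * real (X w choose (k + Suc s)))" for s N
  \<comment> \<open>The binomial coefficient turns (k + r)! into k! r!, so the limits of the
    Bonferroni terms are c times the terms of an exponential series.\<close>
  have coeff: "real ((k + r) choose k) * (y * (lam ^ (k + r) / fact (k + r))) = c * (lam ^ r / fact r)" for r
    using binomial_fact[of k "k + r", where 'a = real] by (simp add: c_def power_add field_simps)
  have bound: "\<bar>avg N (\<lambda>w. Y w * of_bool (X w = k)) - S s N\<bar> \<le> B s N" for s N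
  proof -
    have eq: "avg N (\<lambda>w. Y w * of_bool (X w = k)) - S s N
        = avg N (\<lambda>w. Y w * (of_bool (X w = k) - (\<Sum>r\<le>s. (-1) ^ r * real ((k + r) choose k) * real (X w choose (k + r)))))"
      unfolding S_def avg_cmult[symmetric] avg_sum[symmetric] avg_diff[symmetric]
      by (intro arg_cong[where f = "avg N"] ext) (simp add: right_diff_distrib sum_distrib_left mult_ac)
    have "\<bar>avg N (\<lambda>w. Y w * of_bool (X w = k)) - S s N\<bar> \<le> avg N (\<lambda>w. \<bar>Y w * (of_bool (X w = k) - (\<Sum>r\<le>s. (-1) ^ r * real ((k + r) choose k) * real (X w choose (k + r))))\<bar>)"
      unfolding eq by (rule abs_avg_le)
    also have "\<dots> \<le> avg N (\<lambda>w. Y w * (real ((k + Suc s) choose k) * real (X w choose (k + Suc s))))"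
    proof (rule avg_mono)
      fix w
      show "\<bar>Y w * (of_bool (X w = k) - (\<Sum>r\<le>s. (-1) ^ r * real ((k + r) choose k) * real (X w choose (k + r))))\<bar>
        \<le> Y w * (real ((k + Suc s) choose k) * real (X w choose (k + Suc s)))"
        unfolding abs_mult abs_of_nonneg[OF Y] by (rule mult_left_mono[OF bonferroni Y])
    qed
    also have "\<dots> = B s N" unfolding B_def avg_cmult[symmetric] by (simp add: mult_ac)
    finally show ?thesis .
  qed
  have S_lim: "(S s \<longlongrightarrow> c * (\<Sum>r\<le>s. (- lam) ^ r / fact r)) F" for s
  proof -
    have "(S s \<longlongrightarrow> (\<Sum>r\<le>s. (-1) ^ r * real ((k + r) choose k) * (y * (lam ^ (k + r) / fact (k + r))))) F"
      unfolding S_def by (intro tendsto_sum tendsto_mult tendsto_const lim)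
    also have "(\<Sum>r\<le>s. (-1) ^ r * real ((k + r) choose k) * (y * (lam ^ (k + r) / fact (k + r)))) = c * (\<Sum>r\<le>s. (- lam) ^ r / fact r)"
      unfolding sum_distrib_left mult.assoc coeff by (intro sum.cong refl) (simp add: power_minus[of lam])
    finally show ?thesis .
  qed
  have B_lim: "(B s \<longlongrightarrow> c * (lam ^ Suc s / fact (Suc s))) F" for s
    unfolding B_def coeff[of "Suc s", symmetric] by (intro tendsto_mult tendsto_const lim)
  have "(\<lambda>s. (- lam) ^ s / fact s) sums exp (- lam)" using exp_converges[of "- lam"] by (simp add: divide_inverse mult.commute)
  then have "(\<lambda>s. \<Sum>r\<le>s. (- lam) ^ r / fact r) \<longlonglongrightarrow> exp (- lam)" by (simp add: sums_def_le)
  then have e1: "(\<lambda>s. c * (\<Sum>r\<le>s. (- lam) ^ r / fact r)) \<longlonglongrightarrow> c * exp (- lam)" by (intro tendsto_mult tendsto_const)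
  have "(\<lambda>s. lam ^ s / fact s) \<longlonglongrightarrow> 0" using summable_LIMSEQ_zero[OF summable_exp[of lam]] by (simp add: divide_inverse mult.commute)
  then have "(\<lambda>s. c * (lam ^ Suc s / fact (Suc s))) \<longlonglongrightarrow> c * 0" by (intro tendsto_mult tendsto_const) (rule LIMSEQ_Suc)
  then have e2: "(\<lambda>s. c * (lam ^ Suc s / fact (Suc s))) \<longlonglongrightarrow> 0" by simp
  \<comment> \<open>The truncation s is chosen before N: it makes both the tail of the exponential
    series and the Bonferroni remainder small, and then only finitely many moments have to
    converge.\<close>
  have "\<forall>\<^sub>F s in sequentially. \<bar>c * (\<Sum>r\<le>s. (- lam) ^ r / fact r) - c * exp (- lam)\<bar> < \<epsilon> / 4 \<and> c * (lam ^ Suc s / fact (Suc s)) < \<epsilon> / 4"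
    using tendstoD[OF e1, of "\<epsilon> / 4"] order_tendstoD(2)[OF e2, of "\<epsilon> / 4"] \<epsilon> by (auto simp: dist_real_def eventually_conj_iff)
  then obtain s where s: "\<bar>c * (\<Sum>r\<le>s. (- lam) ^ r / fact r) - c * exp (- lam)\<bar> < \<epsilon> / 4" "c * (lam ^ Suc s / fact (Suc s)) < \<epsilon> / 4"
    using eventually_happens'[OF sequentially_bot] by blast
  have "\<forall>\<^sub>F N in F. dist (S s N) (c * (\<Sum>r\<le>s. (- lam) ^ r / fact r)) < \<epsilon> / 4" using \<epsilon> by (intro tendstoD[OF S_lim]) simp
  moreover have "\<forall>\<^sub>F N in F. B s N < \<epsilon> / 4" using order_tendstoD(2)[OF B_lim s(2)] .
  ultimately show "\<forall>\<^sub>F N in F. dist (avg N (\<lambda>w. Y w * of_bool (X w = k))) (y * (lam ^ k / fact k * exp (- lam))) < \<epsilon>"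
  proof eventually_elim
    case (elim N)
    have "y * (lam ^ k / fact k * exp (- lam)) = c * exp (- lam)" by (simp add: c_def)
    moreover have "\<bar>S s N - c * (\<Sum>r\<le>s. (- lam) ^ r / fact r)\<bar> < \<epsilon> / 4" using elim(1) by (simp add: dist_real_def)
    ultimately show ?case unfolding dist_real_def using bound[of N s] elim(2) s(1) \<epsilon> by linarith
  qed
qed

lemma joint_poisson_limit:
  fixes X :: "'i \<Rightarrow> nat set set \<Rightarrow> nat" and F :: "nat filter"
  assumes F: "F \<noteq> bot" and W: "finite W" and lam: "\<And>A. A \<in> W \<Longrightarrow> lam A \<ge> 0"
    and lim: "\<And>r. ((\<lambda>N. avg N (\<lambda>w. \<Prod>A\<in>W. real (X A w choose r A))) \<longlongrightarrow> (\<Prod>A\<in>W. lam A ^ r A / fact (r A))) F"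
  shows "((\<lambda>N. avg N (\<lambda>w. \<Prod>A\<in>W. of_bool (X A w = k A))) \<longlongrightarrow> (\<Prod>A\<in>W. lam A ^ k A / fact (k A) * exp (- lam A))) F"
proof -
  \<comment> \<open>V holds the variables already converted to indicators; the others still enter
    through binomial coefficients. Apart from the variable A being converted, all of them together
    act as the weight Y.\<close>
  have "((\<lambda>N. avg N (\<lambda>w. (\<Prod>A\<in>V. of_bool (X A w = k A)) * (\<Prod>A\<in>W - V. real (X A w choose r A))))
      \<longlongrightarrow> (\<Prod>A\<in>V. lam A ^ k A / fact (k A) * exp (- lam A)) * (\<Prod>A\<in>W - V. lam A ^ r A / fact (r A))) F"
    if "V \<subseteq> W" for V r
    using finite_subset[OF that W] that
  proof (induction V arbitrary: r rule: finite_induct)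
    case empty
    then show ?case using lim by simp
  next
    case (insert A V)
    have A: "A \<in> W - V" "A \<in> W" using insert by auto
    have WV: "W - insert A V = (W - V) - {A}" by auto
    define Y where "Y w = (\<Prod>A\<in>V. of_bool (X A w = k A)) * (\<Prod>A\<in>W - insert A V. real (X A w choose r A))" for w
    define y where "y = (\<Prod>A\<in>V. lam A ^ k A / fact (k A) * exp (- lam A)) * (\<Prod>A\<in>W - insert A V. lam A ^ r A / fact (r A))"
    have upd: "(\<Prod>B\<in>W - V. f B ((r(A := j)) B)) = f A j * (\<Prod>B\<in>W - insert A V. f B (r B))" for j and f :: "'i \<Rightarrow> nat \<Rightarrow> real"
    proof -
      have "(\<Prod>B\<in>W - V. f B ((r(A := j)) B)) = f A j * (\<Prod>B\<in>(W - V) - {A}. f B ((r(A := j)) B))"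
        using A W by (subst prod.remove[of _ A]) auto
      also have "(\<Prod>B\<in>(W - V) - {A}. f B ((r(A := j)) B)) = (\<Prod>B\<in>W - insert A V. f B (r B))"
        unfolding WV by (intro prod.cong) auto
      finally show ?thesis .
    qed
    \<comment> \<open>Converting A needs all its moments j at once, so the induction hypothesis is
      used with r changed at A.\<close>
    have "((\<lambda>N. avg N (\<lambda>w. Y w * real (X A w choose j))) \<longlongrightarrow> y * (lam A ^ j / fact j)) F" for j
      using insert.IH[of "r(A := j)"] insert.prems
      unfolding upd[of "\<lambda>B i. lam B ^ i / fact i"] upd[of "\<lambda>B i. real (X B _ choose i)"]
      by (simp add: Y_def y_def mult_ac)
    then have "((\<lambda>N. avg N (\<lambda>w. Y w * of_bool (X A w = k A))) \<longlongrightarrow> y * (lam A ^ k A / fact (k A) * exp (- lam A))) F"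
      by (intro weighted_poisson_limit[OF F]) (auto simp: Y_def lam A intro!: mult_nonneg_nonneg prod_nonneg)
    then show ?case
      using insert.hyps by (simp add: Y_def y_def mult_ac)
  qed
  from this[of W] show ?thesis by simp
qed

lemma odd_numbers_neq_bot: "odd_numbers \<noteq> bot"
proof
  assume "odd_numbers = bot"
  then have "\<forall>\<^sub>F N in sequentially. odd N \<longrightarrow> False" using eventually_odd_numbers[of "\<lambda>_. False"] by simp
  then have "\<exists>M::nat. \<forall>N\<ge>M. odd N \<longrightarrow> False" by (simp only: eventually_sequentially)
  then obtain M :: nat where M: "\<forall>N\<ge>M. odd N \<longrightarrow> False" ..
  have "even M" "even (Suc M)" using M[rule_format, of M] M[rule_format, of "Suc M"] by auto
  then show False by simp
qed

section \<open>Factorial moments of the circuit counts\<close>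

lemma finite_max_genus_gluings:
  assumes "N \<ge> 1"
  shows "finite (max_genus_gluings N)"
proof (rule finite_subset)
  show "max_genus_gluings N \<subseteq> Pow (Pow {1..6 * N})" using max_genus_gluings_iff[OF assms] matchings_Union by blast
qed simp

text \<open>The recursion of falling factorials with real subtraction; both sides vanish for c \<ge>
  z.\<close>

lemma fact_binomial_Suc: "fact (Suc c) * real (z choose Suc c) = (real z - real c) * (fact c * real (z choose c))"
proof -
  have "Suc c * (z choose Suc c) = (z - c) * (z choose c)" by (metis binomial_absorption binomial_absorb_comp)
  then have "real (Suc c) * real (z choose Suc c) = real (z - c) * real (z choose c)" by (metis of_nat_mult)
  also have "\<dots> = (real z - real c) * real (z choose c)" by (cases "c \<le> z") (auto simp: of_nat_diff binomial_eq_0)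
  finally show ?thesis by (simp add: mult_ac)
qed

lemma prod_count_list_Cons:
  assumes "finite W" "A \<in> W"
  shows "(\<Prod>B\<in>W. f B (count_list (A # As) B)) = f A (Suc (count_list As A)) * (\<Prod>B\<in>W - {A}. f B (count_list As B))"
    "(\<Prod>B\<in>W. f B (count_list As B)) = f A (count_list As A) * (\<Prod>B\<in>W - {A}. f B (count_list As B))"
proof -
  have "(\<Prod>B\<in>W - {A}. f B (count_list (A # As) B)) = (\<Prod>B\<in>W - {A}. f B (count_list As B))"
    by (intro prod.cong) auto
  then show "(\<Prod>B\<in>W. f B (count_list (A # As) B)) = f A (Suc (count_list As A)) * (\<Prod>B\<in>W - {A}. f B (count_list As B))"
    using assms by (simp add: prod.remove[of W A])
qed (use assms in \<open>simp add: prod.remove[of W A]\<close>)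

text \<open>Each further occurrence of A in the list contributes the next factor of the falling
  factorial of \<open>Z A w\<close>.\<close>

lemma card_carrying_tuples_prod:
  assumes w: "w \<in> matchings {1..n}" and W: "finite W" "W \<subseteq> word_classes" and As: "set As \<subseteq> W"
  shows "real (card (carrying_tuples As w))
    = (\<Prod>A\<in>W. (2 * real (class_length A)) ^ count_list As A * (fact (count_list As A) * real (Z A w choose count_list As A)))"
  using As
proof (induction As)
  case Nil
  have "carrying_tuples [] w = {[]}" by (auto simp: carrying_tuples_def)
  then show ?case by simp
next
  case (Cons A As)
  have A: "A \<in> W" "A \<in> word_classes" "set As \<subseteq> word_classes" using Cons.prems W by auto
  define f where "f B c = (2 * real (class_length B)) ^ c * (fact c * real (Z B w choose c))" for B c
  have "f A (Suc c) = 2 * real (class_length A) * (real (Z A w) - real c) * f A c" for c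
  proof -
    have "f A (Suc c) = 2 * real (class_length A) * (2 * real (class_length A)) ^ c * (fact (Suc c) * real (Z A w choose Suc c))"
      unfolding f_def by (simp only: power_Suc mult.assoc)
    also have "\<dots> = 2 * real (class_length A) * (real (Z A w) - real c) * f A c"
      unfolding fact_binomial_Suc by (simp add: f_def)
    finally show ?thesis .
  qed
  then show ?case
    unfolding card_carrying_tuples_Cons[OF w A(2,3)] using Cons
    unfolding f_def[symmetric] prod_count_list_Cons(1)[OF W(1) A(1), of f] prod_count_list_Cons(2)[OF W(1) A(1), of f]
    by (simp add: mult_ac)
qed

text \<open>Turns a vector r of exponents into a list of classes over which tuples can be
  formed.\<close>

lemma ex_list_with_counts:
  assumes "finite W"
  shows "\<exists>As. set As \<subseteq> W \<and> (\<forall>A\<in>W. count_list As A = r A)"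
  using assms
proof (induction W rule: finite_induct)
  case (insert A W)
  then obtain As where As: "set As \<subseteq> W" "\<forall>A\<in>W. count_list As A = r A" by blast
  have "count_list (replicate n A) B = (if A = B then n else 0)" for n B by (induction n) auto
  moreover have "count_list As A = 0" using As(1) insert.hyps(2) by (auto simp: count_list_0_iff)
  ultimately show ?case using As insert.hyps by (intro exI[of _ "replicate (r A) A @ As"]) auto
qed simp

lemma prod_list_count:
  assumes "finite W" "set As \<subseteq> W"
  shows "real (prod_list (map card As)) = (\<Prod>A\<in>W. real (card A) ^ count_list As A)"
  using assms(2)
proof (induction As)
  case (Cons A As)
  then have A: "A \<in> W" by simp
  show ?case
    using Cons unfolding prod_count_list_Cons(1)[OF assms(1) A, of "\<lambda>A c. real (card A) ^ c"]
      prod_count_list_Cons(2)[OF assms(1) A, of "\<lambda>A c. real (card A) ^ c"] by simp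
qed simp

text \<open>A word using one letter only is L^n or R^n, and R^n is the star of L^n, so excluding one
  class excludes both.\<close>

lemma both_letters:
  assumes A: "A \<in> word_classes" "v \<in> A" and no_L: "\<And>n. n \<ge> 1 \<Longrightarrow> word_class (replicate n L) \<noteq> A"
  shows "L \<in> set v \<and> R \<in> set v"
proof (rule ccontr)
  assume neg: "\<not> ?thesis"
  define n where "n = length v"
  have n: "n \<ge> 1" using word_classesD(3)[OF A] by (cases v) (auto simp: n_def)
  have "v = replicate n L \<or> v = replicate n R"
  proof (cases "R \<in> set v")
    case True
    then have "\<forall>x\<in>set v. x = R" using neg letter.exhaust by metis
    then show ?thesis by (simp add: n_def replicate_eqI)
  next
    case False
    then have "\<forall>x\<in>set v. x = L" using letter.exhaust by metis
    then show ?thesis by (simp add: n_def replicate_eqI)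
  qed
  moreover have "word_star (replicate n L) = replicate n R" by (simp add: word_star_def)
  then have "replicate n R \<in> word_class (replicate n L)" unfolding word_class_def by (intro CollectI exI[of _ 0]) simp
  moreover have "replicate n L \<in> word_class (replicate n L)" by (rule word_class_self)
  ultimately have "v \<in> word_class (replicate n L)" by auto
  then have "word_class v = word_class (replicate n L)" by (rule word_class_eq)
  then show False using word_classesD(1)[OF A] no_L[OF n] by simp
qed

lemma class_mean_pos:
  assumes "A \<in> word_classes"
  shows "class_mean A > 0"
proof -
  obtain v where v: "v \<in> A" using word_classes_nonempty[OF assms] by blast
  have "class_length A > 0" using word_classesD(2,3)[OF assms v] by (metis length_greater_0_conv)
  moreover have "card A > 0" using v finite_word_class[OF assms] by (auto simp: card_gt_0_iff)
  ultimately show ?thesis by (simp add: class_mean_def class_length_def)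
qed

text \<open>Each choice of words for the listed classes contributes 1 in the limit. The moment thus
  tends to the number of such choices divided by q, and |A|^r / ((2 l)^r r!) is the r-th power of
  the mean divided by r!, with l the word length.\<close>

lemma joint_binomial_moments:
  assumes W: "finite W" "W \<subseteq> word_classes" and no_L: "\<And>n. n \<ge> 1 \<Longrightarrow> word_class (replicate n L) \<notin> W"
  shows "((\<lambda>N. avg N (\<lambda>w. \<Prod>A\<in>W. real (Z A w choose r A))) \<longlongrightarrow> (\<Prod>A\<in>W. class_mean A ^ r A / fact (r A))) odd_numbers"
proof -
  obtain As where As: "set As \<subseteq> W" "\<And>A. A \<in> W \<Longrightarrow> count_list As A = r A" using ex_list_with_counts[OF W(1)] by blast
  have Asw: "set As \<subseteq> word_classes" using As W by blast
  have finA: "finite A" if "A \<in> set As" for A using that Asw finite_word_class by blast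
  \<comment> \<open>The factor between products of binomial coefficients and ordered tuples of paths
    with base point and direction.\<close>
  define q where "q = (\<Prod>A\<in>W. (2 * real (class_length A)) ^ r A * fact (r A))"
  have lenpos: "class_length A > 0" if "A \<in> W" for A
  proof -
    have A: "A \<in> word_classes" using that W by blast
    obtain v where v: "v \<in> A" using word_classes_nonempty[OF A] by blast
    show ?thesis using word_classesD(2,3)[OF A v] by (metis length_greater_0_conv)
  qed
  have q: "q \<noteq> 0" using W(1) lenpos by (auto simp: q_def)
  have ev: "\<forall>\<^sub>F N in odd_numbers. avg N (\<lambda>w. \<Prod>A\<in>W. real (Z A w choose r A))
      = (\<Sum>vs\<in>choices As. avg N (\<lambda>w. real (card (word_tuples vs w)))) / q"
    unfolding eventually_odd_numbers
  proof (rule eventually_mono[OF eventually_ge_at_top[of 1]], intro impI)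
    fix N :: nat assume N: "1 \<le> N"
    have "avg N (\<lambda>w. q * (\<Prod>A\<in>W. real (Z A w choose r A))) = avg N (\<lambda>w. \<Sum>vs\<in>choices As. real (card (word_tuples vs w)))"
    proof (rule avg_cong)
      fix w assume "w \<in> max_genus_gluings N"
      then have w: "w \<in> matchings {1..6 * N}" using max_genus_gluings_iff[OF N] by blast
      have "q * (\<Prod>A\<in>W. real (Z A w choose r A)) = real (card (carrying_tuples As w))"
        unfolding card_carrying_tuples_prod[OF w W As(1)] q_def prod.distrib[symmetric]
        by (intro prod.cong refl) (simp add: As(2))
      also have "\<dots> = (\<Sum>vs\<in>choices As. real (card (word_tuples vs w)))"
        using card_carrying_tuples[OF w Asw] by simp
      finally show "q * (\<Prod>A\<in>W. real (Z A w choose r A)) = (\<Sum>vs\<in>choices As. real (card (word_tuples vs w)))" .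
    qed
    then have "q * avg N (\<lambda>w. \<Prod>A\<in>W. real (Z A w choose r A)) = (\<Sum>vs\<in>choices As. avg N (\<lambda>w. real (card (word_tuples vs w))))"
      by (simp only: avg_cmult avg_sum)
    then show "avg N (\<lambda>w. \<Prod>A\<in>W. real (Z A w choose r A)) = (\<Sum>vs\<in>choices As. avg N (\<lambda>w. real (card (word_tuples vs w)))) / q"
      using q by (simp add: field_simps)
  qed
  have "((\<lambda>N. (\<Sum>vs\<in>choices As. avg N (\<lambda>w. real (card (word_tuples vs w)))) / q) \<longlongrightarrow> (\<Sum>vs\<in>choices As. 1) / q) odd_numbers"
  proof (intro tendsto_divide tendsto_sum tendsto_const q avg_word_tuples_tendsto)
    fix vs v assume vs: "vs \<in> choices As" and v: "v \<in> set vs"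
    then obtain A where A: "A \<in> set As" "v \<in> A" by (auto simp: choices_def list_all2_conv_all_nth in_set_conv_nth) (metis nth_mem)
    have "A \<in> W" "A \<in> word_classes" using A As(1) Asw by auto
    then show "L \<in> set v \<and> R \<in> set v" using no_L by (intro both_letters[OF _ A(2)]) auto
  qed
  also have "(\<Sum>vs\<in>choices As. 1) / q = (\<Prod>A\<in>W. class_mean A ^ r A / fact (r A))"
  proof -
    have "(\<Sum>vs\<in>choices As. 1) = real (prod_list (map card As))" using choices_card(2)[OF finA] by simp
    also have "\<dots> = (\<Prod>A\<in>W. real (card A) ^ r A)"
      unfolding prod_list_count[OF W(1) As(1)] using As(2) by (intro prod.cong) auto
    finally have "(\<Sum>vs\<in>choices As. 1) / q = (\<Prod>A\<in>W. real (card A) ^ r A / ((2 * real (class_length A)) ^ r A * fact (r A)))"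
      by (simp add: q_def prod_dividef)
    also have "\<dots> = (\<Prod>A\<in>W. class_mean A ^ r A / fact (r A))"
      by (intro prod.cong refl) (simp add: class_mean_def class_length_def power_divide)
    finally show ?thesis .
  qed
  finally show ?thesis by (rule tendsto_cong[OF ev, THEN iffD2])
qed

lemma joint_poisson_mass:
  fixes W :: "letter list set set" and M :: "'b measure" and Zlim :: "letter list set \<Rightarrow> 'b \<Rightarrow> nat"
  assumes W: "finite W" "W \<subseteq> word_classes" and M: "prob_space M"
    and indep: "prob_space.indep_vars M (\<lambda>_. count_space UNIV) Zlim W"
    and dist: "\<And>A. A \<in> W \<Longrightarrow> distr M (count_space UNIV) (Zlim A) = measure_pmf (poisson_pmf (class_mean A))"
  shows "{x \<in> space M. \<forall>A\<in>W. Zlim A x = k A} \<in> sets M"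
    "measure M {x \<in> space M. \<forall>A\<in>W. Zlim A x = k A} = (\<Prod>A\<in>W. class_mean A ^ k A / fact (k A) * exp (- class_mean A))"
proof -
  interpret prob_space M by (rule M)
  have rv: "Zlim A \<in> measurable M (count_space UNIV)" if "A \<in> W" for A
    using indep that by (auto simp: indep_vars_def)
  show "{x \<in> space M. \<forall>A\<in>W. Zlim A x = k A} \<in> sets M"
  proof (rule sets.sets_Collect_finite_All[OF _ W(1)])
    fix A assume "A \<in> W"
    then have "Zlim A -` {k A} \<inter> space M \<in> sets M" using rv by (intro measurable_sets) auto
    also have "Zlim A -` {k A} \<inter> space M = {x \<in> space M. Zlim A x = k A}" by auto
    finally show "{x \<in> space M. Zlim A x = k A} \<in> sets M" .
  qed
  show "measure M {x \<in> space M. \<forall>A\<in>W. Zlim A x = k A} = (\<Prod>A\<in>W. class_mean A ^ k A / fact (k A) * exp (- class_mean A))"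
  \<comment> \<open>The intersection over W and the product rule for independent variables need W
    nonempty; for empty W the event is the whole space.\<close>
  proof (cases "W = {}")
    case True
    then show ?thesis by (simp add: prob_space)
  next
    case False
    have "{x \<in> space M. \<forall>A\<in>W. Zlim A x = k A} = (\<Inter>A\<in>W. Zlim A -` {k A} \<inter> space M)" using False by auto
    then have "measure M {x \<in> space M. \<forall>A\<in>W. Zlim A x = k A} = (\<Prod>A\<in>W. measure M (Zlim A -` {k A} \<inter> space M))"
      using indep_varsD_finite[OF indep False W(1), of "\<lambda>A. {k A}"] by simp
    also have "\<dots> = (\<Prod>A\<in>W. class_mean A ^ k A / fact (k A) * exp (- class_mean A))"
    proof (rule prod.cong[OF refl])
      fix A assume A: "A \<in> W"
      have "measure M (Zlim A -` {k A} \<inter> space M) = measure (distr M (count_space UNIV) (Zlim A)) {k A}"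
        using rv[OF A] by (simp add: measure_distr)
      also have "\<dots> = pmf (poisson_pmf (class_mean A)) (k A)" unfolding dist[OF A] by (simp add: measure_pmf_single)
      also have "\<dots> = class_mean A ^ k A / fact (k A) * exp (- class_mean A)"
        using class_mean_pos[of A] A W by (intro pmf_poisson) auto
      finally show "measure M (Zlim A -` {k A} \<inter> space M) = class_mean A ^ k A / fact (k A) * exp (- class_mean A)" .
    qed
    finally show ?thesis .
  qed
qed

text \<open>The sum over a box is the integral of f cut off outside that box. The cut-off functions
  converge pointwise and are dominated by B, and measurability of the limit is inherited from
  them.\<close>

lemma integral_as_limit:
  fixes W :: "'i set" and X :: "'i \<Rightarrow> 'b \<Rightarrow> nat" and f :: "('i \<Rightarrow> nat) \<Rightarrow> real"
  assumes M: "prob_space M" and W: "finite W"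
    and sets: "\<And>k. {x \<in> space M. \<forall>A\<in>W. X A x = k A} \<in> sets M"
    and bd: "\<And>k. \<bar>f k\<bar> \<le> B"
  shows "(\<lambda>n. \<Sum>k\<in>PiE W (\<lambda>_. {..n}). f k * measure M {x \<in> space M. \<forall>A\<in>W. X A x = k A})
    \<longlonglongrightarrow> (\<integral>x. f (\<lambda>A\<in>W. X A x) \<partial>M)"
proof -
  interpret prob_space M by (rule M)
  define E where "E k = {x \<in> space M. \<forall>A\<in>W. X A x = k A}" for k
  define K where "K n = PiE W (\<lambda>_. {..n :: nat})" for n
  define g where "g n x = (\<Sum>k\<in>K n. f k * indicator (E k) x)" for n x
  have finK: "finite (K n)" for n using W by (simp add: K_def finite_PiE)
  have E: "x \<in> E k \<longleftrightarrow> k = (\<lambda>A\<in>W. X A x)" if "x \<in> space M" "k \<in> K n" for x k n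
  proof -
    have "k A = undefined" if "A \<notin> W" for A using \<open>k \<in> K n\<close> that by (auto simp: K_def PiE_def extensional_def)
    then show ?thesis using that(1) by (auto simp: E_def fun_eq_iff restrict_def)
  qed
  have g: "g n x = (if (\<lambda>A\<in>W. X A x) \<in> K n then f (\<lambda>A\<in>W. X A x) else 0)" if "x \<in> space M" for n x
  proof -
    have "g n x = (\<Sum>k\<in>K n. if k = (\<lambda>A\<in>W. X A x) then f (\<lambda>A\<in>W. X A x) else 0)"
      unfolding g_def using E[OF that] by (intro sum.cong refl) (auto simp: indicator_def)
    then show ?thesis using finK by simp
  qed
  have lim: "(\<lambda>n. g n x) \<longlonglongrightarrow> f (\<lambda>A\<in>W. X A x)" if x: "x \<in> space M" for x
  proof (rule tendsto_eventually)
    \<comment> \<open>The sum of the values bounds each of them, so every box from n0 on contains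
      the point.\<close>
    define n0 where "n0 = (\<Sum>A\<in>W. X A x)"
    have "(\<lambda>A\<in>W. X A x) \<in> K n" if "n0 \<le> n" for n
      using that member_le_sum[of _ W "\<lambda>A. X A x"] W by (fastforce simp: K_def n0_def)
    then show "\<forall>\<^sub>F n in sequentially. g n x = f (\<lambda>A\<in>W. X A x)"
      using g[OF x] by (intro eventually_sequentiallyI[of n0]) simp
  qed
  have gm: "g n \<in> borel_measurable M" for n
    unfolding g_def using sets by (intro borel_measurable_sum borel_measurable_times borel_measurable_const borel_measurable_indicator) (simp add: E_def)
  have fm: "(\<lambda>x. f (\<lambda>A\<in>W. X A x)) \<in> borel_measurable M"
    by (rule borel_measurable_LIMSEQ_real[OF lim gm])
  have B0: "0 \<le> B" using bd[of undefined] by linarith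
  have "(\<lambda>n. \<integral>x. g n x \<partial>M) \<longlonglongrightarrow> (\<integral>x. f (\<lambda>A\<in>W. X A x) \<partial>M)"
  proof (rule integral_dominated_convergence[where w = "\<lambda>_. B"])
    show "AE x in M. (\<lambda>n. g n x) \<longlonglongrightarrow> f (\<lambda>A\<in>W. X A x)" using lim by (intro AE_I2)
    show "AE x in M. norm (g n x) \<le> B" for n using g bd B0 by (intro AE_I2) simp
  qed (use gm fm in auto)
  moreover have "(\<integral>x. g n x \<partial>M) = (\<Sum>k\<in>K n. f k * measure M (E k))" for n
  proof -
    have "integrable M (\<lambda>x. f k * indicator (E k) x)" for k
      using sets[of k] by (intro integrable_mult_right integrable_real_indicator) (auto simp: E_def emeasure_eq_measure)
    then have "(\<integral>x. g n x \<partial>M) = (\<Sum>k\<in>K n. \<integral>x. f k * indicator (E k) x \<partial>M)"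
      unfolding g_def by (intro Bochner_Integration.integral_sum)
    also have "\<dots> = (\<Sum>k\<in>K n. f k * measure M (E k))"
      using sets by (intro sum.cong refl) (simp add: E_def Int_absorb1 sets.sets_into_space)
    finally show ?thesis .
  qed
  ultimately show ?thesis by (simp add: E_def K_def)
qed

text \<open>Point masses converge on every finite box. As the limit masses add up to 1, a large box
  carries nearly all mass of the limit and hence, for large odd N, of the circuit counts, so no mass
  escapes to infinity.\<close>

theorem theoremB:
  fixes W :: "letter list set set"
    and M :: "'b measure"
    and Zlim :: "letter list set \<Rightarrow> 'b \<Rightarrow> nat"
  assumes "finite W"
    and "W \<subseteq> word_classes"
    and "\<And>n. n \<ge> 1 \<Longrightarrow> word_class (replicate n L) \<notin> W"
    and "prob_space M"
    and "prob_space.indep_vars M (\<lambda>_. count_space UNIV) Zlim W"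
    and "\<And>A. A \<in> W \<Longrightarrow>
           distr M (count_space UNIV) (Zlim A) = measure_pmf (poisson_pmf (class_mean A))"
  shows "conv_in_distribution
           (\<lambda>N. uniform_count_measure (max_genus_gluings N))
           (\<lambda>N \<omega>. \<lambda>A\<in>W. Z A \<omega>)
           M (\<lambda>x. \<lambda>A\<in>W. Zlim A x)
           (inf sequentially (principal {N. odd N}))"
  unfolding conv_in_distribution_def odd_numbers_def[symmetric]
proof (intro allI impI)
  fix f :: "(letter list set \<Rightarrow> nat) \<Rightarrow> real"
  assume "continuous_on UNIV f \<and> bounded (range f)"
  then obtain B where B: "\<And>k. \<bar>f k\<bar> \<le> B" by (auto simp: bounded_iff)
  have B0: "0 \<le> B" using B[of undefined] by linarith
  define q where "q k = (\<Prod>A\<in>W. class_mean A ^ k A / fact (k A) * exp (- class_mean A))" for k :: "letter list set \<Rightarrow> nat"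
  define K where "K n = PiE W (\<lambda>_. {..n :: nat})" for n
  define T where "T w = (\<lambda>A\<in>W. Z A w)" for w
  have finK: "finite (K n)" for n using assms(1) by (simp add: K_def finite_PiE)
  note mass = joint_poisson_mass[OF assms(1,2,4,5,6)]
  have lim_f: "(\<lambda>n. \<Sum>k\<in>K n. f k * q k) \<longlonglongrightarrow> (\<integral>x. f (\<lambda>A\<in>W. Zlim A x) \<partial>M)"
    using integral_as_limit[OF assms(4,1) mass(1) B] by (simp add: mass(2) K_def q_def)
  \<comment> \<open>The constant function 1 in \<open>integral_as_limit\<close> shows that the limit
    masses add up to 1.\<close>
  have lim_1: "(\<lambda>n. \<Sum>k\<in>K n. q k) \<longlonglongrightarrow> 1"
    using integral_as_limit[OF assms(4,1) mass(1), of "\<lambda>_. 1" 1] prob_space.prob_space[OF assms(4)]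
    by (simp add: mass(2) K_def q_def)
  have lim_q: "((\<lambda>N. avg N (\<lambda>w. of_bool (T w = k))) \<longlongrightarrow> q k) odd_numbers" if k: "k \<in> K n" for k n
  proof -
    have "of_bool (T w = k) = (\<Prod>A\<in>W. of_bool (Z A w = k A) :: real)" for w
    proof -
      have "k A = undefined" if "A \<notin> W" for A using k that by (auto simp: K_def PiE_def extensional_def)
      then have "T w = k \<longleftrightarrow> (\<forall>A\<in>W. Z A w = k A)" by (auto simp: T_def fun_eq_iff restrict_def)
      then show ?thesis using assms(1) by (auto simp: of_bool_def prod_zero_iff)
    qed
    moreover have "((\<lambda>N. avg N (\<lambda>w. \<Prod>A\<in>W. of_bool (Z A w = k A))) \<longlongrightarrow> q k) odd_numbers"
      unfolding q_def
      by (intro joint_poisson_limit[OF odd_numbers_neq_bot assms(1)] joint_binomial_moments assms(1,2,3))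
        (use class_mean_pos assms(2) in \<open>auto intro: less_imp_le\<close>)
    ultimately show ?thesis by simp
  qed
  have "((\<lambda>N. avg N (\<lambda>w. f (T w))) \<longlongrightarrow> (\<integral>x. f (\<lambda>A\<in>W. Zlim A x) \<partial>M)) odd_numbers"
  proof (rule tendstoI)
    fix \<epsilon> :: real assume \<epsilon>: "\<epsilon> > 0"
    \<comment> \<open>B + 1 instead of B keeps the denominator positive when B is 0.\<close>
    define \<delta> where "\<delta> = \<epsilon> / (4 * (B + 1))"
    have \<delta>: "\<delta> > 0" "B * \<delta> \<le> \<epsilon> / 4" using \<epsilon> B0 by (auto simp: \<delta>_def field_simps)
    have "\<forall>\<^sub>F n in sequentially. dist (\<Sum>k\<in>K n. f k * q k) (\<integral>x. f (\<lambda>A\<in>W. Zlim A x) \<partial>M) < \<epsilon> / 4 \<and> dist (\<Sum>k\<in>K n. q k) 1 < \<delta>"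
      using tendstoD[OF lim_f, of "\<epsilon> / 4"] tendstoD[OF lim_1 \<delta>(1)] \<epsilon> by (simp add: eventually_conj_iff)
    then obtain n where n: "\<bar>(\<Sum>k\<in>K n. f k * q k) - (\<integral>x. f (\<lambda>A\<in>W. Zlim A x) \<partial>M)\<bar> < \<epsilon> / 4" "\<bar>(\<Sum>k\<in>K n. q k) - 1\<bar> < \<delta>"
      using eventually_happens'[OF sequentially_bot] by (fastforce simp: dist_real_def)
    define s where "s N = (\<Sum>k\<in>K n. f k * avg N (\<lambda>w. of_bool (T w = k)))" for N
    define t where "t N = (\<Sum>k\<in>K n. avg N (\<lambda>w. of_bool (T w = k)))" for N
    have "(s \<longlongrightarrow> (\<Sum>k\<in>K n. f k * q k)) odd_numbers" unfolding s_def by (intro tendsto_sum tendsto_mult tendsto_const lim_q)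
    then have ev_s: "\<forall>\<^sub>F N in odd_numbers. dist (s N) (\<Sum>k\<in>K n. f k * q k) < \<epsilon> / 4" using \<epsilon> by (intro tendstoD) auto
    have "(t \<longlongrightarrow> (\<Sum>k\<in>K n. q k)) odd_numbers" unfolding t_def by (intro tendsto_sum lim_q)
    then have "((\<lambda>N. B * (1 - t N)) \<longlongrightarrow> B * (1 - (\<Sum>k\<in>K n. q k))) odd_numbers" by (intro tendsto_intros)
    moreover have "B * (1 - (\<Sum>k\<in>K n. q k)) < \<epsilon> / 2"
    proof -
      have "B * (1 - (\<Sum>k\<in>K n. q k)) \<le> B * \<delta>" using n(2) B0 by (intro mult_left_mono) auto
      then show ?thesis using \<delta>(2) \<epsilon> by linarith
    qed
    ultimately have ev_t: "\<forall>\<^sub>F N in odd_numbers. B * (1 - t N) < \<epsilon> / 2" by (rule order_tendstoD(2))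
    have ev_c: "\<forall>\<^sub>F N in odd_numbers. 0 < card (max_genus_gluings N)"
      using eventually_mono[OF contain_prob_asymptotics[of 1 0]] by fastforce
    show "\<forall>\<^sub>F N in odd_numbers. dist (avg N (\<lambda>w. f (T w))) (\<integral>x. f (\<lambda>A\<in>W. Zlim A x) \<partial>M) < \<epsilon>"
      using ev_s ev_t ev_c
    proof eventually_elim
      case (elim N)
      have one: "avg N (\<lambda>_. 1) = 1" using elim(3) by (simp add: avg_def)
      have ind: "(\<Sum>k\<in>K n. h k * of_bool (T w = k)) = (if T w \<in> K n then h (T w) else 0)" for h :: "_ \<Rightarrow> real" and w
      proof -
        have "(\<Sum>k\<in>K n. h k * of_bool (T w = k)) = (\<Sum>k\<in>K n. if k = T w then h (T w) else 0)" by (intro sum.cong) auto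
        then show ?thesis using finK by simp
      qed
      have eq: "avg N (\<lambda>w. f (T w)) - s N = avg N (\<lambda>w. f (T w) - (\<Sum>k\<in>K n. f k * of_bool (T w = k)))"
        by (simp only: s_def avg_diff avg_sum avg_cmult)
      have "\<bar>avg N (\<lambda>w. f (T w)) - s N\<bar> \<le> avg N (\<lambda>w. \<bar>f (T w) - (\<Sum>k\<in>K n. f k * of_bool (T w = k))\<bar>)"
        unfolding eq by (rule abs_avg_le)
      \<comment> \<open>Inside the box the difference is zero, and outside it is f at that point,
        bounded by B; the average is thus B times the mass outside.\<close>
      also have "\<dots> \<le> avg N (\<lambda>w. B * (1 - (\<Sum>k\<in>K n. 1 * of_bool (T w = k))))"
        unfolding ind by (intro avg_mono) (use B in auto)
      also have "\<dots> = B * (1 - t N)" by (simp only: avg_cmult avg_diff avg_sum one t_def mult_1)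
      finally have "\<bar>avg N (\<lambda>w. f (T w)) - s N\<bar> \<le> B * (1 - t N)" .
      moreover have "\<bar>s N - (\<Sum>k\<in>K n. f k * q k)\<bar> < \<epsilon> / 4" using elim(1) by (simp only: dist_real_def)
      ultimately show ?case unfolding dist_real_def using n(1) elim(2) by linarith
    qed
  qed
  moreover have "\<forall>\<^sub>F N in odd_numbers. avg N (\<lambda>w. f (T w)) = (\<integral>w. f (\<lambda>A\<in>W. Z A w) \<partial>uniform_count_measure (max_genus_gluings N))"
    unfolding eventually_odd_numbers
    by (rule eventually_mono[OF eventually_ge_at_top[of 1]])
      (simp add: integral_uniform_count_measure[OF finite_max_genus_gluings] avg_def T_def)
  ultimately show "((\<lambda>N. \<integral>w. f (\<lambda>A\<in>W. Z A w) \<partial>uniform_count_measure (max_genus_gluings N)) \<longlongrightarrow> (\<integral>x. f (\<lambda>A\<in>W. Zlim A x) \<partial>M)) odd_numbers"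
    by (rule Lim_transform_eventually)
qed

end
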